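(* Let $P\in\mathrm{Gr}(n,p)$ where $p\le\frac n2$. The conjugate locus $\mathrm{Conj}_P$ of $P$ consists of all points $F\in\mathrm{Gr}(n,p)$ with at least two identical principal angles between $F$ and $P$ or, when $p<\frac n2$, at least one zero principal angle between $F$ and $P$.
   Context: Let $n\geq 2$ and $p\ge 1$ be integers. $\mathrm{Gr}(n,p)=\{P\in\mathbb{R}^{n\times n}: P^T=P,\ P^2=P,\ \mathrm{rank}\,P=p\}$, an embedded submanifold of the symmetric $n\times n$ matrices, with tangent space $T_P\mathrm{Gr}(n,p)=\{\Delta=\Delta^T: \Delta P+P\Delta=\Delta\}$ and Riemannian metric $g_P(\Delta_1,\Delta_2)=\frac12\mathrm{tr}(\Delta_1\Delta_2)$. Geodesics from $P$ are $t\mapsto\mathrm{Exp}^{\mathrm{Gr}}_P(t\Delta)=\exp_m(t[\Delta,P])\,P\,\exp_m(-t[\Delta,P])$, with $\exp_m$ the matrix exponential and $[A,B]=AB-BA$. If $P=UU^T$ and $F=YY^T$ with $U,Y\in\mathbb{R}^{n\times p}$, $U^TU=Y^TY=I_p$, the $p$ principal angles between $P$ and $F$ are $\theta_k=\arccos(s_k)\in[0,\frac\pi2]$, $k=1,\dots,p$, where $s_1\ge\dots\ge s_p$ are the singular values of $U^TY$. "At least two identical principal angles" means $\theta_i=\theta_j$ for some $i\ne j$. A Jacobi field along a geodesic $\gamma$ is a smooth vector field $J$ along $\gamma$ with $D_t^2J+R(J,\dot\gamma)\dot\gamma=0$, where $D_t$ is the covariant derivative along $\gamma$ (Levi-Civita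 connection) and $R$ the Riemannian curvature tensor. The conjugate locus $\mathrm{Conj}_P$ is the set of all $F\in\mathrm{Gr}(n,p)$ such that there is a (not necessarily minimizing, nonconstant) geodesic segment from $P$ to $F$ and a Jacobi field along it, not identically zero, that vanishes at the endpoints $P$ and $F$ of the segment. *)

theory Defs
  imports "HOL-Analysis.Analysis"
begin

section \<open>The Grassmannian as an embedded submanifold\<close>

definition Gr :: "nat \<Rightarrow> (real^'n^'n) set" where
  "Gr p = {P. transpose P = P \<and> P ** P = P \<and> rank P = p}"

definition tangent_space :: "real^'n^'n \<Rightarrow> (real^'n^'n) set" where
  "tangent_space P = {\<Delta>. \<Delta> = transpose \<Delta> \<and> \<Delta> ** P + P ** \<Delta> = \<Delta>}"

text \<open>The metric has the same coefficients in every tangent space, so the base point is dropped.\<close>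

definition metric :: "real^'n^'n \<Rightarrow> real^'n^'n \<Rightarrow> real" where
  "metric \<Delta>1 \<Delta>2 = (1/2) * trace (\<Delta>1 ** \<Delta>2)"

text \<open>
  The exponential function of the library does not apply to matrices: multiplication on
  the type of matrices is entrywise, so the power series is written out.
\<close>

primrec matrix_power :: "real^'n^'n \<Rightarrow> nat \<Rightarrow> real^'n^'n" where
  "matrix_power A 0 = mat 1"
| "matrix_power A (Suc k) = A ** matrix_power A k"

definition matrix_exp :: "real^'n^'n \<Rightarrow> real^'n^'n" where
  "matrix_exp A = (\<Sum>k. (1 / fact k) *\<^sub>R matrix_power A k)"

definition commutator :: "real^'n^'n \<Rightarrow> real^'n^'n \<Rightarrow> real^'n^'n" where
  "commutator A B = A ** B - B ** A"

definition Exp_Gr :: "real^'n^'n \<Rightarrow> real^'n^'n \<Rightarrow> real^'n^'n" where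
  "Exp_Gr P \<Delta> = matrix_exp (commutator \<Delta> P) ** P ** matrix_exp (- commutator \<Delta> P)"


section \<open>Smooth functions and vector fields\<close>

text \<open>
  This is meant for sets on which derivatives are unique: open subsets of a
  Euclidean space, and closed real intervals with more than one point (where the derivatives
  at the endpoints are one-sided).
\<close>

primrec Ck_on :: "nat \<Rightarrow> ('a::euclidean_space \<Rightarrow> 'b::real_normed_vector) \<Rightarrow> 'a set \<Rightarrow> bool" where
  "Ck_on 0 f S \<longleftrightarrow> continuous_on S f"
| "Ck_on (Suc k) f S \<longleftrightarrow>
     (\<forall>x\<in>S. f differentiable (at x within S)) \<and>
     (\<forall>v. Ck_on k (\<lambda>x. frechet_derivative f (at x within S) v) S)"

definition smooth_on :: "('a::euclidean_space \<Rightarrow> 'b::real_normed_vector) \<Rightarrow> 'a set \<Rightarrow> bool" where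
  "smooth_on f S \<longleftrightarrow> (\<forall>k. Ck_on k f S)"

text \<open>
  Functions and vector fields on the Grassmannian are total functions of which only the values
  on \<open>Gr p\<close> matter. Smoothness on the embedded submanifold means the existence of local
  smooth extensions to the ambient space.
\<close>

definition smooth_on_Gr :: "nat \<Rightarrow> (real^'n^'n \<Rightarrow> 'b::real_normed_vector) \<Rightarrow> bool" where
  "smooth_on_Gr p f \<longleftrightarrow>
     (\<forall>P\<in>Gr p. \<exists>W g. open W \<and> P \<in> W \<and> smooth_on g W \<and> (\<forall>Q\<in>W \<inter> Gr p. f Q = g Q))"

definition vector_field :: "nat \<Rightarrow> (real^'n^'n \<Rightarrow> real^'n^'n) \<Rightarrow> bool" where
  "vector_field p X \<longleftrightarrow> smooth_on_Gr p X \<and> (\<forall>P\<in>Gr p. X P \<in> tangent_space P)"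

text \<open>
  The derivative of a function on \<open>Gr p\<close> in a tangent direction. All Frechet derivatives at
  \<open>P\<close> within \<open>Gr p\<close> agree on \<open>tangent_space P\<close>, and equal there the derivative of any local
  smooth extension; only tangent vectors \<open>v\<close> are used below.
\<close>

definition dir_deriv ::
    "nat \<Rightarrow> (real^'n^'n \<Rightarrow> 'b::real_normed_vector) \<Rightarrow> real^'n^'n \<Rightarrow> real^'n^'n \<Rightarrow> 'b" where
  "dir_deriv p f P v = frechet_derivative f (at P within Gr p) v"

text \<open>
  The identity \<open>[X,Y]f = X(Yf) - Y(Xf)\<close> for \<open>f\<close> ranging over the matrix entries, which
  are global smooth functions whose differentials separate tangent vectors.
\<close>

definition lie_bracket ::
    "nat \<Rightarrow> (real^'n^'n \<Rightarrow> real^'n^'n) \<Rightarrow> (real^'n^'n \<Rightarrow> real^'n^'n) \<Rightarrow> real^'n^'n \<Rightarrow> real^'n^'n" where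
  "lie_bracket p X Y P = dir_deriv p Y P (X P) - dir_deriv p X P (Y P)"


section \<open>Levi-Civita connection and curvature\<close>

text \<open>
  \<open>nab Y P v\<close> is the derivative of the vector field \<open>Y\<close> at \<open>P\<close> in the
  direction \<open>v\<close>; thus \<open>\<lambda>P. nab Y P (X P)\<close> is usually written with \<open>X\<close> as a subscript.
\<close>

type_synonym 'n connection = "(real^'n^'n \<Rightarrow> real^'n^'n) \<Rightarrow> real^'n^'n \<Rightarrow> real^'n^'n \<Rightarrow> real^'n^'n"

definition is_connection :: "nat \<Rightarrow> 'n::finite connection \<Rightarrow> bool" where
  "is_connection p nab \<longleftrightarrow>
     (\<forall>X Y. vector_field p X \<longrightarrow> vector_field p Y \<longrightarrow> vector_field p (\<lambda>P. nab Y P (X P))) \<and>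
     (\<forall>Y. vector_field p Y \<longrightarrow>
        (\<forall>P\<in>Gr p. \<forall>v\<in>tangent_space P. \<forall>w\<in>tangent_space P. \<forall>a b.
           nab Y P (a *\<^sub>R v + b *\<^sub>R w) = a *\<^sub>R nab Y P v + b *\<^sub>R nab Y P w)) \<and>
     (\<forall>Y Z. vector_field p Y \<longrightarrow> vector_field p Z \<longrightarrow>
        (\<forall>P\<in>Gr p. \<forall>v\<in>tangent_space P. nab (\<lambda>Q. Y Q + Z Q) P v = nab Y P v + nab Z P v)) \<and>
     (\<forall>f Y. smooth_on_Gr p f \<longrightarrow> vector_field p Y \<longrightarrow>
        (\<forall>P\<in>Gr p. \<forall>v\<in>tangent_space P.
           nab (\<lambda>Q. f Q *\<^sub>R Y Q) P v = dir_deriv p f P v *\<^sub>R Y P + f P *\<^sub>R nab Y P v))"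

definition torsion_free :: "nat \<Rightarrow> 'n::finite connection \<Rightarrow> bool" where
  "torsion_free p nab \<longleftrightarrow>
     (\<forall>X Y. vector_field p X \<longrightarrow> vector_field p Y \<longrightarrow>
        (\<forall>P\<in>Gr p. nab Y P (X P) - nab X P (Y P) = lie_bracket p X Y P))"

definition metric_compatible :: "nat \<Rightarrow> 'n::finite connection \<Rightarrow> bool" where
  "metric_compatible p nab \<longleftrightarrow>
     (\<forall>Y Z. vector_field p Y \<longrightarrow> vector_field p Z \<longrightarrow>
        (\<forall>P\<in>Gr p. \<forall>v\<in>tangent_space P.
           dir_deriv p (\<lambda>Q. metric (Y Q) (Z Q)) P v =
             metric (nab Y P v) (Z P) + metric (Y P) (nab Z P v)))"

text \<open>
  Such a connection is unique on vector fields, points of \<open>Gr p\<close> and tangent vectors. The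
  choice only concerns irrelevant values elsewhere.
\<close>

definition levi_civita :: "nat \<Rightarrow> 'n::finite connection" where
  "levi_civita p = (SOME nab. is_connection p nab \<and> torsion_free p nab \<and> metric_compatible p nab)"

text \<open>
  \<open>R(x,y)z\<close> for tangent vectors \<open>x\<close>, \<open>y\<close>, \<open>z\<close> at \<open>P\<close>: the common value for all
  extensions \<open>X\<close>, \<open>Y\<close>, \<open>Z\<close> to vector fields. The sign is the one for which the Jacobi equation
  has \<open>+ R(J, \<gamma>')\<gamma>'\<close>.
\<close>

definition curvature ::
    "nat \<Rightarrow> real^'n^'n \<Rightarrow> real^'n^'n \<Rightarrow> real^'n^'n \<Rightarrow> real^'n^'n \<Rightarrow> real^'n^'n" where
  "curvature p P x y z = (let nab = levi_civita p in
     (THE r. \<forall>X Y Z. vector_field p X \<and> vector_field p Y \<and> vector_field p Z \<and>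
                     X P = x \<and> Y P = y \<and> Z P = z \<longrightarrow>
        r = nab (\<lambda>Q. nab Z Q (Y Q)) P (X P) - nab (\<lambda>Q. nab Z Q (X Q)) P (Y P)
            - nab Z P (lie_bracket p X Y P)))"


section \<open>Jacobi fields and the conjugate locus\<close>

definition field_along :: "(real \<Rightarrow> real^'n^'n) \<Rightarrow> real set \<Rightarrow> (real \<Rightarrow> real^'n^'n) \<Rightarrow> bool" where
  "field_along \<gamma> T J \<longleftrightarrow> smooth_on J T \<and> (\<forall>t\<in>T. J t \<in> tangent_space (\<gamma> t))"

definition is_covariant_derivative_along ::
    "nat \<Rightarrow> (real \<Rightarrow> real^'n^'n) \<Rightarrow> real set \<Rightarrow> ((real \<Rightarrow> real^'n^'n) \<Rightarrow> real \<Rightarrow> real^'n^'n) \<Rightarrow> bool" where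
  "is_covariant_derivative_along p \<gamma> T D \<longleftrightarrow>
     (\<forall>J. field_along \<gamma> T J \<longrightarrow> field_along \<gamma> T (D J)) \<and>
     (\<forall>J K. field_along \<gamma> T J \<longrightarrow> field_along \<gamma> T K \<longrightarrow>
        (\<forall>t\<in>T. D (\<lambda>s. J s + K s) t = D J t + D K t)) \<and>
     (\<forall>f J. smooth_on f T \<longrightarrow> field_along \<gamma> T J \<longrightarrow>
        (\<forall>t\<in>T. D (\<lambda>s. f s *\<^sub>R J s) t =
           vector_derivative f (at t within T) *\<^sub>R J t + f t *\<^sub>R D J t)) \<and>
     (\<forall>X. vector_field p X \<longrightarrow>
        (\<forall>t\<in>T. D (\<lambda>s. X (\<gamma> s)) t =
           levi_civita p X (\<gamma> t) (vector_derivative \<gamma> (at t within T))))"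

definition covariant_derivative_along ::
    "nat \<Rightarrow> (real \<Rightarrow> real^'n^'n) \<Rightarrow> real set \<Rightarrow> (real \<Rightarrow> real^'n^'n) \<Rightarrow> real \<Rightarrow> real^'n^'n" where
  "covariant_derivative_along p \<gamma> T = (SOME D. is_covariant_derivative_along p \<gamma> T D)"

definition jacobi_field ::
    "nat \<Rightarrow> (real \<Rightarrow> real^'n^'n) \<Rightarrow> real set \<Rightarrow> (real \<Rightarrow> real^'n^'n) \<Rightarrow> bool" where
  "jacobi_field p \<gamma> T J \<longleftrightarrow>
     field_along \<gamma> T J \<and>
     (let D = covariant_derivative_along p \<gamma> T; \<gamma>' = (\<lambda>t. vector_derivative \<gamma> (at t within T)) in
        \<forall>t\<in>T. D (D J) t + curvature p (\<gamma> t) (J t) (\<gamma>' t) (\<gamma>' t) = 0)"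

text \<open>A geodesic \<open>t \<mapsto> Exp_Gr P (t *\<^sub>R \<Delta>)\<close> is nonconstant iff \<open>\<Delta> \<noteq> 0\<close>.\<close>

definition conjugate_locus :: "nat \<Rightarrow> real^'n^'n \<Rightarrow> (real^'n^'n) set" where
  "conjugate_locus p P = {F \<in> Gr p.
     \<exists>\<Delta>\<in>tangent_space P. \<Delta> \<noteq> 0 \<and>
       (\<exists>l>0. Exp_Gr P (l *\<^sub>R \<Delta>) = F \<and>
         (\<exists>J. jacobi_field p (\<lambda>t. Exp_Gr P (t *\<^sub>R \<Delta>)) {0..l} J \<and>
              (\<exists>t\<in>{0..l}. J t \<noteq> 0) \<and> J 0 = 0 \<and> J l = 0))}"


section \<open>Principal angles\<close>

text \<open>
  The nonincreasing list of the square roots of the eigenvalues of \<open>transpose M ** M\<close>, with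
  multiplicities as roots of the characteristic polynomial.
\<close>

definition singular_values :: "real^'p^'p \<Rightarrow> real list" where
  "singular_values M = (THE s. length s = CARD('p) \<and> sorted_wrt (\<ge>) s \<and> (\<forall>x\<in>set s. 0 \<le> x) \<and>
     (\<forall>x. det (mat x - transpose M ** M) = (\<Prod>y\<leftarrow>s. x - y\<^sup>2)))"

text \<open>
  The list does not depend on the matrices \<open>U\<close> and \<open>Y\<close> that represent \<open>P\<close> and \<open>F\<close>.
  The type argument provides the index type of their columns.
\<close>

definition principal_angles ::
    "'p::finite itself \<Rightarrow> real^'n^'n \<Rightarrow> real^'n^'n \<Rightarrow> real list" where
  "principal_angles T P F = (THE \<theta>. \<exists>U Y :: real^'p^'n.
     transpose U ** U = mat 1 \<and> transpose Y ** Y = mat 1 \<and>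
     P = U ** transpose U \<and> F = Y ** transpose Y \<and>
     \<theta> = map arccos (singular_values (transpose U ** Y)))"

end

theory Submission
  imports Defs
begin

text \<open>
  Put \<open>\<Omega> = [\<Delta>,P]\<close>. A field along the geodesic \<open>\<gamma>(t) = exp(t\<Omega>) P exp(-t\<Omega>)\<close> has the form
  \<open>exp(t\<Omega>) K(t) exp(-t\<Omega>)\<close> with \<open>K(t)\<close> tangent at \<open>P\<close>, and its covariant derivative is the one
  belonging to \<open>K'\<close>. As \<open>R(x,y)z = [[x,y],z]\<close>, the Jacobi equation reads \<open>K'' + [[K,\<Delta>],\<Delta>] = 0\<close>; in an
  orthonormal eigenbasis \<open>u\<^sub>a\<close> of \<open>\<Delta>\<close> with eigenvalues \<open>\<lambda>\<^sub>a\<close> the entries of \<open>K\<close> oscillate with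
  frequencies \<open>\<lambda>\<^sub>a - \<lambda>\<^sub>b\<close>. A conjugate point at time \<open>L\<close> thus gives \<open>a\<close>, \<open>b\<close> such that
  \<open>(\<lambda>\<^sub>a - \<lambda>\<^sub>b) L\<close> is a nonzero multiple of \<open>\<pi>\<close>. On the range of \<open>P\<close>, the map \<open>P \<gamma>(L) P\<close> is
  \<open>cos\<^sup>2(L\<Delta>)\<close>, and its eigenvalues are the squared cosines of the principal angles; so \<open>P u\<^sub>a\<close> and
  \<open>P u\<^sub>b\<close> are independent eigenvectors for a common eigenvalue unless one of them vanishes, which forces the
  eigenvalue 1. Conversely, adding \<open>\<pi>\<close> to one angle of a geodesic from \<open>P\<close> to \<open>F\<close> does not change
  its endpoint and creates the required frequency \<open>\<pi>\<close>.
\<close>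

text \<open>Independence of \<open>P u\<^sub>a\<close> and \<open>P u\<^sub>b\<close> has one
  obstacle. The reflection \<open>2P - 1\<close> anticommutes with tangent vectors at
  \<open>P\<close>, so it carries an eigenvector \<open>u\<close> of \<Delta> to one for the
  opposite eigenvalue, with the same image under \<open>P\<close>. Such a pair carries no Jacobi
  field: for tangent \<open>K\<close>, the matrix \<open>K (2P - 1) = K P - P K\<close> is skew, so
  the entry of \<open>K\<close> between \<open>u\<close> and \<open>(2P - 1) u\<close> is zero. The
  distinction between \<open>n > 2p\<close> and \<open>n = 2p\<close> comes from directions in the
  kernel of \<open>P\<close> that \<Delta> kills. If \<open>n > 2p\<close>, they always exist, and
  one zero angle, lengthened to \<pi>, already oscillates against them. If \<open>n = 2p\<close>,
  such a direction forces one in the range of \<open>P\<close> as well, hence a second zero angle.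
  Connection and covariant derivative are chosen by axioms alone. They become accessible by
  exhibiting a model, the tangential part of the ambient derivative, and by showing that the axioms
  leave no freedom on vector fields and tangent vectors.\<close>

section \<open>Calculus of \<open>Ck_on\<close>\<close>

text \<open>The condition under which derivatives within a set are unique: each point can be
  approached inside \<open>S\<close> along every coordinate axis, from one side at least. Open sets
  and closed intervals of positive length both qualify, so the calculus is developed once for
  both.\<close>

definition deriv_unique_on :: "'a::euclidean_space set \<Rightarrow> bool" where
  "deriv_unique_on S \<longleftrightarrow>
     (\<forall>x\<in>S. \<forall>i\<in>Basis. \<forall>e>0. \<exists>d. 0 < \<bar>d\<bar> \<and> \<bar>d\<bar> < e \<and> x + d *\<^sub>R i \<in> S)"

lemma deriv_unique_on_open:
  assumes "open S"
  shows "deriv_unique_on S"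
  unfolding deriv_unique_on_def
proof (intro ballI allI impI)
  fix x i :: 'a and e :: real
  assume x: "x \<in> S" and i: "i \<in> Basis" and e: "0 < e"
  from assms x obtain r where r: "0 < r" "ball x r \<subseteq> S"
    by (meson open_contains_ball)
  define d where "d = min (r/2) (e/2)"
  have "x + d *\<^sub>R i \<in> ball x r"
    using r e i by (auto simp: dist_norm d_def)
  then show "\<exists>d. 0 < \<bar>d\<bar> \<and> \<bar>d\<bar> < e \<and> x + d *\<^sub>R i \<in> S"
    using r e by (intro exI[of _ d]) (auto simp: d_def)
qed

lemma deriv_unique_on_interval:
  fixes a b :: real
  assumes "a < b"
  shows "deriv_unique_on {a..b}"
  unfolding deriv_unique_on_def
proof (intro ballI allI impI)
  fix x i :: real and e :: real
  assume x: "x \<in> {a..b}" and i: "i \<in> Basis" and e: "0 < e"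
  have [simp]: "i = 1" using i by simp
  show "\<exists>d. 0 < \<bar>d\<bar> \<and> \<bar>d\<bar> < e \<and> x + d *\<^sub>R i \<in> {a..b}"
  proof (cases "x < b")
    case True
    then show ?thesis using x e
      by (intro exI[of _ "min (b - x) (e/2)"]) (auto simp: min_def)
  next
    case False
    then show ?thesis using x e assms
      by (intro exI[of _ "- min (b - a) (e/2)"]) (auto simp: min_def)
  qed
qed

lemma frechet_derivative_within_eq:
  assumes "deriv_unique_on S" "x \<in> S" "(f has_derivative f') (at x within S)"
  shows "frechet_derivative f (at x within S) = f'"
proof (rule frechet_derivative_unique_within)
  show "(f has_derivative frechet_derivative f (at x within S)) (at x within S)"
    using assms(3) frechet_derivative_works differentiableI by blast
  show "(f has_derivative f') (at x within S)" by fact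
  fix i e assume "i \<in> (Basis::'a set)" "(e::real) > 0"
  then show "\<exists>d. 0 < \<bar>d\<bar> \<and> \<bar>d\<bar> < e \<and> x + d *\<^sub>R i \<in> S"
    using assms unfolding deriv_unique_on_def by blast
qed

lemma frechet_derivative_within_cong:
  assumes "x \<in> S" "\<And>y. y \<in> S \<Longrightarrow> f y = g y"
  shows "frechet_derivative f (at x within S) = frechet_derivative g (at x within S)"
proof -
  have "(f has_derivative f') (at x within S) \<longleftrightarrow> (g has_derivative f') (at x within S)" for f'
    using has_derivative_transform[of x S g f f'] has_derivative_transform[of x S f g f'] assms by auto
  then show ?thesis by (simp add: frechet_derivative_def)
qed

lemma Ck_on_cong:
  assumes "\<And>x. x \<in> S \<Longrightarrow> f x = g x"
  shows "Ck_on k f S \<longleftrightarrow> Ck_on k g S"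
  using assms
proof (induction k arbitrary: f g)
  case 0
  then show ?case by (simp cong: continuous_on_cong)
next
  case (Suc k)
  have 1: "f differentiable (at x within S) \<longleftrightarrow> g differentiable (at x within S)" if "x \<in> S" for x
    using has_derivative_transform[of x S g f] has_derivative_transform[of x S f g] Suc.prems that
    by (fastforce simp: differentiable_def)
  have 2: "Ck_on k (\<lambda>x. frechet_derivative f (at x within S) v) S
       \<longleftrightarrow> Ck_on k (\<lambda>x. frechet_derivative g (at x within S) v) S" for v
  proof (rule Suc.IH)
    fix x assume "x \<in> S"
    then have "frechet_derivative f (at x within S) = frechet_derivative g (at x within S)"
      by (rule frechet_derivative_within_cong) (rule Suc.prems)
    then show "frechet_derivative f (at x within S) v = frechet_derivative g (at x within S) v"
      by simp
  qed
  show ?case using 1 2 by simp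
qed

lemma smooth_on_cong:
  assumes "\<And>x. x \<in> S \<Longrightarrow> f x = g x"
  shows "smooth_on f S \<longleftrightarrow> smooth_on g S"
  unfolding smooth_on_def using Ck_on_cong[of S f g] assms by simp

text \<open>Lets any known derivative formula stand in for \<open>frechet_derivative\<close>. The
  closure properties below are inductions on \<open>k\<close> through this rule.\<close>

lemma Ck_on_SucI:
  assumes "deriv_unique_on S"
    and "\<And>x. x \<in> S \<Longrightarrow> (f has_derivative f' x) (at x within S)"
    and "\<And>v. Ck_on k (\<lambda>x. f' x v) S"
  shows "Ck_on (Suc k) f S"
proof -
  have "Ck_on k (\<lambda>x. frechet_derivative f (at x within S) v) S \<longleftrightarrow> Ck_on k (\<lambda>x. f' x v) S" for v
    by (rule Ck_on_cong) (simp add: frechet_derivative_within_eq[OF assms(1) _ assms(2)])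
  then show ?thesis using assms by (auto intro: differentiableI)
qed

lemma Ck_on_SucD_deriv:
  assumes "Ck_on (Suc k) f S" "x \<in> S"
  shows "(f has_derivative frechet_derivative f (at x within S)) (at x within S)"
  using assms frechet_derivative_works by auto

lemma Ck_on_SucD: "Ck_on (Suc k) f S \<Longrightarrow> Ck_on k f S"
proof (induction k arbitrary: f)
  case 0
  then show ?case
    by (auto intro!: differentiable_imp_continuous_on simp: differentiable_on_def)
next
  case (Suc k)
  then show ?case by (metis Ck_on.simps(2))
qed

lemma Ck_on_const: "deriv_unique_on S \<Longrightarrow> Ck_on k (\<lambda>x. c) S"
proof (induction k arbitrary: c)
  case (Suc k)
  show ?case by (rule Ck_on_SucI[where f'="\<lambda>x v. 0"]) (use Suc in auto)
qed auto

lemma Ck_on_ident: "deriv_unique_on S \<Longrightarrow> Ck_on k (\<lambda>x. x) S"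
proof (cases k)
  case (Suc n)
  assume *: "deriv_unique_on S"
  show ?thesis unfolding Suc
    by (rule Ck_on_SucI[where f'="\<lambda>x v. v"]) (use * Ck_on_const in \<open>auto intro!: derivative_eq_intros\<close>)
qed auto

lemma Ck_on_linear:
  assumes "deriv_unique_on S" "bounded_linear L" "Ck_on k f S"
  shows "Ck_on k (\<lambda>x. L (f x)) S"
  using assms(3)
proof (induction k arbitrary: f)
  case 0
  then show ?case using assms(2) by (simp add: linear_continuous_on_compose bounded_linear.continuous_on)
next
  case (Suc k)
  show ?case
  proof (rule Ck_on_SucI[OF assms(1)])
    show "((\<lambda>x. L (f x)) has_derivative (\<lambda>v. L (frechet_derivative f (at x within S) v))) (at x within S)"
      if "x \<in> S" for x
      by (rule bounded_linear.has_derivative[OF assms(2) Ck_on_SucD_deriv[OF Suc.prems that]])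
  qed (use Suc in auto)
qed

lemma Ck_on_add:
  assumes "deriv_unique_on S" "Ck_on k f S" "Ck_on k g S"
  shows "Ck_on k (\<lambda>x. f x + g x) S"
  using assms(2,3)
proof (induction k arbitrary: f g)
  case 0
  then show ?case by (simp add: continuous_on_add)
next
  case (Suc k)
  show ?case
  proof (rule Ck_on_SucI[OF assms(1)])
    show "((\<lambda>x. f x + g x) has_derivative (\<lambda>v. frechet_derivative f (at x within S) v
        + frechet_derivative g (at x within S) v)) (at x within S)"
      if "x \<in> S" for x
      by (rule has_derivative_add[OF Ck_on_SucD_deriv[OF Suc.prems(1) that] Ck_on_SucD_deriv[OF Suc.prems(2) that]])
  qed (use Suc in auto)
qed

text \<open>In each summand of the product rule one factor is differentiated and the other is
  lowered from class \<open>Suc k\<close> to \<open>k\<close> by \<open>Ck_on_SucD\<close>, so the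
  induction hypothesis covers both.\<close>

lemma Ck_on_bilinear:
  assumes "deriv_unique_on S" "bounded_bilinear B" "Ck_on k f S" "Ck_on k g S"
  shows "Ck_on k (\<lambda>x. B (f x) (g x)) S"
  using assms(3,4)
proof (induction k arbitrary: f g)
  case 0
  then show ?case by (simp add: bounded_bilinear.continuous_on[OF assms(2)])
next
  case (Suc k)
  show ?case
  proof (rule Ck_on_SucI[OF assms(1)])
    show "((\<lambda>x. B (f x) (g x)) has_derivative (\<lambda>v. B (f x) (frechet_derivative g (at x within S) v)
        + B (frechet_derivative f (at x within S) v) (g x))) (at x within S)"
      if "x \<in> S" for x
      by (rule bounded_bilinear.FDERIV[OF assms(2) Ck_on_SucD_deriv[OF Suc.prems(1) that]
            Ck_on_SucD_deriv[OF Suc.prems(2) that]])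
  next
    fix v
    show "Ck_on k (\<lambda>x. B (f x) (frechet_derivative g (at x within S) v)
        + B (frechet_derivative f (at x within S) v) (g x)) S"
      proof (rule Ck_on_add[OF assms(1)])
      show "Ck_on k (\<lambda>x. B (f x) (frechet_derivative g (at x within S) v)) S"
        by (rule Suc.IH[OF Ck_on_SucD[OF Suc.prems(1)]]) (use Suc.prems in simp)
      show "Ck_on k (\<lambda>x. B (frechet_derivative f (at x within S) v) (g x)) S"
        by (rule Suc.IH[OF _ Ck_on_SucD[OF Suc.prems(2)]]) (use Suc.prems in simp)
    qed
  qed
qed

lemma Ck_on_subset_open:
  assumes "open S" "open T" "T \<subseteq> S" "Ck_on k f S"
  shows "Ck_on k f T"
  using assms(4)
proof (induction k arbitrary: f)
  case 0
  then show ?case using assms(3) continuous_on_subset by auto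
next
  case (Suc k)
  show ?case
  proof (rule Ck_on_SucI[OF deriv_unique_on_open[OF assms(2)]])
    show "(f has_derivative (frechet_derivative f (at x within S))) (at x within T)" if "x \<in> T" for x
      using Ck_on_SucD_deriv[OF Suc.prems, of x] that assms(3) has_derivative_subset by blast
  qed (use Suc in auto)
qed

lemma smooth_onD:
  assumes "smooth_on f S"
  shows "\<And>x. x \<in> S \<Longrightarrow> (f has_derivative frechet_derivative f (at x within S)) (at x within S)"
    and "smooth_on (\<lambda>x. frechet_derivative f (at x within S) v) S"
proof -
  have "Ck_on (Suc k) f S" for k using assms by (simp only: smooth_on_def)
  then show "\<And>x. x \<in> S \<Longrightarrow> (f has_derivative frechet_derivative f (at x within S)) (at x within S)"
    and "smooth_on (\<lambda>x. frechet_derivative f (at x within S) v) S"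
    by (auto simp: smooth_on_def frechet_derivative_works)
qed

lemma smooth_on_continuous: "smooth_on f S \<Longrightarrow> continuous_on S f"
  unfolding smooth_on_def by (metis Ck_on.simps(1))

lemma smooth_on_const: "deriv_unique_on S \<Longrightarrow> smooth_on (\<lambda>x. c) S"
  by (simp add: smooth_on_def Ck_on_const)

lemma smooth_on_ident: "deriv_unique_on S \<Longrightarrow> smooth_on (\<lambda>x. x) S"
  by (simp add: smooth_on_def Ck_on_ident)

lemma smooth_on_linear:
  "deriv_unique_on S \<Longrightarrow> bounded_linear L \<Longrightarrow> smooth_on f S \<Longrightarrow> smooth_on (\<lambda>x. L (f x)) S"
  by (simp add: smooth_on_def Ck_on_linear)

lemma smooth_on_add:
  "deriv_unique_on S \<Longrightarrow> smooth_on f S \<Longrightarrow> smooth_on g S \<Longrightarrow> smooth_on (\<lambda>x. f x + g x) S"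
  by (simp add: smooth_on_def Ck_on_add)

lemma smooth_on_bilinear:
  "deriv_unique_on S \<Longrightarrow> bounded_bilinear B \<Longrightarrow> smooth_on f S \<Longrightarrow> smooth_on g S
     \<Longrightarrow> smooth_on (\<lambda>x. B (f x) (g x)) S"
  by (simp add: smooth_on_def Ck_on_bilinear)

lemma smooth_on_subset_open: "open S \<Longrightarrow> open T \<Longrightarrow> T \<subseteq> S \<Longrightarrow> smooth_on f S \<Longrightarrow> smooth_on f T"
  using Ck_on_subset_open smooth_on_def by metis

lemma smooth_on_diff:
  fixes f g :: "'a::euclidean_space \<Rightarrow> 'b::real_normed_vector"
  assumes "deriv_unique_on S" "smooth_on f S" "smooth_on g S"
  shows "smooth_on (\<lambda>x. f x - g x) S"
proof -
  have "smooth_on (\<lambda>x. f x + - g x) S"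
    using smooth_on_linear[OF assms(1) bounded_linear_minus[OF bounded_linear_ident] assms(3)]
    by (intro smooth_on_add assms)
  then show ?thesis by simp
qed

lemma smooth_on_sum:
  assumes "deriv_unique_on S" "finite I" "\<And>i. i \<in> I \<Longrightarrow> smooth_on (f i) S"
  shows "smooth_on (\<lambda>x. \<Sum>i\<in>I. f i x) S"
  using assms(2,3)
  by (induction I rule: finite_induct) (simp_all add: smooth_on_const smooth_on_add assms(1))

text \<open>Bootstrapping for a curve that solves a differential equation: if the right-hand side
  inherits the regularity of the curve, each pass gains one derivative. It serves for conjugation by
  \<open>matrix_exp\<close>, where the derivative is a linear function of the curve.\<close>

lemma smooth_onI_deriv:
  fixes f :: "real \<Rightarrow> 'b::real_normed_vector"
  assumes "deriv_unique_on S"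
    and "\<And>x. x \<in> S \<Longrightarrow> (f has_vector_derivative f' x) (at x within S)"
    and "\<And>k. Ck_on k f S \<Longrightarrow> Ck_on k f' S"
  shows "smooth_on f S"
proof -
  have "Ck_on k f S" for k
  proof (induction k)
    case 0
    then show ?case
      by (auto simp: continuous_on_eq_continuous_within intro: has_vector_derivative_continuous assms(2))
  next
    case (Suc k)
    show ?case
      by (rule Ck_on_SucI[where f'="\<lambda>x v. v *\<^sub>R f' x", OF assms(1)])
        (use assms(2) Ck_on_linear[OF assms(1) bounded_linear_scaleR_right assms(3)[OF Suc]] in \<open>auto simp: has_vector_derivative_def\<close>)
  qed
  then show ?thesis by (simp add: smooth_on_def)
qed

lemma smooth_on_vector_derivative:
  fixes f :: "real \<Rightarrow> 'b::real_normed_vector"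
  assumes "a < b" "smooth_on f {a..b}"
  shows "\<And>x. x \<in> {a..b} \<Longrightarrow> (f has_vector_derivative vector_derivative f (at x within {a..b})) (at x within {a..b})"
    and "smooth_on (\<lambda>x. vector_derivative f (at x within {a..b})) {a..b}"
proof -
  show 1: "(f has_vector_derivative vector_derivative f (at x within {a..b})) (at x within {a..b})" if "x \<in> {a..b}" for x
    using smooth_onD(1)[OF assms(2) that] vector_derivative_works differentiableI by blast
  have "frechet_derivative f (at x within {a..b}) 1 = vector_derivative f (at x within {a..b})" if "x \<in> {a..b}" for x
    using frechet_derivative_within_eq[OF deriv_unique_on_interval[OF assms(1)] that 1[OF that, unfolded has_vector_derivative_def]]
    by simp
  then show "smooth_on (\<lambda>x. vector_derivative f (at x within {a..b})) {a..b}"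
    using smooth_onD(2)[OF assms(2), of 1]
      smooth_on_cong[of "{a..b}" "\<lambda>x. frechet_derivative f (at x within {a..b}) 1"
        "\<lambda>x. vector_derivative f (at x within {a..b})"] by simp
qed

text \<open>Both orders of differentiation are limits of the same second difference, by applying the
  mean value theorem twice.\<close>

lemma second_difference_mvt:
  fixes g :: "'a::real_normed_vector \<Rightarrow> real"
  assumes r: "ball P r \<subseteq> W" and h: "0 < h" "h * (norm x + norm y) < r"
    and d: "\<And>Q. Q \<in> W \<Longrightarrow> (g has_derivative g' Q) (at Q)"
    and dd: "\<And>Q. Q \<in> W \<Longrightarrow> ((\<lambda>Q. g' Q x) has_derivative g'' Q) (at Q)"
  shows "\<exists>s t. 0 \<le> s \<and> s \<le> h \<and> 0 \<le> t \<and> t \<le> h \<and>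
    g (P + h *\<^sub>R x + h *\<^sub>R y) - g (P + h *\<^sub>R x) - g (P + h *\<^sub>R y) + g P
      = h * h * g'' (P + s *\<^sub>R x + t *\<^sub>R y) y"
proof -
  have inW: "P + s *\<^sub>R x + t *\<^sub>R y \<in> W" if "0 \<le> s" "s \<le> h" "0 \<le> t" "t \<le> h" for s t
  proof -
    have "norm (s *\<^sub>R x + t *\<^sub>R y) \<le> s * norm x + t * norm y"
      using that norm_triangle_ineq[of "s *\<^sub>R x" "t *\<^sub>R y"] by simp
    also have "\<dots> \<le> h * norm x + h * norm y"
      using that by (intro add_mono mult_right_mono) auto
    also have "\<dots> < r" using h by (simp add: algebra_simps)
    finally have "dist (P + s *\<^sub>R x + t *\<^sub>R y) P < r"
      by (simp add: dist_norm add.assoc)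
    then show ?thesis using r by (auto simp: dist_commute)
  qed
  \<comment> \<open>The increment of \<open>\<phi>\<close> from 0 to \<open>h\<close> is the second
    difference. One mean value is taken here in direction \<open>x\<close>; the increment of
    \<open>g'\<close> that it leaves is treated in direction \<open>y\<close> through
    \<open>\<psi>\<close>.\<close>
  define \<phi> where "\<phi> s = g (P + s *\<^sub>R x + h *\<^sub>R y) - g (P + s *\<^sub>R x)" for s
  have \<phi>d: "(\<phi> has_real_derivative (g' (P + s *\<^sub>R x + h *\<^sub>R y) x - g' (P + s *\<^sub>R x) x)) (at s)"
    if "0 \<le> s" "s \<le> h" for s
  proof -
    have a: "((\<lambda>s. g (P + s *\<^sub>R x + c *\<^sub>R y)) has_derivative (\<lambda>u. g' (P + s *\<^sub>R x + c *\<^sub>R y) (u *\<^sub>R x))) (at s)"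
      if "0 \<le> c" "c \<le> h" for c
      by (rule has_derivative_compose[where g=g and f="\<lambda>s. P + s *\<^sub>R x + c *\<^sub>R y"])
         (use that \<open>0 \<le> s\<close> \<open>s \<le> h\<close> in \<open>auto intro!: derivative_eq_intros d inW\<close>)
    have lin: "g' Q (u *\<^sub>R x) = u * g' Q x" if "Q \<in> W" for u Q
      using d[OF that] has_derivative_linear linear_cmul by fastforce
    have "(\<phi> has_derivative (\<lambda>u. g' (P + s *\<^sub>R x + h *\<^sub>R y) (u *\<^sub>R x) - g' (P + s *\<^sub>R x) (u *\<^sub>R x))) (at s)"
      unfolding \<phi>_def using a[of h] a[of 0] h by (intro has_derivative_diff) auto
    moreover have "(\<lambda>u. g' (P + s *\<^sub>R x + h *\<^sub>R y) (u *\<^sub>R x) - g' (P + s *\<^sub>R x) (u *\<^sub>R x))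
        = (*) (g' (P + s *\<^sub>R x + h *\<^sub>R y) x - g' (P + s *\<^sub>R x) x)"
      using lin[OF inW[of s h]] lin[of "P + s *\<^sub>R x"] inW[of s 0] that h
      by (auto simp: algebra_simps)
    ultimately show ?thesis unfolding has_field_derivative_def by simp
  qed
  obtain s where s: "0 < s" "s < h" "\<phi> h - \<phi> 0 = (h - 0) * (g' (P + s *\<^sub>R x + h *\<^sub>R y) x - g' (P + s *\<^sub>R x) x)"
    using MVT2[of 0 h \<phi>, OF h(1) \<phi>d] by auto
  define \<psi> where "\<psi> t = g' (P + s *\<^sub>R x + t *\<^sub>R y) x" for t
  have \<psi>d: "(\<psi> has_real_derivative (g'' (P + s *\<^sub>R x + t *\<^sub>R y) y)) (at t)" if "0 \<le> t" "t \<le> h" for t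
  proof -
    have W: "P + s *\<^sub>R x + t *\<^sub>R y \<in> W" using inW that s by auto
    have "(\<psi> has_derivative (\<lambda>u. g'' (P + s *\<^sub>R x + t *\<^sub>R y) (u *\<^sub>R y))) (at t)"
      unfolding \<psi>_def
      by (rule has_derivative_compose[where f="\<lambda>t. P + s *\<^sub>R x + t *\<^sub>R y"])
         (auto intro!: derivative_eq_intros dd[OF W])
    moreover have "g'' (P + s *\<^sub>R x + t *\<^sub>R y) (u *\<^sub>R y) = u * g'' (P + s *\<^sub>R x + t *\<^sub>R y) y" for u
      using dd[OF W] has_derivative_linear linear_cmul by fastforce
    ultimately show ?thesis unfolding has_field_derivative_def
      by (simp add: mult.commute[of "g'' _ _"] mult_commute_abs)
  qed
  obtain t where t: "0 < t" "t < h" "\<psi> h - \<psi> 0 = (h - 0) * g'' (P + s *\<^sub>R x + t *\<^sub>R y) y"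
    using MVT2[of 0 h \<psi>, OF h(1) \<psi>d] by auto
  show ?thesis
    using s t by (intro exI[of _ s] exI[of _ t]) (simp add: \<phi>_def \<psi>_def algebra_simps)
qed

lemma second_difference_tendsto:
  fixes g :: "'a::real_normed_vector \<Rightarrow> real"
  assumes W: "open W" "P \<in> W"
    and d: "\<And>Q. Q \<in> W \<Longrightarrow> (g has_derivative g' Q) (at Q)"
    and dd: "\<And>Q. Q \<in> W \<Longrightarrow> ((\<lambda>Q. g' Q x) has_derivative g'' Q) (at Q)"
    and c: "isCont (\<lambda>Q. g'' Q y) P"
  shows "((\<lambda>h. (g (P + h *\<^sub>R x + h *\<^sub>R y) - g (P + h *\<^sub>R x) - g (P + h *\<^sub>R y) + g P) / (h*h))
    \<longlongrightarrow> g'' P y) (at_right 0)"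
proof (rule tendstoI)
  fix e :: real assume e: "0 < e"
  obtain r where r: "r > 0" "ball P r \<subseteq> W" using W open_contains_ball by metis
  obtain q where q: "q > 0" "\<And>Q. dist Q P < q \<Longrightarrow> dist (g'' Q y) (g'' P y) < e"
    using c e unfolding continuous_at_eps_delta by blast
  \<comment> \<open>The summand 1 covers \<open>x = y = 0\<close>; the minimum keeps the
    intermediate point both in \<open>W\<close> and within the continuity radius
    \<open>q\<close>.\<close>
  define m where "m = min r q / (norm x + norm y + 1)"
  have m: "m > 0" using r q by (auto simp: m_def intro!: divide_pos_pos add_nonneg_pos)
  show "\<forall>\<^sub>F h in at_right 0. dist ((g (P + h *\<^sub>R x + h *\<^sub>R y) - g (P + h *\<^sub>R x) - g (P + h *\<^sub>R y) + g P) / (h*h)) (g'' P y) < e"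
    unfolding eventually_at_right_field
  proof (intro exI[of _ m] conjI m allI impI)
    fix h assume h: "0 < h" "h < m"
    have n: "0 < norm x + norm y + 1" by (simp add: add_nonneg_pos)
    have "h * (norm x + norm y) \<le> h * (norm x + norm y + 1)" using h by simp
    also have "\<dots> < m * (norm x + norm y + 1)"
      using h n mult_strict_right_mono by blast
    also have "\<dots> = min r q" using n by (simp add: m_def)
    finally have hh: "h * (norm x + norm y) < min r q" .
    then obtain s t where st: "0 \<le> s" "s \<le> h" "0 \<le> t" "t \<le> h"
      "g (P + h *\<^sub>R x + h *\<^sub>R y) - g (P + h *\<^sub>R x) - g (P + h *\<^sub>R y) + g P
        = h * h * g'' (P + s *\<^sub>R x + t *\<^sub>R y) y"
      using second_difference_mvt[OF r(2) h(1) _ d dd, where y=y] by auto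
    have "norm (s *\<^sub>R x + t *\<^sub>R y) \<le> s * norm x + t * norm y"
      using st norm_triangle_ineq[of "s *\<^sub>R x" "t *\<^sub>R y"] by simp
    also have "\<dots> \<le> h * norm x + h * norm y"
      using st by (intro add_mono mult_right_mono) auto
    also have "\<dots> < q" using hh by (simp add: algebra_simps)
    finally have "dist (P + s *\<^sub>R x + t *\<^sub>R y) P < q"
      by (simp add: dist_norm add.assoc)
    from q(2)[OF this] st(5) h
    show "dist ((g (P + h *\<^sub>R x + h *\<^sub>R y) - g (P + h *\<^sub>R x) - g (P + h *\<^sub>R y) + g P) / (h*h)) (g'' P y) < e"
      by simp
  qed
qed

lemma smooth_on_openD:
  assumes "open W" "smooth_on f W" "Q \<in> W"
  shows "(f has_derivative frechet_derivative f (at Q within W)) (at Q)"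
  using smooth_onD(1)[OF assms(2,3)] at_within_open[OF assms(3,1)] by simp

lemma second_derivative_symmetric_real:
  fixes f :: "'a::euclidean_space \<Rightarrow> real"
  assumes W: "open W" "P \<in> W" and f: "smooth_on f W"
  shows "frechet_derivative (\<lambda>Q. frechet_derivative f (at Q within W) x) (at P within W) y
       = frechet_derivative (\<lambda>Q. frechet_derivative f (at Q within W) y) (at P within W) x"
proof -
  let ?D = "\<lambda>Q. frechet_derivative f (at Q within W)"
  let ?DD = "\<lambda>v Q. frechet_derivative (\<lambda>Q. ?D Q v) (at Q within W)"
  have sm: "smooth_on (\<lambda>Q. ?D Q v) W" for v by (rule smooth_onD(2)[OF f])
  have cont: "isCont (\<lambda>Q. ?DD v Q w) P" for v w
    using smooth_on_continuous[OF smooth_onD(2)[OF sm]] continuous_on_eq_continuous_at W by blast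
  note lim = second_difference_tendsto[OF W, of f ?D _ "?DD _", OF smooth_on_openD[OF W(1) f]
      smooth_on_openD[OF W(1) sm] cont]
  have "?DD x P y = ?DD y P x"
  proof (rule tendsto_unique[OF _ lim[of x y]])
    show "((\<lambda>h. (f (P + h *\<^sub>R x + h *\<^sub>R y) - f (P + h *\<^sub>R x) - f (P + h *\<^sub>R y) + f P) / (h * h)) \<longlongrightarrow> ?DD y P x)
     (at_right 0)"
      using lim[of y x] by (simp add: algebra_simps)
  qed auto
  then show ?thesis .
qed

text \<open>By coordinates, as the mean value theorem behind the real case has no vector-valued
  form.\<close>

lemma second_derivative_symmetric:
  fixes f :: "'a::euclidean_space \<Rightarrow> 'b::euclidean_space"
  assumes W: "open W" "P \<in> W" and f: "smooth_on f W"
  shows "frechet_derivative (\<lambda>Q. frechet_derivative f (at Q within W) x) (at P within W) y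
       = frechet_derivative (\<lambda>Q. frechet_derivative f (at Q within W) y) (at P within W) x"
proof (rule euclidean_eqI)
  fix b :: 'b assume "b \<in> Basis"
  note U = deriv_unique_on_open[OF W(1)]
  let ?D = "\<lambda>f Q. frechet_derivative f (at Q within W)"
  have in1: "?D (\<lambda>Q. g Q \<bullet> b) Q v = ?D g Q v \<bullet> b" if "smooth_on g W" "Q \<in> W" for v Q and g :: "'a \<Rightarrow> 'b"
    using frechet_derivative_within_eq[OF U that(2) has_derivative_inner_left[OF smooth_onD(1)[OF that]], of b]
    by simp
  have sb: "smooth_on (\<lambda>Q. f Q \<bullet> b) W"
    by (rule smooth_on_linear[OF U _ f]) (rule bounded_linear_inner_left)
  have "?D (\<lambda>Q. ?D f Q v) P w \<bullet> b = ?D (\<lambda>Q. ?D (\<lambda>Q. f Q \<bullet> b) Q v) P w" for v w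
  proof -
    have "?D (\<lambda>Q. ?D (\<lambda>Q. f Q \<bullet> b) Q v) P = ?D (\<lambda>Q. ?D f Q v \<bullet> b) P"
      by (rule frechet_derivative_within_cong[OF W(2)]) (rule in1[OF f])
    then show ?thesis using in1[OF smooth_onD(2)[OF f] W(2)] by simp
  qed
  then show "?D (\<lambda>Q. ?D f Q x) P y \<bullet> b = ?D (\<lambda>Q. ?D f Q y) P x \<bullet> b"
    using second_derivative_symmetric_real[OF W sb] by metis
qed

section \<open>Matrix algebra and the matrix exponential\<close>

lemma bounded_bilinear_matrix_mult:
  "bounded_bilinear ((**) :: real^'n^'m \<Rightarrow> real^'k^'n \<Rightarrow> real^'k^'m)"
  unfolding bilinear_conv_bounded_bilinear[symmetric] bilinear_def
  by (auto intro!: linearI simp: matrix_add_ldistrib matrix_matrix_mult_def vec_eq_iff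
      sum_distrib_left sum.distrib algebra_simps)

interpretation matrix_mult: bounded_bilinear "(**) :: real^'n^'m \<Rightarrow> real^'k^'n \<Rightarrow> real^'k^'m"
  by (rule bounded_bilinear_matrix_mult)

lemma bounded_bilinear_matrix_vector_mult:
  "bounded_bilinear ((*v) :: real^'n^'m \<Rightarrow> real^'n \<Rightarrow> real^'m)"
  unfolding bilinear_conv_bounded_bilinear[symmetric] bilinear_def
  by (auto intro!: linearI simp: matrix_vector_mult_def vec_eq_iff
      sum_distrib_left sum.distrib algebra_simps)

interpretation matrix_vector: bounded_bilinear "(*v) :: real^'n^'m \<Rightarrow> real^'n \<Rightarrow> real^'m"
  by (rule bounded_bilinear_matrix_vector_mult)

lemmas matrix_algebra = matrix_mult.add_left matrix_mult.add_right matrix_mult.diff_left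
  matrix_mult.diff_right matrix_mult.minus_left matrix_mult.minus_right matrix_mult.scaleR_left
  matrix_mult.scaleR_right matrix_mul_assoc[symmetric]

lemmas matrix_vector_algebra = matrix_vector.add_left matrix_vector.add_right matrix_vector.diff_left
  matrix_vector.diff_right matrix_vector.minus_left matrix_vector.minus_right matrix_vector.scaleR_left
  matrix_vector.scaleR_right matrix_vector_mul_assoc[symmetric]

lemma bounded_linear_transpose: "bounded_linear (transpose :: real^'n^'m \<Rightarrow> real^'m^'n)"
  by (auto intro!: linear_conv_bounded_linear[THEN iffD1] linearI simp: transpose_def vec_eq_iff)

lemma transpose_algebra:
  fixes A B :: "real^'n^'m"
  shows "transpose (A + B) = transpose A + transpose B" "transpose (A - B) = transpose A - transpose B"
    "transpose (- A) = - transpose A" "transpose (r *\<^sub>R A) = r *\<^sub>R transpose A"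
    "transpose (A ** C) = transpose C ** transpose A"
  by (simp_all add: matrix_transpose_mul) (simp_all add: transpose_def vec_eq_iff)

text \<open>Multiplication on matrices being entrywise, the simplifier may turn \<open>A + A\<close> into \<open>2 * A\<close>.\<close>

lemma numeral_times_matrix: "numeral k * (A :: real^'n^'m) = numeral k *\<^sub>R A"
proof -
  have "(numeral k :: real^'n^'m) $ i $ j = numeral k" for i j
    by (metis numeral_index)
  then show ?thesis by (simp add: vec_eq_iff)
qed

lemma inner_matrix_vector: "(x::real^'m) \<bullet> (A *v y) = (transpose A *v x) \<bullet> y"
  by (simp add: dot_lmul_matrix)



lemma inner_matrix_trace: "A \<bullet> B = trace (transpose A ** (B::real^'n^'m))"
  unfolding trace_def inner_vec_def matrix_matrix_mult_def transpose_def
  by (simp add: sum.swap[of _ "UNIV :: 'm set"])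

section \<open>The matrix exponential\<close>

lemma matrix_power_commute: "A ** matrix_power A k = matrix_power A k ** A"
proof (induction k)
  case (Suc k)
  have "A ** matrix_power A (Suc k) = A ** (matrix_power A k ** A)" using Suc by simp
  then show ?case by (simp add: matrix_mul_assoc)
qed simp

lemma matrix_power_scaleR: "matrix_power (t *\<^sub>R A) k = t ^ k *\<^sub>R matrix_power A k"
  by (induction k) (simp_all add: matrix_algebra)

lemma transpose_matrix_power: "transpose (matrix_power A k) = matrix_power (transpose A) k"
  by (induction k) (simp_all add: matrix_transpose_mul matrix_power_commute)

text \<open>Boundedness of the product makes the norm submultiplicative up to a constant
  \<open>K\<close>. Absorbing \<open>K\<close> into the base bounds the powers by those of
  \<open>norm A * K\<close>, up to a fixed factor, and leaves the scalar exponential series.\<close>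

lemma summable_matrix_exp:
  fixes A :: "real^'a^'a"
  shows "summable (\<lambda>k. (1 / fact k) *\<^sub>R matrix_power A k)"
proof -
  obtain K where K: "K \<ge> 0" "\<And>(X :: real^'a^'a) (Y :: real^'a^'a). norm (X ** Y) \<le> norm X * norm Y * K"
    using matrix_mult.nonneg_bounded by blast
  then have K0: "0 \<le> norm A * K" by simp
  have bound: "norm (matrix_power A k) \<le> norm (mat 1 :: real^'a^'a) * (norm A * K) ^ k" for k
  proof (induction k)
    case (Suc k)
    have "norm (matrix_power A (Suc k)) \<le> (norm A * K) * norm (matrix_power A k)"
      using K(2)[of A "matrix_power A k"] by (simp add: mult_ac)
    also have "\<dots> \<le> (norm A * K) * (norm (mat 1 :: real^'a^'a) * (norm A * K) ^ k)"
      by (rule mult_left_mono[OF Suc K0])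
    finally show ?case by (simp add: mult_ac)
  qed simp
  have "summable (\<lambda>k. norm (mat 1 :: real^'a^'a) * (inverse (fact k) * (norm A * K) ^ k))"
    by (intro summable_mult summable_exp)
  then show ?thesis
    by (rule summable_comparison_test'[where N=0])
       (use bound in \<open>auto simp: divide_simps mult_ac\<close>)
qed

lemma matrix_exp_linear:
  assumes "bounded_linear L"
  shows "L (matrix_exp A) = (\<Sum>k. (1 / fact k) *\<^sub>R L (matrix_power A k))"
  unfolding matrix_exp_def bounded_linear.suminf[OF assms summable_matrix_exp]
  by (simp add: linear_cmul[OF bounded_linear.linear[OF assms]])

lemma matrix_exp_commute: "A ** matrix_exp A = matrix_exp A ** A"
  using matrix_exp_linear[OF matrix_mult.bounded_linear_right, of A A]
    matrix_exp_linear[OF matrix_mult.bounded_linear_left, of A A]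
  by (simp add: matrix_power_commute)

lemma transpose_matrix_exp: "transpose (matrix_exp A) = matrix_exp (transpose A)"
  using matrix_exp_linear[OF bounded_linear_transpose, of A]
  by (simp add: transpose_matrix_power matrix_exp_def)

lemma matrix_exp_0 [simp]: "matrix_exp (0 :: real^'n^'n) = mat 1"
proof -
  have "(1 / fact k) *\<^sub>R matrix_power (0 :: real^'n^'n) k = (if k = 0 then mat 1 else 0)" for k
    by (cases k) auto
  then show ?thesis unfolding matrix_exp_def
    using suminf_finite[of "{0}" "\<lambda>k. if k = 0 then mat 1 else (0 :: real^'n^'n)"] by simp
qed

text \<open>Every entry is an everywhere convergent real power series in \<open>t\<close>. Termwise
  differentiation shifts its coefficients (\<open>diffs\<close>), which amounts to one more factor
  \<open>A\<close>.\<close>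

lemma has_vector_derivative_matrix_exp:
  fixes A :: "real^'a^'a"
  shows "((\<lambda>t. matrix_exp (t *\<^sub>R A)) has_vector_derivative (A ** matrix_exp (t *\<^sub>R A))) (at t within T)"
proof -
  have comp: "((\<lambda>t. matrix_exp (t *\<^sub>R A) $ i $ j) has_field_derivative (A ** matrix_exp (t *\<^sub>R A)) $ i $ j) (at t)" for i j
  proof -
    let ?c = "\<lambda>k. matrix_power A k $ i $ j / fact k"
    have bl: "bounded_linear (\<lambda>M::real^'a^'a. M $ i $ j)"
      by (intro bounded_linear_vec_nth bounded_linear_compose[OF bounded_linear_vec_nth])
    have e: "matrix_exp (y *\<^sub>R A) $ i $ j = (\<Sum>k. ?c k * y ^ k)" for y
      using matrix_exp_linear[OF bl, of "y *\<^sub>R A"] by (simp add: matrix_power_scaleR mult_ac)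
    have s: "summable (\<lambda>k. ?c k * y ^ k)" for y
      using bounded_linear.summable[OF bl summable_matrix_exp[of "y *\<^sub>R A"]]
      by (simp add: matrix_power_scaleR mult_ac)
    have d: "(A ** matrix_exp (t *\<^sub>R A)) $ i $ j = (\<Sum>k. diffs ?c k * t ^ k)"
    proof -
      have "(A ** matrix_exp (t *\<^sub>R A)) $ i $ j = (\<Sum>k. (1 / fact k) *\<^sub>R (A ** matrix_power (t *\<^sub>R A) k) $ i $ j)"
        using matrix_exp_linear[OF bounded_linear_compose[OF bl matrix_mult.bounded_linear_right], of A "t *\<^sub>R A"] by simp
      also have "(\<lambda>k. (1 / fact k) *\<^sub>R (A ** matrix_power (t *\<^sub>R A) k) $ i $ j) = (\<lambda>k. diffs ?c k * t ^ k)"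
      proof (rule ext)
        fix k
        have "real (Suc k) / fact (Suc k) = 1 / fact k" by (simp del: of_nat_Suc)
        then have "diffs ?c k = (A ** matrix_power A k) $ i $ j / fact k"
          by (simp add: diffs_def del: of_nat_Suc fact_Suc) (metis mult.commute times_divide_eq_left mult_1)
        then show "(1 / fact k) *\<^sub>R (A ** matrix_power (t *\<^sub>R A) k) $ i $ j = diffs ?c k * t ^ k"
          by (simp add: matrix_power_scaleR matrix_mult.scaleR_right)
      qed
      finally show ?thesis .
    qed
    show ?thesis
      unfolding e d by (rule termdiffs_strong_converges_everywhere[OF s])
  qed
  have "((\<lambda>t. matrix_exp (t *\<^sub>R A)) has_derivative (\<lambda>x. x *\<^sub>R (A ** matrix_exp (t *\<^sub>R A)))) (at t)"
  proof (subst has_derivative_componentwise_within, intro ballI)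
    fix b :: "real^'a^'a" assume "b \<in> Basis"
    then obtain i j where b: "b = axis i (axis j 1)" by (auto simp: Basis_vec_def)
    show "((\<lambda>t. matrix_exp (t *\<^sub>R A) \<bullet> b) has_derivative (\<lambda>x. (x *\<^sub>R (A ** matrix_exp (t *\<^sub>R A))) \<bullet> b)) (at t)"
      using comp[of i j] unfolding b has_field_derivative_def
      by (simp add: inner_axis mult_commute_abs)
  qed
  then show ?thesis unfolding has_vector_derivative_def by (rule has_derivative_at_withinI)
qed

lemma has_vector_derivative_zero_eq:
  fixes f :: "real \<Rightarrow> 'a::real_normed_vector"
  assumes "\<And>t. (f has_vector_derivative 0) (at t)"
  shows "f s = f t"
  by (rule has_derivative_zero_unique[of UNIV f])
     (use assms in \<open>auto simp: has_vector_derivative_def\<close>)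

text \<open>The product of the exponentials of \<open>t A\<close> and \<open>- t A\<close> has
  derivative zero, because \<open>A\<close> commutes with its exponential, and it is the identity at
  \<open>t = 0\<close>.\<close>

lemma matrix_exp_minus_right: "matrix_exp A ** matrix_exp (- A) = mat 1"
proof -
  let ?f = "\<lambda>t. matrix_exp (t *\<^sub>R A) ** matrix_exp (t *\<^sub>R (- A))"
  have c: "matrix_exp (t *\<^sub>R A) ** A = A ** matrix_exp (t *\<^sub>R A)" for t
    using matrix_exp_commute[of "t *\<^sub>R A"]
    by (cases "t = 0") (simp_all add: matrix_algebra)
  have "(?f has_vector_derivative 0) (at t)" for t
  proof -
    have "matrix_exp (t *\<^sub>R A) ** (- A ** matrix_exp (t *\<^sub>R (- A))) + (A ** matrix_exp (t *\<^sub>R A)) ** matrix_exp (t *\<^sub>R (- A)) = 0"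
      unfolding c[symmetric] by (simp add: matrix_algebra)
    then show ?thesis
      using matrix_mult.has_vector_derivative[OF has_vector_derivative_matrix_exp[of A t UNIV]
        has_vector_derivative_matrix_exp[of "- A" t UNIV]]
      by simp
  qed
  from has_vector_derivative_zero_eq[of ?f 1 0, OF this] show ?thesis by simp
qed

lemma matrix_exp_minus_left: "matrix_exp (- A) ** matrix_exp A = mat 1"
  using matrix_exp_minus_right[of "- A"] by simp

text \<open>On the plane of \<open>v\<close> and \<open>w\<close> the matrix \<open>A\<close> is
  \<open>l\<close> times a quarter turn. Multiplying the claimed curve by the exponential of
  \<open>- t A\<close> gives a curve with derivative zero, which therefore stays at
  \<open>v\<close>.\<close>

lemma matrix_exp_rotation:
  assumes "A *v v = l *\<^sub>R w" "A *v w = - (l *\<^sub>R v)"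
  shows "matrix_exp (t *\<^sub>R A) *v v = cos (t * l) *\<^sub>R v + sin (t * l) *\<^sub>R w"
proof -
  let ?r = "\<lambda>t. cos (t * l) *\<^sub>R v + sin (t * l) *\<^sub>R w"
  let ?f = "\<lambda>t. matrix_exp (t *\<^sub>R (- A)) *v ?r t"
  have c: "matrix_exp (t *\<^sub>R (-A)) ** A = A ** matrix_exp (t *\<^sub>R (-A))" for t
    using matrix_exp_commute[of "t *\<^sub>R (-A)"]
    by (cases "t = 0") (simp_all add: matrix_algebra)
  have "(?f has_vector_derivative 0) (at t)" for t
  proof -
    have r: "(?r has_vector_derivative (- (l * sin (t * l)) *\<^sub>R v + (l * cos (t * l)) *\<^sub>R w)) (at t)"
      by (auto intro!: derivative_eq_intros simp: has_vector_derivative_def algebra_simps)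
    have "matrix_exp (t *\<^sub>R (- A)) *v (- (l * sin (t * l)) *\<^sub>R v + (l * cos (t * l)) *\<^sub>R w)
        + (- A ** matrix_exp (t *\<^sub>R (- A))) *v ?r t = 0"
      unfolding matrix_mult.minus_left c[symmetric]
      by (simp add: matrix_vector_algebra assms) (simp add: algebra_simps)
    then show ?thesis
      using matrix_vector.has_vector_derivative[OF has_vector_derivative_matrix_exp[of "- A" t UNIV] r]
      by simp
  qed
  from has_vector_derivative_zero_eq[of ?f t 0, OF this]
  have "matrix_exp (t *\<^sub>R A) *v ?f t = matrix_exp (t *\<^sub>R A) *v v" by simp
  then show ?thesis
    using matrix_exp_minus_right[of "t *\<^sub>R A"] by (simp add: matrix_vector_mul_assoc)
qed

section \<open>Points, tangent vectors and geodesics\<close>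

text \<open>With \<open>Q = 1 - P\<close> this is \<open>P S Q + Q S P\<close>, the off-diagonal
  part of \<open>S\<close>; for symmetric \<open>S\<close> it is the orthogonal projection onto the
  tangent space at \<open>P\<close>. Being polynomial in \<open>P\<close>, it is defined and smooth
  off the Grassmannian too.\<close>

definition tangent_proj :: "real^'n^'n \<Rightarrow> real^'n^'n \<Rightarrow> real^'n^'n" where
  "tangent_proj P S = P ** S + S ** P - 2 *\<^sub>R (P ** S ** P)"

lemma GrD:
  assumes "P \<in> Gr p"
  shows "transpose P = P" "P ** P = P" "P ** (P ** X) = P ** X"
  using assms by (simp_all add: Gr_def matrix_mul_assoc)

lemma tangent_spaceD:
  assumes "v \<in> tangent_space P"
  shows "transpose v = v" "v ** P + P ** v = v"
  using assms by (simp_all add: tangent_space_def)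

text \<open>Rewrite rules that move \<open>P\<close> to the left of a tangent vector and use that
  its diagonal block \<open>P v P\<close> is zero. The variants with a trailing \<open>X\<close> are
  there because \<open>matrix_algebra\<close> nests products to the right.\<close>

lemma tangent_spaceD_mult:
  assumes "P \<in> Gr p" "v \<in> tangent_space P"
  shows "v ** P = v - P ** v" "P ** (v ** P) = 0"
    "v ** (P ** X) = v ** X - P ** (v ** X)" "P ** (v ** (P ** X)) = 0"
proof -
  show 1: "v ** P = v - P ** v" using tangent_spaceD(2)[OF assms(2)] by (simp add: algebra_simps)
  show 2: "P ** (v ** P) = 0" unfolding 1 by (simp add: matrix_algebra GrD[OF assms(1)])
  show "v ** (P ** X) = v ** X - P ** (v ** X)"
    using arg_cong[OF 1, of "\<lambda>M. M ** X"] by (simp add: matrix_algebra)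
  show "P ** (v ** (P ** X)) = 0"
    using arg_cong[OF 2, of "\<lambda>M. M ** X"] by (simp add: matrix_algebra)
qed

lemma subspace_tangent_space: "subspace (tangent_space P)"
  unfolding subspace_def tangent_space_def
  by (auto simp: matrix_algebra transpose_algebra scaleR_right_distrib[symmetric] algebra_simps
      simp del: scaleR_right_distrib) (simp add: transpose_def vec_eq_iff)

lemmas tangent_space_add = subspace_add[OF subspace_tangent_space]
  and tangent_space_scaleR = subspace_scale[OF subspace_tangent_space]
  and tangent_space_diff = subspace_diff[OF subspace_tangent_space]

lemma tangent_proj_in:
  assumes "P \<in> Gr p" "transpose S = S"
  shows "tangent_proj P S \<in> tangent_space P"
  unfolding tangent_space_def tangent_proj_def scaleR_2
  by (simp add: matrix_algebra transpose_algebra GrD[OF assms(1)] assms(2) numeral_times_matrix)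

lemma tangent_proj_ident:
  assumes "P \<in> Gr p" "v \<in> tangent_space P"
  shows "tangent_proj P v = v"
  unfolding tangent_proj_def
  by (simp add: matrix_algebra GrD[OF assms(1)] tangent_spaceD_mult[OF assms])

lemma bounded_linear_tangent_proj: "bounded_linear (tangent_proj P)"
  by (auto intro!: linear_conv_bounded_linear[THEN iffD1] linearI
      simp: tangent_proj_def matrix_algebra algebra_simps)

text \<open>The projection is self-adjoint for the trace form: by cyclicity \<open>P S P z\<close>
  has the same trace as \<open>S P z P\<close>, and \<open>P z P = 0\<close>.\<close>

lemma trace_tangent_proj:
  assumes "P \<in> Gr p" "z \<in> tangent_space P"
  shows "trace (tangent_proj P S ** z) = trace (S ** z)"
proof -
  have "trace (P ** S ** P ** z) = trace (S ** P ** z ** P)"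
    using trace_mul_sym[of P "S ** P ** z"] by (simp add: matrix_algebra)
  also have "\<dots> = 0" using tangent_spaceD_mult(2)[OF assms] by (simp add: matrix_algebra trace_def)
  finally have 1: "trace (P ** S ** P ** z) = 0" .
  have 2: "trace (P ** S ** z) = trace (S ** z ** P)"
    using trace_mul_sym[of P "S ** z"] by (simp add: matrix_algebra)
  have "trace (tangent_proj P S ** z) = trace (P ** S ** z) + trace (S ** P ** z) - 2 * trace (P ** S ** P ** z)"
    unfolding tangent_proj_def matrix_mult.add_left matrix_mult.diff_left matrix_mult.scaleR_left
    by (simp add: trace_def sum.distrib sum_subtractf sum_distrib_left)
  also have "\<dots> = trace (S ** (z ** P + P ** z))"
    unfolding 1 2 by (simp add: matrix_algebra trace_def sum.distrib)
  finally show ?thesis using tangent_spaceD(2)[OF assms(2)] by simp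
qed

lemma commutator_scaleR: "commutator (t *\<^sub>R A) B = t *\<^sub>R commutator A B"
  by (simp add: commutator_def matrix_algebra algebra_simps)

lemma rank_conjugate:
  assumes "A ** B = mat 1" "B ** A = (mat 1 :: real^'n^'n)"
  shows "rank (A ** (P::real^'n^'n) ** B) = rank P"
proof (rule antisym)
  show "rank (A ** P ** B) \<le> rank P"
    using rank_mul_le_left[of "A ** P" B] rank_mul_le_right[of A P] by linarith
  have "rank (B ** (A ** P ** B) ** A) = rank P"
    using assms by (metis matrix_mul_assoc matrix_mul_lid matrix_mul_rid)
  then show "rank P \<le> rank (A ** P ** B)"
    using rank_mul_le_left[of "B ** (A ** P ** B)" A] rank_mul_le_right[of B "A ** P ** B"] by linarith
qed

locale geodesic =
  fixes p :: nat and P \<Delta> :: "real^'n^'n"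
  assumes P: "P \<in> Gr p" and \<Delta>: "\<Delta> \<in> tangent_space P"
begin

definition \<Omega> where "\<Omega> = commutator \<Delta> P"
definition E where "E t = matrix_exp (t *\<^sub>R \<Omega>)"
definition \<gamma> where "\<gamma> t = Exp_Gr P (t *\<^sub>R \<Delta>)"

lemma transpose_\<Omega>: "transpose \<Omega> = - \<Omega>"
  unfolding \<Omega>_def commutator_def
  by (simp add: transpose_algebra GrD[OF P] tangent_spaceD[OF \<Delta>])

lemma E_0 [simp]: "E 0 = mat 1"
  by (simp add: E_def)

lemma transpose_E: "transpose (E t) = E (- t)"
  by (simp add: E_def transpose_matrix_exp transpose_algebra transpose_\<Omega>)

lemma E_inverse: "E t ** E (- t) = mat 1" "E (- t) ** E t = mat 1"
  using matrix_exp_minus_right[of "t *\<^sub>R \<Omega>"] matrix_exp_minus_left[of "t *\<^sub>R \<Omega>"] by (simp_all add: E_def)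

lemma E_inverse': "E t ** (E (- t) ** X) = X" "E (- t) ** (E t ** X) = X"
  by (simp_all add: matrix_mul_assoc E_inverse)

lemma E_commute: "E t ** \<Omega> = \<Omega> ** E t"
  unfolding E_def using matrix_exp_commute[of "t *\<^sub>R \<Omega>"]
  by (cases "t = 0") (simp_all add: matrix_algebra)

lemma E_commute': "E t ** (\<Omega> ** X) = \<Omega> ** (E t ** X)"
  by (simp add: matrix_mul_assoc E_commute)

lemma E_deriv: "(E has_vector_derivative (\<Omega> ** E t)) (at t within T)"
  unfolding E_def by (rule has_vector_derivative_matrix_exp)

lemma E_minus_deriv: "((\<lambda>t. E (- t)) has_vector_derivative (- (\<Omega> ** E (- t)))) (at t within T)"
  using has_vector_derivative_matrix_exp[of "- \<Omega>" t T] by (simp add: E_def matrix_algebra)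

lemma \<gamma>_eq: "\<gamma> t = E t ** P ** E (- t)"
  by (simp add: \<gamma>_def Exp_Gr_def E_def \<Omega>_def commutator_scaleR)

lemma \<gamma>_0 [simp]: "\<gamma> 0 = P"
  by (simp add: \<gamma>_eq)

lemma \<gamma>_Gr: "\<gamma> t \<in> Gr p"
proof -
  have "transpose (\<gamma> t) = \<gamma> t"
    unfolding \<gamma>_eq by (simp add: matrix_transpose_mul transpose_E GrD[OF P] matrix_algebra)
  moreover have "\<gamma> t ** \<gamma> t = \<gamma> t"
    unfolding \<gamma>_eq by (simp add: matrix_algebra GrD[OF P] E_inverse')
  moreover have "rank (\<gamma> t) = p"
    unfolding \<gamma>_eq rank_conjugate[OF E_inverse] using P by (simp add: Gr_def)
  ultimately show ?thesis by (simp add: Gr_def)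
qed

lemma conj_tangent:
  assumes "K \<in> tangent_space P"
  shows "E t ** K ** E (- t) \<in> tangent_space (\<gamma> t)"
  unfolding tangent_space_def \<gamma>_eq
  by (simp add: matrix_algebra transpose_algebra transpose_E E_inverse' tangent_spaceD[OF assms]
      tangent_spaceD_mult[OF P assms])

lemma conj_tangent_inv:
  assumes "J \<in> tangent_space (\<gamma> t)"
  shows "E (- t) ** J ** E t \<in> tangent_space P"
proof -
  have "E (- t) ** (J ** \<gamma> t + \<gamma> t ** J) ** E t = E (- t) ** J ** E t"
    by (simp only: tangent_spaceD(2)[OF assms])
  then show ?thesis
    unfolding tangent_space_def \<gamma>_eq
    by (simp add: matrix_algebra transpose_algebra transpose_E E_inverse E_inverse' tangent_spaceD(1)[OF assms])
qed

text \<open>Taking the commutator with \<open>P\<close> twice is the identity on tangent vectors,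
  because \<open>P \<Delta> P = 0\<close>. Hence the geodesic leaves \<open>P\<close> with velocity
  \<open>\<Delta>\<close>.\<close>

lemma \<Omega>_\<Delta>: "\<Omega> ** P - P ** \<Omega> = \<Delta>"
  unfolding \<Omega>_def commutator_def
  by (simp add: matrix_algebra GrD[OF P] tangent_spaceD_mult[OF P \<Delta>] numeral_times_matrix)

lemma \<gamma>_deriv: "(\<gamma> has_vector_derivative (\<Omega> ** \<gamma> t - \<gamma> t ** \<Omega>)) (at t within T)"
proof -
  have "((\<lambda>t. E t ** P ** E (- t)) has_vector_derivative
     (E t ** P ** (- (\<Omega> ** E (- t))) + (\<Omega> ** E t ** P) ** E (- t))) (at t within T)"
    by (intro matrix_mult.has_vector_derivative E_minus_deriv
        bounded_linear.has_vector_derivative[OF matrix_mult.bounded_linear_left] E_deriv)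
  moreover have "E t ** P ** (- (\<Omega> ** E (- t))) + (\<Omega> ** E t ** P) ** E (- t) = \<Omega> ** \<gamma> t - \<gamma> t ** \<Omega>"
    unfolding \<gamma>_eq by (simp add: matrix_algebra E_commute)
  ultimately show ?thesis unfolding \<gamma>_eq by simp
qed

lemma \<gamma>_velocity: "\<Omega> ** \<gamma> t - \<gamma> t ** \<Omega> = E t ** \<Delta> ** E (- t)"
proof -
  have "E t ** \<Delta> ** E (- t) = E t ** (\<Omega> ** P - P ** \<Omega>) ** E (- t)"
    by (simp only: \<Omega>_\<Delta>)
  then show ?thesis
    unfolding \<gamma>_eq by (simp add: matrix_algebra E_commute E_commute')
qed

end

section \<open>The Levi-Civita connection and its curvature\<close>

text \<open>Within \<open>Gr p\<close> only tangent directions are visible, so agreement of the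
  whole linear maps cannot be expected. For tangent \<open>v\<close> the geodesic with velocity
  \<open>v\<close> stays in \<open>Gr p\<close>, and the chain rule along it determines the value at
  \<open>v\<close>.\<close>

lemma has_derivative_Gr_unique:
  assumes "P \<in> Gr p" "v \<in> tangent_space P"
    and "(f has_derivative f') (at P within Gr p)" "(f has_derivative f'') (at P within Gr p)"
  shows "f' v = f'' v"
proof -
  interpret geodesic p P v by unfold_locales (fact assms)+
  have g: "(\<gamma> has_derivative (\<lambda>h. h *\<^sub>R v)) (at 0)"
    using \<gamma>_deriv[of 0 UNIV] \<Omega>_\<Delta> by (simp add: has_vector_derivative_def)
  have "(f \<circ> \<gamma> has_derivative D \<circ> (\<lambda>h. h *\<^sub>R v)) (at 0)"
    if "(f has_derivative D) (at P within Gr p)" for D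
    by (rule diff_chain_within[OF g]) (use has_derivative_subset[OF that, of "range \<gamma>"] \<gamma>_Gr in auto)
  from has_derivative_unique[OF this[OF assms(3)] this[OF assms(4)]]
  show ?thesis by (auto dest: fun_cong[of _ _ 1])
qed

lemma dir_deriv_eq:
  assumes "P \<in> Gr p" "v \<in> tangent_space P" "(f has_derivative f') (at P within Gr p)"
  shows "dir_deriv p f P v = f' v"
  unfolding dir_deriv_def
  by (rule has_derivative_Gr_unique[OF assms(1,2) frechet_derivative_works[THEN iffD1, OF differentiableI[OF assms(3)]] assms(3)])

definition local_extension ::
    "nat \<Rightarrow> (real^'n^'n \<Rightarrow> 'b::real_normed_vector) \<Rightarrow> (real^'n^'n) set \<Rightarrow> (real^'n^'n \<Rightarrow> 'b) \<Rightarrow> bool" where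
  "local_extension p f W g \<longleftrightarrow> open W \<and> smooth_on g W \<and> (\<forall>Q\<in>W \<inter> Gr p. f Q = g Q)"

lemma smooth_on_Gr_iff: "smooth_on_Gr p f \<longleftrightarrow> (\<forall>P\<in>Gr p. \<exists>W g. P \<in> W \<and> local_extension p f W g)"
  unfolding smooth_on_Gr_def local_extension_def by blast

lemma local_extension_subset:
  assumes "local_extension p f W g" "open V"
  shows "local_extension p f (W \<inter> V) g"
  using assms smooth_on_subset_open[of W "W \<inter> V" g] unfolding local_extension_def by auto

lemma smooth_on_open_deriv:
  assumes "open W" "smooth_on g W" "Q \<in> W"
  shows "(g has_derivative frechet_derivative g (at Q)) (at Q)"
  using smooth_on_openD[OF assms] at_within_open[OF assms(3,1)] by simp

lemma smooth_on_frechet_derivative: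
  assumes "open W" "smooth_on g W"
  shows "smooth_on (\<lambda>Q. frechet_derivative g (at Q) v) W"
  using smooth_onD(2)[OF assms(2), of v] smooth_on_cong[of W "\<lambda>Q. frechet_derivative g (at Q within W) v"
    "\<lambda>Q. frechet_derivative g (at Q) v"] at_within_open[OF _ assms(1)] by simp

lemma frechet_derivative_expand:
  fixes g :: "'a::euclidean_space \<Rightarrow> 'b::real_normed_vector"
  assumes "open W" "smooth_on g W" "Q \<in> W"
  shows "frechet_derivative g (at Q) v = (\<Sum>b\<in>Basis. (v \<bullet> b) *\<^sub>R frechet_derivative g (at Q) b)"
proof -
  have l: "linear (frechet_derivative g (at Q))"
    using smooth_on_open_deriv[OF assms] has_derivative_linear by blast
  have "frechet_derivative g (at Q) v = frechet_derivative g (at Q) (\<Sum>b\<in>Basis. (v \<bullet> b) *\<^sub>R b)"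
    by (simp add: euclidean_representation)
  also have "\<dots> = (\<Sum>b\<in>Basis. (v \<bullet> b) *\<^sub>R frechet_derivative g (at Q) b)"
    using l by (simp add: linear_sum linear_cmul)
  finally show ?thesis .
qed

text \<open>\<open>Ck_on\<close> differentiates in fixed directions only. For a direction that
  varies with the point, the derivative is expanded over \<open>Basis\<close>, and the product rule
  applies to each term.\<close>

lemma smooth_on_frechet_derivative_apply:
  fixes g :: "'a::euclidean_space \<Rightarrow> 'b::real_normed_vector"
  assumes W: "open W" and g: "smooth_on g W" and h: "smooth_on h W"
  shows "smooth_on (\<lambda>Q. frechet_derivative g (at Q) (h Q)) W"
proof -
  note U = deriv_unique_on_open[OF W]
  have "smooth_on (\<lambda>Q. \<Sum>b\<in>Basis. (h Q \<bullet> b) *\<^sub>R frechet_derivative g (at Q) b) W"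
    using smooth_on_linear[OF U bounded_linear_inner_left h]
    by (intro smooth_on_sum[OF U] smooth_on_bilinear[OF U bounded_bilinear_scaleR]
        smooth_on_frechet_derivative[OF W g]) auto
  then show ?thesis
    using smooth_on_cong[of W "\<lambda>Q. \<Sum>b\<in>Basis. (h Q \<bullet> b) *\<^sub>R frechet_derivative g (at Q) b"
       "\<lambda>Q. frechet_derivative g (at Q) (h Q)"] frechet_derivative_expand[OF W g]
    by metis
qed

lemma frechet_derivative_apply_has_derivative:
  fixes g :: "'a::euclidean_space \<Rightarrow> 'b::real_normed_vector"
  assumes W: "open W" "P \<in> W" and g: "smooth_on g W" and h: "(h has_derivative h') (at P)"
  shows "((\<lambda>Q. frechet_derivative g (at Q) (h Q)) has_derivative
     (\<lambda>x. frechet_derivative (\<lambda>Q. frechet_derivative g (at Q) (h P)) (at P) x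
        + frechet_derivative g (at P) (h' x))) (at P)"
proof -
  let ?D = "\<lambda>b Q. frechet_derivative g (at Q) b"
  have D: "(?D b has_derivative frechet_derivative (?D b) (at P)) (at P)" for b
    by (rule smooth_on_open_deriv[OF W(1) smooth_on_frechet_derivative[OF W(1) g] W(2)])
  let ?S' = "\<lambda>x. \<Sum>b\<in>Basis. (h P \<bullet> b) *\<^sub>R frechet_derivative (?D b) (at P) x + (h' x \<bullet> b) *\<^sub>R ?D b P"
  have "((\<lambda>Q. \<Sum>b\<in>Basis. (h Q \<bullet> b) *\<^sub>R ?D b Q) has_derivative ?S') (at P)"
    by (intro has_derivative_sum has_derivative_scaleR D has_derivative_inner_left h)
  then have 1: "((\<lambda>Q. frechet_derivative g (at Q) (h Q)) has_derivative ?S') (at P)"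
    by (rule has_derivative_transform_within_open[OF _ W])
       (simp add: frechet_derivative_expand[OF W(1) g, symmetric])
  have "((\<lambda>Q. \<Sum>b\<in>Basis. (h P \<bullet> b) *\<^sub>R ?D b Q) has_derivative
      (\<lambda>x. \<Sum>b\<in>Basis. (h P \<bullet> b) *\<^sub>R frechet_derivative (?D b) (at P) x)) (at P)"
    by (intro has_derivative_sum has_derivative_scaleR_right D)
  then have "(?D (h P) has_derivative (\<lambda>x. \<Sum>b\<in>Basis. (h P \<bullet> b) *\<^sub>R frechet_derivative (?D b) (at P) x)) (at P)"
    by (rule has_derivative_transform_within_open[OF _ W])
       (simp add: frechet_derivative_expand[OF W(1) g, symmetric])
  from frechet_derivative_at[OF this]
  have "?S' = (\<lambda>x. frechet_derivative (?D (h P)) (at P) x + frechet_derivative g (at P) (h' x))"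
    unfolding frechet_derivative_expand[OF W(1) g W(2), of "h' _"]
    by (auto simp: sum.distrib fun_eq_iff dest: sym)
  with 1 show ?thesis by simp
qed

lemma local_extension_has_derivative:
  assumes "local_extension p f W g" "Q \<in> W" "Q \<in> Gr p"
  shows "(f has_derivative frechet_derivative g (at Q)) (at Q within Gr p)"
proof -
  from assms obtain e where e: "e > 0" "ball Q e \<subseteq> W"
    unfolding local_extension_def by (meson open_contains_ball)
  have "(g has_derivative frechet_derivative g (at Q)) (at Q within Gr p)"
    using assms smooth_on_open_deriv has_derivative_at_withinI unfolding local_extension_def by blast
  then show ?thesis
  proof (rule has_derivative_transform_within[OF _ e(1) assms(3)])
    fix x assume x: "x \<in> Gr p" "dist x Q < e"
    then have "x \<in> W" using e(2) by (auto simp: dist_commute)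
    then show "g x = f x" using assms(1) x(1) by (simp add: local_extension_def)
  qed
qed

lemma local_extension_dir_deriv:
  assumes "local_extension p f W g" "Q \<in> W" "Q \<in> Gr p" "v \<in> tangent_space Q"
  shows "dir_deriv p f Q v = frechet_derivative g (at Q) v"
  by (rule dir_deriv_eq[OF assms(3,4) local_extension_has_derivative[OF assms(1-3)]])

lemma smooth_on_Gr_has_derivative:
  assumes "smooth_on_Gr p f" "P \<in> Gr p"
  obtains f' where "(f has_derivative f') (at P within Gr p)"
  using assms local_extension_has_derivative unfolding smooth_on_Gr_iff by blast

lemma smooth_on_tangent_proj:
  assumes "open W" "smooth_on F W"
  shows "smooth_on (\<lambda>Q. tangent_proj Q (F Q)) W"
proof -
  note U = deriv_unique_on_open[OF assms(1)]
  note m = smooth_on_bilinear[OF U bounded_bilinear_matrix_mult]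
  note i = smooth_on_ident[OF U]
  show ?thesis unfolding tangent_proj_def
    by (rule smooth_on_diff[OF U smooth_on_add[OF U m[OF i assms(2)] m[OF assms(2) i]]
        smooth_on_linear[OF U bounded_linear_scaleR_right m[OF m[OF i assms(2)] i]]])
qed

lemma vector_field_tangent_proj:
  assumes "transpose S = S"
  shows "vector_field p (\<lambda>Q. tangent_proj Q S)"
proof -
  have "local_extension p (\<lambda>Q. tangent_proj Q S) UNIV (\<lambda>Q. tangent_proj Q S)"
    using smooth_on_tangent_proj[OF open_UNIV smooth_on_const[OF deriv_unique_on_open[OF open_UNIV]]]
    by (simp add: local_extension_def)
  then show ?thesis
    unfolding vector_field_def smooth_on_Gr_iff using tangent_proj_in[OF _ assms] by blast
qed

lemma vector_field_extension:
  assumes "P \<in> Gr p" "v \<in> tangent_space P"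
  obtains X where "vector_field p X" "X P = v"
  using vector_field_tangent_proj[OF tangent_spaceD(1)[OF assms(2)]] tangent_proj_ident[OF assms] by metis

text \<open>Both equations that define the tangent space are differentiated along
  \<open>Gr p\<close>. The second result fixes the part of \<open>X' v\<close> normal to the
  Grassmannian by \<open>X P\<close> and \<open>v\<close> alone: this is the second fundamental
  form.\<close>

lemma vector_field_deriv:
  assumes X: "vector_field p X" and P: "P \<in> Gr p" and v: "v \<in> tangent_space P"
    and X': "(X has_derivative X') (at P within Gr p)"
  shows "transpose (X' v) = X' v"
    and "X' v - P ** X' v - X' v ** P = X P ** v + v ** X P"
proof -
  have T: "X Q \<in> tangent_space Q" if "Q \<in> Gr p" for Q using X that by (simp add: vector_field_def)
  have "((\<lambda>Q. transpose (X Q)) has_derivative (\<lambda>v. transpose (X' v))) (at P within Gr p)"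
    by (rule bounded_linear.has_derivative[OF bounded_linear_transpose X'])
  then have "(X has_derivative (\<lambda>v. transpose (X' v))) (at P within Gr p)"
    by (rule has_derivative_transform[OF P, rotated]) (simp add: tangent_spaceD(1)[OF T])
  from has_derivative_Gr_unique[OF P v this X'] show "transpose (X' v) = X' v" .
  have "((\<lambda>Q. X Q ** Q + Q ** X Q) has_derivative
     (\<lambda>v. (X P ** v + X' v ** P) + (P ** X' v + v ** X P))) (at P within Gr p)"
    by (intro has_derivative_add matrix_mult.FDERIV X' has_derivative_ident)
  then have "(X has_derivative (\<lambda>v. (X P ** v + X' v ** P) + (P ** X' v + v ** X P))) (at P within Gr p)"
    by (rule has_derivative_transform[OF P, rotated]) (simp add: tangent_spaceD(2)[OF T])
  from has_derivative_Gr_unique[OF P v this X']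
  show "X' v - P ** X' v - X' v ** P = X P ** v + v ** X P" by (simp add: algebra_simps)
qed

section \<open>Identification of the Levi-Civita connection\<close>

text \<open>The tangential part of the ambient derivative. On symmetric matrices
  \<open>metric\<close> is half the Euclidean inner product, so the classical description of the
  connection of a submanifold applies.\<close>

definition grass_conn :: "nat \<Rightarrow> 'n::finite connection" where
  "grass_conn p Y P v = tangent_proj P (dir_deriv p Y P v)"

lemma grass_conn_eq:
  assumes "P \<in> Gr p" "v \<in> tangent_space P" "(Y has_derivative Y') (at P within Gr p)"
  shows "grass_conn p Y P v = tangent_proj P (Y' v)"
  by (simp add: grass_conn_def dir_deriv_eq[OF assms])

lemma vector_field_has_derivative:
  assumes "vector_field p X" "P \<in> Gr p"
  obtains X' where "(X has_derivative X') (at P within Gr p)"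
  using assms smooth_on_Gr_has_derivative unfolding vector_field_def by blast

lemma tangent_proj_linear: "linear (tangent_proj P)"
  using bounded_linear_tangent_proj bounded_linear.linear by blast

lemma vector_field_grass_conn:
  fixes X Y :: "real^'n^'n \<Rightarrow> real^'n^'n"
  assumes X: "vector_field p X" and Y: "vector_field p Y"
  shows "vector_field p (\<lambda>P. grass_conn p Y P (X P))"
  unfolding vector_field_def
proof
  have T: "X Q \<in> tangent_space Q" if "Q \<in> Gr p" for Q using X that by (simp add: vector_field_def)
  show "smooth_on_Gr p (\<lambda>P. grass_conn p Y P (X P))"
    unfolding smooth_on_Gr_iff
  proof
    fix P :: "real^'n^'n" assume P: "P \<in> Gr p"
    obtain W1 g where g: "P \<in> W1" "local_extension p Y W1 g"
      using Y P unfolding vector_field_def smooth_on_Gr_iff by blast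
    obtain W2 h where h: "P \<in> W2" "local_extension p X W2 h"
      using X P unfolding vector_field_def smooth_on_Gr_iff by blast
    define W where "W = W1 \<inter> W2"
    have W: "open W" "P \<in> W" using g h by (auto simp: W_def local_extension_def)
    have g': "local_extension p Y W g" and h': "local_extension p X W h"
      using local_extension_subset[OF g(2), of W2] local_extension_subset[OF h(2), of W1] g h
      by (auto simp: W_def local_extension_def Int_commute)
    have "smooth_on (\<lambda>Q. tangent_proj Q (frechet_derivative g (at Q) (h Q))) W"
      using g' h' by (intro smooth_on_tangent_proj smooth_on_frechet_derivative_apply W)
        (auto simp: local_extension_def)
    moreover have "grass_conn p Y Q (X Q) = tangent_proj Q (frechet_derivative g (at Q) (h Q))"
      if "Q \<in> W \<inter> Gr p" for Q
    proof -
      have "h Q = X Q" using that h' by (simp add: local_extension_def)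
      then show ?thesis
        using that local_extension_dir_deriv[OF g' _ _ T] by (simp add: grass_conn_def)
    qed
    ultimately show "\<exists>W g. P \<in> W \<and> local_extension p (\<lambda>P. grass_conn p Y P (X P)) W g"
      using W unfolding local_extension_def by blast
  qed
  show "\<forall>P\<in>Gr p. grass_conn p Y P (X P) \<in> tangent_space P"
  proof
    fix P :: "real^'n^'n" assume P: "P \<in> Gr p"
    obtain Y' where Y': "(Y has_derivative Y') (at P within Gr p)"
      using vector_field_has_derivative[OF Y P] .
    show "grass_conn p Y P (X P) \<in> tangent_space P"
      unfolding grass_conn_eq[OF P T[OF P] Y']
      by (rule tangent_proj_in[OF P vector_field_deriv(1)[OF Y P T[OF P] Y']])
  qed
qed

lemma is_connection_grass_conn: "is_connection p (grass_conn p :: 'n::finite connection)"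
  unfolding is_connection_def
proof (intro conjI allI impI ballI)
  fix X Y :: "real^'n^'n \<Rightarrow> real^'n^'n"
  assume "vector_field p X" "vector_field p Y"
  then show "vector_field p (\<lambda>P. grass_conn p Y P (X P))" by (rule vector_field_grass_conn)
next
  fix Y :: "real^'n^'n \<Rightarrow> real^'n^'n" and P v w :: "real^'n^'n" and a b :: real
  assume Y: "vector_field p Y" and P: "P \<in> Gr p" and vw: "v \<in> tangent_space P" "w \<in> tangent_space P"
  obtain Y' where Y': "(Y has_derivative Y') (at P within Gr p)"
    using vector_field_has_derivative[OF Y P] .
  have "a *\<^sub>R v + b *\<^sub>R w \<in> tangent_space P"
    using vw by (intro tangent_space_add tangent_space_scaleR)
  then show "grass_conn p Y P (a *\<^sub>R v + b *\<^sub>R w) = a *\<^sub>R grass_conn p Y P v + b *\<^sub>R grass_conn p Y P w"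
    using has_derivative_linear[OF Y']
    by (simp add: grass_conn_eq[OF P _ Y'] vw linear_add linear_cmul tangent_proj_linear)
next
  fix Y Z :: "real^'n^'n \<Rightarrow> real^'n^'n" and P v :: "real^'n^'n"
  assume Y: "vector_field p Y" and Z: "vector_field p Z" and P: "P \<in> Gr p" and v: "v \<in> tangent_space P"
  obtain Y' where Y': "(Y has_derivative Y') (at P within Gr p)"
    using vector_field_has_derivative[OF Y P] .
  obtain Z' where Z': "(Z has_derivative Z') (at P within Gr p)"
    using vector_field_has_derivative[OF Z P] .
  show "grass_conn p (\<lambda>Q. Y Q + Z Q) P v = grass_conn p Y P v + grass_conn p Z P v"
    by (simp add: grass_conn_eq[OF P v Y'] grass_conn_eq[OF P v Z']
        grass_conn_eq[OF P v has_derivative_add[OF Y' Z']] linear_add[OF tangent_proj_linear])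
next
  fix f :: "real^'n^'n \<Rightarrow> real" and Y :: "real^'n^'n \<Rightarrow> real^'n^'n" and P v :: "real^'n^'n"
  assume f: "smooth_on_Gr p f" and Y: "vector_field p Y" and P: "P \<in> Gr p" and v: "v \<in> tangent_space P"
  obtain Y' where Y': "(Y has_derivative Y') (at P within Gr p)"
    using vector_field_has_derivative[OF Y P] .
  obtain f' where f': "(f has_derivative f') (at P within Gr p)"
    using smooth_on_Gr_has_derivative[OF f P] .
  have "Y P \<in> tangent_space P" using Y P by (simp add: vector_field_def)
  then show "grass_conn p (\<lambda>Q. f Q *\<^sub>R Y Q) P v = dir_deriv p f P v *\<^sub>R Y P + f P *\<^sub>R grass_conn p Y P v"
    by (simp add: grass_conn_eq[OF P v Y'] dir_deriv_eq[OF P v f'] tangent_proj_ident[OF P]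
        grass_conn_eq[OF P v has_derivative_scaleR[OF f' Y']]
        linear_add[OF tangent_proj_linear] linear_cmul[OF tangent_proj_linear])
qed

text \<open>The right-hand side in \<open>vector_field_deriv\<close> is symmetric in the value of
  the field and the direction. The two derivatives thus have the same normal part, which cancels in
  the bracket.\<close>

lemma lie_bracket_tangent:
  assumes X: "vector_field p X" and Y: "vector_field p Y" and P: "P \<in> Gr p"
  shows "lie_bracket p X Y P \<in> tangent_space P"
proof -
  have T: "X P \<in> tangent_space P" "Y P \<in> tangent_space P" using X Y P by (simp_all add: vector_field_def)
  obtain X' where X': "(X has_derivative X') (at P within Gr p)"
    using vector_field_has_derivative[OF X P] .
  obtain Y' where Y': "(Y has_derivative Y') (at P within Gr p)"
    using vector_field_has_derivative[OF Y P] .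
  have "Y' (X P) - P ** Y' (X P) - Y' (X P) ** P = X' (Y P) - P ** X' (Y P) - X' (Y P) ** P"
    using vector_field_deriv(2)[OF X P T(2) X'] vector_field_deriv(2)[OF Y P T(1) Y'] by simp
  then have "(Y' (X P) - X' (Y P)) ** P + P ** (Y' (X P) - X' (Y P)) = Y' (X P) - X' (Y P)"
    by (simp add: matrix_mult.diff_left matrix_mult.diff_right algebra_simps)
  then show ?thesis
    unfolding tangent_space_def lie_bracket_def dir_deriv_eq[OF P T(1) Y'] dir_deriv_eq[OF P T(2) X']
    by (simp add: transpose_algebra vector_field_deriv(1)[OF X P T(2) X'] vector_field_deriv(1)[OF Y P T(1) Y'])
qed

lemma torsion_free_grass_conn: "torsion_free p (grass_conn p :: 'n::finite connection)"
  unfolding torsion_free_def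
proof (intro allI impI ballI)
  fix X Y :: "real^'n^'n \<Rightarrow> real^'n^'n" and P :: "real^'n^'n"
  assume X: "vector_field p X" and Y: "vector_field p Y" and P: "P \<in> Gr p"
  have "grass_conn p Y P (X P) - grass_conn p X P (Y P) = tangent_proj P (lie_bracket p X Y P)"
    by (simp add: grass_conn_def lie_bracket_def linear_diff[OF tangent_proj_linear])
  then show "grass_conn p Y P (X P) - grass_conn p X P (Y P) = lie_bracket p X Y P"
    by (simp add: tangent_proj_ident[OF P lie_bracket_tangent[OF X Y P]])
qed

lemma metric_sym: "metric A B = metric B A"
  unfolding metric_def by (rule arg_cong[OF trace_mul_sym])

lemma metric_linear:
  "metric (A + B) C = metric A C + metric B C" "metric (A - B) C = metric A C - metric B C"
  "metric C (A + B) = metric C A + metric C B" "metric C (A - B) = metric C A - metric C B"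
  by (simp_all add: metric_def matrix_algebra trace_def sum.distrib sum_subtractf algebra_simps)

lemma metric_eq_0_tangent: "v \<in> tangent_space P \<Longrightarrow> metric v v = 0 \<Longrightarrow> v = 0"
  using inner_matrix_trace[of v v] tangent_spaceD(1)[of v P] by (simp add: metric_def)

lemma bounded_bilinear_metric: "bounded_bilinear (metric :: real^'n^'n \<Rightarrow> real^'n^'n \<Rightarrow> real)"
  unfolding bilinear_conv_bounded_bilinear[symmetric] bilinear_def
  by (auto intro!: linearI simp: metric_linear)
     (simp_all add: metric_def matrix_algebra trace_def sum_distrib_left mult_ac)

lemma metric_tangent_proj:
  assumes "P \<in> Gr p" "z \<in> tangent_space P"
  shows "metric (tangent_proj P S) z = metric S z"
  by (simp add: metric_def trace_tangent_proj[OF assms])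

lemma metric_compatible_grass_conn: "metric_compatible p (grass_conn p :: 'n::finite connection)"
  unfolding metric_compatible_def
proof (intro allI impI ballI)
  fix Y Z :: "real^'n^'n \<Rightarrow> real^'n^'n" and P v :: "real^'n^'n"
  assume Y: "vector_field p Y" and Z: "vector_field p Z" and P: "P \<in> Gr p" and v: "v \<in> tangent_space P"
  have T: "Y P \<in> tangent_space P" "Z P \<in> tangent_space P" using Y Z P by (simp_all add: vector_field_def)
  obtain Y' where Y': "(Y has_derivative Y') (at P within Gr p)"
    using vector_field_has_derivative[OF Y P] .
  obtain Z' where Z': "(Z has_derivative Z') (at P within Gr p)"
    using vector_field_has_derivative[OF Z P] .
  note D = bounded_bilinear.FDERIV[OF bounded_bilinear_metric Y' Z']
  show "dir_deriv p (\<lambda>Q. metric (Y Q) (Z Q)) P v =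
             metric (grass_conn p Y P v) (Z P) + metric (Y P) (grass_conn p Z P v)"
    unfolding dir_deriv_eq[OF P v D] grass_conn_eq[OF P v Y'] grass_conn_eq[OF P v Z']
      metric_sym[of "Y P" "tangent_proj P _"] metric_tangent_proj[OF P T(2)] metric_tangent_proj[OF P T(1)]
    by (simp add: metric_sym)
qed

lemma levi_civita_properties:
  "is_connection p (levi_civita p :: 'n::finite connection)"
  "torsion_free p (levi_civita p :: 'n::finite connection)"
  "metric_compatible p (levi_civita p :: 'n::finite connection)"
proof -
  have "\<exists>nab :: 'n connection. is_connection p nab \<and> torsion_free p nab \<and> metric_compatible p nab"
    using is_connection_grass_conn torsion_free_grass_conn metric_compatible_grass_conn by blast
  from someI_ex[OF this]
  show "is_connection p (levi_civita p :: 'n connection)"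
    "torsion_free p (levi_civita p :: 'n connection)"
    "metric_compatible p (levi_civita p :: 'n connection)"
    unfolding levi_civita_def by blast+
qed

text \<open>The difference \<open>A X Y\<close> of two such connections is symmetric in \<open>X\<close> and \<open>Y\<close>, while
  \<open>metric (A X Y) Z\<close> is antisymmetric in \<open>Y\<close> and \<open>Z\<close>; hence it vanishes.\<close>

lemma levi_civita_unique:
  fixes nab1 nab2 :: "'n::finite connection"
  assumes c: "is_connection p nab1" "is_connection p nab2"
    and t: "torsion_free p nab1" "torsion_free p nab2"
    and m: "metric_compatible p nab1" "metric_compatible p nab2"
    and Y: "vector_field p Y" and P: "P \<in> Gr p" and v: "v \<in> tangent_space P"
  shows "nab1 Y P v = nab2 Y P v"
proof -
  define A where "A X Y = nab1 Y P (X P) - nab2 Y P (X P)" for X Y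
  define T where "T X Y Z = metric (A X Y) (Z P)" for X Y Z
  have sym: "A X Y = A Y X" if "vector_field p X" "vector_field p Y" for X Y
  proof -
    have "nab1 Y P (X P) - nab1 X P (Y P) = lie_bracket p X Y P"
      using t(1) that P unfolding torsion_free_def by simp
    moreover have "nab2 Y P (X P) - nab2 X P (Y P) = lie_bracket p X Y P"
      using t(2) that P unfolding torsion_free_def by simp
    ultimately show ?thesis unfolding A_def by (simp add: algebra_simps)
  qed
  have anti: "T X Y Z = - T X Z Y" if "vector_field p X" "vector_field p Y" "vector_field p Z" for X Y Z
  proof -
    have X: "X P \<in> tangent_space P" using that P by (simp add: vector_field_def)
    have "metric (nab1 Y P (X P)) (Z P) + metric (Y P) (nab1 Z P (X P))
        = dir_deriv p (\<lambda>Q. metric (Y Q) (Z Q)) P (X P)"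
      using m(1) that P X unfolding metric_compatible_def by simp
    moreover have "metric (nab2 Y P (X P)) (Z P) + metric (Y P) (nab2 Z P (X P))
        = dir_deriv p (\<lambda>Q. metric (Y Q) (Z Q)) P (X P)"
      using m(2) that P X unfolding metric_compatible_def by simp
    ultimately show ?thesis
      by (simp add: T_def A_def metric_linear metric_sym[of "Y P"])
  qed
  obtain X where X: "vector_field p X" "X P = v" using vector_field_extension[OF P v] .
  have tan: "A X Y \<in> tangent_space P"
    using c X(1) Y P unfolding A_def is_connection_def
    by (intro tangent_space_diff) (auto simp: vector_field_def)
  \<comment> \<open>Extending the difference \<open>A X Y\<close> itself turns
    \<open>T X Y Z\<close> into its squared length.\<close>
  obtain Z where Z: "vector_field p Z" "Z P = A X Y" using vector_field_extension[OF P tan] .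
  have s: "T X' Y' Z' = T Y' X' Z'" if "vector_field p X'" "vector_field p Y'" for X' Y' Z'
    unfolding T_def using sym[OF that] by simp
  \<comment> \<open>Six swaps, alternately antisymmetric and symmetric, lead back to
    \<open>T X Y Z\<close> with three changes of sign.\<close>
  have "T X Y Z = - T X Z Y" "T X Z Y = T Z X Y" "T Z X Y = - T Z Y X" "T Z Y X = T Y Z X"
    "T Y Z X = - T Y X Z" "T Y X Z = T X Y Z"
    by (rule anti s; fact X Y Z)+
  then have "T X Y Z = 0" by simp
  then have "A X Y = 0" using metric_eq_0_tangent[OF tan] Z by (simp add: T_def)
  then show ?thesis by (simp add: A_def X)
qed

lemma levi_civita_eq:
  assumes "vector_field p Y" "P \<in> Gr p" "v \<in> tangent_space P"
  shows "levi_civita p Y P v = grass_conn p Y P v"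
  by (rule levi_civita_unique[OF levi_civita_properties(1) is_connection_grass_conn
      levi_civita_properties(2) torsion_free_grass_conn levi_civita_properties(3)
      metric_compatible_grass_conn assms])

section \<open>The curvature tensor\<close>

text \<open>The product rule, split into the projection of \<open>F'\<close> and the derivative of
  the projection itself at the fixed matrix \<open>F P\<close>. The second part is what produces
  curvature.\<close>

lemma tangent_proj_deriv:
  assumes "(F has_derivative F') (at P)"
  shows "((\<lambda>Q. tangent_proj Q (F Q)) has_derivative (\<lambda>x. tangent_proj P (F' x) +
     (x ** F P + F P ** x - 2 *\<^sub>R (x ** F P ** P) - 2 *\<^sub>R (P ** F P ** x)))) (at P)"
proof -
  have "((\<lambda>Q. tangent_proj Q (F Q)) has_derivative (\<lambda>x. (P ** F' x + x ** F P) + (F P ** x + F' x ** P)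
      - 2 *\<^sub>R ((P ** F P) ** x + (P ** F' x + x ** F P) ** P))) (at P)"
    unfolding tangent_proj_def
    by (intro has_derivative_diff has_derivative_add has_derivative_scaleR_right matrix_mult.FDERIV
        has_derivative_ident assms)
  moreover have "(\<lambda>x. (P ** F' x + x ** F P) + (F P ** x + F' x ** P)
      - 2 *\<^sub>R ((P ** F P) ** x + (P ** F' x + x ** F P) ** P)) = (\<lambda>x. tangent_proj P (F' x) +
     (x ** F P + F P ** x - 2 *\<^sub>R (x ** F P ** P) - 2 *\<^sub>R (P ** F P ** x)))"
    unfolding tangent_proj_def scaleR_2 by (auto simp: matrix_algebra)
  ultimately show ?thesis by simp
qed

lemma tangent_proj_idem:
  assumes "P \<in> Gr p"
  shows "tangent_proj P (tangent_proj P S) = tangent_proj P S"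
  unfolding tangent_proj_def scaleR_2 by (simp add: matrix_algebra GrD[OF assms] numeral_times_matrix)

text \<open>\<open>C\<close> is the difference of the diagonal blocks
  \<open>(1 - P) S (1 - P)\<close> and \<open>P S P\<close>, so the tangential part of
  \<open>S\<close> has dropped out. When \<open>S\<close> is a derivative of a vector field,
  \<open>vector_field_deriv\<close> expresses \<open>C\<close> by values at the point.\<close>

lemma tangent_proj_normal_part:
  assumes "P \<in> Gr p" "x \<in> tangent_space P" "S - P ** S - S ** P = C"
  shows "tangent_proj P (x ** S + S ** x - 2 *\<^sub>R (x ** S ** P) - 2 *\<^sub>R (P ** S ** x)) = x ** C + C ** x"
proof -
  have "tangent_proj P (x ** S + S ** x - 2 *\<^sub>R (x ** S ** P) - 2 *\<^sub>R (P ** S ** x))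
    = (P ** x) ** S - P ** S ** x - x ** S ** P + S ** (x ** P)"
    unfolding tangent_proj_def scaleR_2 by (simp add: matrix_algebra GrD[OF assms(1)] numeral_times_matrix)
  also have "\<dots> = x ** C + C ** x"
  proof -
    have a: "P ** x = x - x ** P" "x ** P = x - P ** x"
      using tangent_spaceD(2)[OF assms(2)] by (auto simp: algebra_simps)
    show ?thesis unfolding a(1) unfolding a(2) assms(3)[symmetric]
      using a(1) by (simp add: matrix_algebra) 
  qed
  finally show ?thesis .
qed

text \<open>The second derivatives of \<open>Z\<close> cancel by symmetry, and the derivatives of
  \<open>X\<close> and \<open>Y\<close> cancel against the bracket term. What stays is the
  derivative of the projection, applied to first derivatives of \<open>Z\<close>; only their normal
  part counts there, and this depends on the field only through \<open>Z P\<close>.\<close>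

lemma curvature_vector_fields:
  fixes X Y Z :: "real^'n^'n \<Rightarrow> real^'n^'n"
  assumes X: "vector_field p X" and Y: "vector_field p Y" and Z: "vector_field p Z" and P: "P \<in> Gr p"
  defines "nab \<equiv> (levi_civita p :: 'n connection)"
  shows "nab (\<lambda>Q. nab Z Q (Y Q)) P (X P) - nab (\<lambda>Q. nab Z Q (X Q)) P (Y P) - nab Z P (lie_bracket p X Y P)
    = commutator (commutator (X P) (Y P)) (Z P)"
proof -
  have T: "V Q \<in> tangent_space Q" if "vector_field p V" "Q \<in> Gr p" for V Q
    using that by (simp add: vector_field_def)
  obtain WX gX where gX0: "P \<in> WX" "local_extension p X WX gX"
    using X P unfolding vector_field_def smooth_on_Gr_iff by blast
  obtain WY gY where gY0: "P \<in> WY" "local_extension p Y WY gY"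
    using Y P unfolding vector_field_def smooth_on_Gr_iff by blast
  obtain WZ gZ where gZ0: "P \<in> WZ" "local_extension p Z WZ gZ"
    using Z P unfolding vector_field_def smooth_on_Gr_iff by blast
  define W where "W = WX \<inter> (WY \<inter> WZ)"
  have W: "open W" "P \<in> W" using gX0 gY0 gZ0 by (auto simp: W_def local_extension_def)
  have "open WX" "open WY" "open WZ" using gX0 gY0 gZ0 by (auto simp: local_extension_def)
  then have gX: "local_extension p X W gX" and gY: "local_extension p Y W gY" and gZ: "local_extension p Z W gZ"
    using local_extension_subset[OF gX0(2), of "WY \<inter> WZ"] local_extension_subset[OF gY0(2), of "WX \<inter> WZ"]
      local_extension_subset[OF gZ0(2), of "WX \<inter> WY"] by (auto simp: W_def ac_simps)
  have sZ: "smooth_on gZ W" using gZ by (simp add: local_extension_def)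
  let ?D = "\<lambda>g. frechet_derivative g (at P)"
  have nab: "nab V Q v = grass_conn p V Q v" if "vector_field p V" "Q \<in> Gr p" "v \<in> tangent_space Q" for V Q v
    unfolding nab_def by (rule levi_civita_eq[OF that])
  \<comment> \<open>The inner covariant derivative is known on \<open>Gr p\<close> only, so the
    outer differentiation is carried out on its ambient extension \<open>?G\<close>.\<close>
  have second: "nab (\<lambda>Q. nab Z Q (V Q)) P u = tangent_proj P (tangent_proj P
       (?D (\<lambda>Q. frechet_derivative gZ (at Q) (V P)) u + ?D gZ (?D gV u)) +
       (u ** ?D gZ (V P) + ?D gZ (V P) ** u - 2 *\<^sub>R (u ** ?D gZ (V P) ** P) - 2 *\<^sub>R (P ** ?D gZ (V P) ** u)))"
    if V: "vector_field p V" and gV: "local_extension p V W gV" and u: "u \<in> tangent_space P" for V gV u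
  proof -
    have VP: "gV P = V P" using gV W(2) P by (auto simp: local_extension_def)
    have sV: "smooth_on gV W" using gV by (simp add: local_extension_def)
    let ?G = "\<lambda>Q. tangent_proj Q (frechet_derivative gZ (at Q) (gV Q))"
    have ext: "local_extension p (\<lambda>Q. nab Z Q (V Q)) W ?G"
      unfolding local_extension_def
    proof (intro conjI ballI)
      show "smooth_on ?G W"
        by (intro smooth_on_tangent_proj smooth_on_frechet_derivative_apply W sZ sV)
      fix Q assume Q: "Q \<in> W \<inter> Gr p"
      then have "gV Q = V Q" using gV by (simp add: local_extension_def)
      then show "nab Z Q (V Q) = ?G Q"
        using Q nab[OF Z _ T[OF V]] local_extension_dir_deriv[OF gZ _ _ T[OF V]]
        by (simp add: grass_conn_def)
    qed (rule W)
    have vf: "vector_field p (\<lambda>Q. nab Z Q (V Q))"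
    proof -
      have "is_connection p nab" unfolding nab_def by (rule levi_civita_properties(1))
      then show ?thesis using V Z unfolding is_connection_def by simp
    qed
    note d = tangent_proj_deriv[OF frechet_derivative_apply_has_derivative[OF W sZ
          smooth_on_open_deriv[OF W(1) sV W(2)]]]
    have "nab (\<lambda>Q. nab Z Q (V Q)) P u = tangent_proj P (?D ?G u)"
      by (simp add: nab[OF vf P u] grass_conn_def local_extension_dir_deriv[OF ext W(2) P u])
    also have "?D ?G u = tangent_proj P
       (?D (\<lambda>Q. frechet_derivative gZ (at Q) (V P)) u + ?D gZ (?D gV u)) +
       (u ** ?D gZ (V P) + ?D gZ (V P) ** u - 2 *\<^sub>R (u ** ?D gZ (V P) ** P) - 2 *\<^sub>R (P ** ?D gZ (V P) ** u))"
      using frechet_derivative_at[OF d, symmetric] VP by simp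
    finally show ?thesis .
  qed
  have lie: "lie_bracket p X Y P = ?D gY (X P) - ?D gX (Y P)"
    by (simp add: lie_bracket_def local_extension_dir_deriv[OF gX W(2) P T[OF Y P]]
        local_extension_dir_deriv[OF gY W(2) P T[OF X P]])
  have lin: "linear (?D gZ)"
    using smooth_on_open_deriv[OF W(1) sZ W(2)] has_derivative_linear by blast
  have third: "nab Z P (lie_bracket p X Y P) = tangent_proj P (?D gZ (?D gY (X P))) - tangent_proj P (?D gZ (?D gX (Y P)))"
    unfolding nab[OF Z P lie_bracket_tangent[OF X Y P]] grass_conn_def
      local_extension_dir_deriv[OF gZ W(2) P lie_bracket_tangent[OF X Y P]]
    by (simp add: lie linear_diff[OF lin] linear_diff[OF tangent_proj_linear])
  have symm: "?D (\<lambda>Q. frechet_derivative gZ (at Q) (Y P)) (X P) = ?D (\<lambda>Q. frechet_derivative gZ (at Q) (X P)) (Y P)"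
  proof -
    have "frechet_derivative (\<lambda>Q. frechet_derivative gZ (at Q within W) v) (at P within W)
      = frechet_derivative (\<lambda>Q. frechet_derivative gZ (at Q) v) (at P)" for v
      using frechet_derivative_within_cong[of P W "\<lambda>Q. frechet_derivative gZ (at Q within W) v" "\<lambda>Q. frechet_derivative gZ (at Q) v"]
        at_within_open[OF _ W(1)] W(2) by simp
    then show ?thesis
      using second_derivative_symmetric[OF W sZ, of "Y P" "X P"] by simp
  qed
  have norm: "tangent_proj P (u ** ?D gZ v + ?D gZ v ** u - 2 *\<^sub>R (u ** ?D gZ v ** P) - 2 *\<^sub>R (P ** ?D gZ v ** u))
    = u ** (Z P ** v + v ** Z P) + (Z P ** v + v ** Z P) ** u"
    if "u \<in> tangent_space P" "v \<in> tangent_space P" for u v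
    by (rule tangent_proj_normal_part[OF P that(1)
          vector_field_deriv(2)[OF Z P that(2) local_extension_has_derivative[OF gZ W(2) P]]])
  show ?thesis
    unfolding second[OF Y gY T[OF X P]] second[OF X gX T[OF Y P]] third symm
    by (simp add: linear_add[OF tangent_proj_linear] tangent_proj_idem[OF P]
        norm[OF T[OF X P] T[OF Y P]] norm[OF T[OF Y P] T[OF X P]])
       (simp add: commutator_def matrix_algebra)
qed

text \<open>The definite description requires that all extensions give the same value, and also that
  one triple of extensions exists: without it every \<open>r\<close> would qualify.\<close>

lemma curvature_eq:
  assumes P: "P \<in> Gr p" and "x \<in> tangent_space P" "y \<in> tangent_space P" "z \<in> tangent_space P"
  shows "curvature p P x y z = commutator (commutator x y) z"
proof -
  obtain X where X: "vector_field p X" "X P = x" using vector_field_extension[OF P assms(2)] .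
  obtain Y where Y: "vector_field p Y" "Y P = y" using vector_field_extension[OF P assms(3)] .
  obtain Z where Z: "vector_field p Z" "Z P = z" using vector_field_extension[OF P assms(4)] .
  show ?thesis
    unfolding curvature_def Let_def
  proof (rule the_equality, intro allI impI)
    show "commutator (commutator x y) z = levi_civita p (\<lambda>Q. levi_civita p Z Q (Y Q)) P (X P)
        - levi_civita p (\<lambda>Q. levi_civita p Z Q (X Q)) P (Y P) - levi_civita p Z P (lie_bracket p X Y P)"
      if "vector_field p X \<and> vector_field p Y \<and> vector_field p Z \<and> X P = x \<and> Y P = y \<and> Z P = z"
      for X Y Z
      using curvature_vector_fields[of p X Y Z P] that P by simp
  next
    fix r
    assume "\<forall>X Y Z. vector_field p X \<and> vector_field p Y \<and> vector_field p Z \<and> X P = x \<and> Y P = y \<and> Z P = z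
      \<longrightarrow> r = levi_civita p (\<lambda>Q. levi_civita p Z Q (Y Q)) P (X P)
        - levi_civita p (\<lambda>Q. levi_civita p Z Q (X Q)) P (Y P) - levi_civita p Z P (lie_bracket p X Y P)"
    then show "r = commutator (commutator x y) z"
      using curvature_vector_fields[OF X(1) Y(1) Z(1) P] X Y Z by simp
  qed
qed

section \<open>Covariant derivatives and Jacobi fields along a geodesic\<close>

lemma vector_derivative_unique_interval:
  fixes a b :: real and f :: "real \<Rightarrow> 'b::real_normed_vector"
  assumes "a < b" "t \<in> {a..b}" "(f has_vector_derivative f') (at t within {a..b})"
    "(f has_vector_derivative f'') (at t within {a..b})"
  shows "f' = f''"
proof -
  note u = frechet_derivative_within_eq[OF deriv_unique_on_interval[OF assms(1)] assms(2)]
  have "(\<lambda>x. x *\<^sub>R f') = (\<lambda>x. x *\<^sub>R f'')"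
    using u[OF assms(3)[unfolded has_vector_derivative_def]]
      u[OF assms(4)[unfolded has_vector_derivative_def]] by simp
  from fun_cong[OF this, of 1] show ?thesis by simp
qed

lemma vector_derivative_eq_interval:
  fixes a b :: real and f :: "real \<Rightarrow> 'b::real_normed_vector"
  assumes "a < b" "t \<in> {a..b}" "(f has_vector_derivative f') (at t within {a..b})"
  shows "vector_derivative f (at t within {a..b}) = f'"
  using vector_derivative_unique_interval[OF assms(1,2) _ assms(3)]
    vector_derivative_works[THEN iffD1, OF differentiableI_vector[OF assms(3)]] by simp

context geodesic
begin

lemma conj_deriv:
  "((\<lambda>t. E t ** K ** E (- t)) has_vector_derivative
     (\<Omega> ** (E t ** K ** E (- t)) - (E t ** K ** E (- t)) ** \<Omega>)) (at t within T)"
proof -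
  have "((\<lambda>t. E t ** K ** E (- t)) has_vector_derivative
     (E t ** K ** (- (\<Omega> ** E (- t))) + (\<Omega> ** E t ** K) ** E (- t))) (at t within T)"
    by (intro matrix_mult.has_vector_derivative E_minus_deriv
        bounded_linear.has_vector_derivative[OF matrix_mult.bounded_linear_left] E_deriv)
  moreover have "E t ** K ** (- (\<Omega> ** E (- t))) + (\<Omega> ** E t ** K) ** E (- t)
      = \<Omega> ** (E t ** K ** E (- t)) - (E t ** K ** E (- t)) ** \<Omega>"
    by (simp add: matrix_algebra E_commute)
  ultimately show ?thesis by simp
qed

lemma bounded_linear_commutator: "bounded_linear (\<lambda>X. \<Omega> ** X - X ** \<Omega>)"
  by (intro bounded_linear_sub matrix_mult.bounded_linear_left matrix_mult.bounded_linear_right)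

lemma smooth_on_conj:
  assumes "deriv_unique_on T"
  shows "smooth_on (\<lambda>t. E t ** K ** E (- t)) T"
  by (rule smooth_onI_deriv[OF assms conj_deriv Ck_on_linear[OF assms bounded_linear_commutator]])

lemma smooth_on_\<gamma>: "deriv_unique_on T \<Longrightarrow> smooth_on \<gamma> T"
  using smooth_on_conj[of T P] unfolding \<gamma>_eq[abs_def] .

definition velocity where "velocity t = E t ** \<Delta> ** E (- t)"

lemma velocity_tangent: "velocity t \<in> tangent_space (\<gamma> t)"
  unfolding velocity_def by (rule conj_tangent[OF \<Delta>])

lemma \<gamma>_has_velocity: "(\<gamma> has_vector_derivative velocity t) (at t within T)"
  using \<gamma>_deriv unfolding \<gamma>_velocity velocity_def .

text \<open>\<open>\<Omega>\<close> commutes with \<open>E t\<close>, so being off-diagonal with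
  respect to \<open>P\<close> carries over to \<open>\<gamma> t\<close>. Products of two
  off-diagonal matrices are block diagonal; hence commutators of \<open>\<Omega>\<close> with
  tangent vectors are normal.\<close>

lemma \<Omega>_off_diagonal: "\<Omega> ** \<gamma> t + \<gamma> t ** \<Omega> = \<Omega>"
proof -
  have "\<Omega> ** P + P ** \<Omega> = \<Omega>"
    unfolding \<Omega>_def commutator_def
    by (simp add: matrix_algebra GrD[OF P] tangent_spaceD_mult[OF P \<Delta>] numeral_times_matrix)
  then have "E t ** (\<Omega> ** P + P ** \<Omega>) ** E (- t) = E t ** \<Omega> ** E (- t)" by simp
  then show ?thesis
    unfolding \<gamma>_eq by (simp add: matrix_algebra E_commute E_commute' E_inverse)
qed

section \<open>Covariant differentiation along a geodesic\<close>

definition covd where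
  "covd T J t = tangent_proj (\<gamma> t) (vector_derivative J (at t within T))"

text \<open>In the third claim, a field \<open>E t K(t) E (- t)\<close> has
  \<open>E t K'(t) E (- t)\<close> as its covariant derivative. The reason is that \<open>J'\<close>
  is the sum of a tangent matrix and of the commutator of \<open>\<Omega>\<close> with
  \<open>J t\<close>, which is normal.\<close>

lemma field_along_deriv:
  assumes L: "0 < L" and J: "field_along \<gamma> {0..L} J" and t: "t \<in> {0..L}"
  defines "J' \<equiv> vector_derivative J (at t within {0..L})"
  shows "(J has_vector_derivative J') (at t within {0..L})"
    and "transpose J' = J'"
    and "covd {0..L} J t = J' + J t ** \<Omega> - \<Omega> ** J t"
proof -
  let ?T = "{0..L}"
  have JT: "J s \<in> tangent_space (\<gamma> s)" if "s \<in> ?T" for s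
    using J that by (simp add: field_along_def)
  show J': "(J has_vector_derivative J') (at t within ?T)"
    unfolding J'_def using J smooth_on_vector_derivative(1)[OF L _ t, of J] by (simp add: field_along_def)
  have "((\<lambda>s. transpose (J s)) has_vector_derivative transpose J') (at t within ?T)"
    by (rule bounded_linear.has_vector_derivative[OF bounded_linear_transpose J'])
  then have "(J has_vector_derivative transpose J') (at t within ?T)"
    by (rule has_vector_derivative_transform[OF t, rotated]) (simp add: tangent_spaceD(1)[OF JT])
  from vector_derivative_unique_interval[OF L t this J'] show "transpose J' = J'" .
  let ?g = "\<gamma> t" and ?J = "J t" and ?g' = "\<Omega> ** \<gamma> t - \<gamma> t ** \<Omega>"
  have "((\<lambda>s. J s ** \<gamma> s + \<gamma> s ** J s) has_vector_derivative
     (?J ** ?g' + J' ** ?g) + (?g ** J' + ?g' ** ?J)) (at t within ?T)"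
    by (intro has_vector_derivative_add matrix_mult.has_vector_derivative J' \<gamma>_deriv)
  then have "(J has_vector_derivative (?J ** ?g' + J' ** ?g) + (?g ** J' + ?g' ** ?J)) (at t within ?T)"
    by (rule has_vector_derivative_transform[OF t, rotated]) (simp add: tangent_spaceD(2)[OF JT])
  from vector_derivative_unique_interval[OF L t this J']
  have h: "(?J ** ?g' + J' ** ?g) + (?g ** J' + ?g' ** ?J) = J'" .
  \<comment> \<open>\<open>N\<close> is tangent: the equation \<open>h\<close> for
    \<open>J'\<close>, obtained by differentiating the tangency of \<open>J\<close>, has an
    inhomogeneous part that the commutator compensates.\<close>
  define N where "N = J' + ?J ** \<Omega> - \<Omega> ** ?J"
  note JD = tangent_spaceD_mult[OF \<gamma>_Gr JT[OF t]]
  have "N ** ?g + ?g ** N - N = (J' ** ?g + ?g ** J' - J')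
      + (?J ** \<Omega> ** ?g - \<Omega> ** (?J ** ?g) + ?g ** ?J ** \<Omega> - ?g ** \<Omega> ** ?J - ?J ** \<Omega> + \<Omega> ** ?J)"
    unfolding N_def by (simp add: matrix_algebra)
  also have "J' ** ?g + ?g ** J' - J' = - (?J ** ?g' + ?g' ** ?J)"
    using h by (simp add: algebra_simps)
  also have "- (?J ** ?g' + ?g' ** ?J)
      + (?J ** \<Omega> ** ?g - \<Omega> ** (?J ** ?g) + ?g ** ?J ** \<Omega> - ?g ** \<Omega> ** ?J - ?J ** \<Omega> + \<Omega> ** ?J) = 0"
    by (simp add: matrix_algebra JD)
  finally have a: "N ** ?g = N - ?g ** N" by (simp add: algebra_simps)
  have N1: "tangent_proj ?g N = N"
    unfolding tangent_proj_def by (simp add: matrix_algebra a GrD[OF \<gamma>_Gr[of t]])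
  have N2: "tangent_proj ?g (?J ** \<Omega> - \<Omega> ** ?J) = 0"
  proof -
    have a: "\<Omega> ** ?g = \<Omega> - ?g ** \<Omega>" using \<Omega>_off_diagonal[of t] by (simp add: algebra_simps)
    have a': "\<Omega> ** (?g ** X) = \<Omega> ** X - ?g ** (\<Omega> ** X)" for X
      using arg_cong[OF a, of "\<lambda>M. M ** X"] by (simp add: matrix_algebra)
    show ?thesis
      unfolding tangent_proj_def scaleR_2
      by (simp add: matrix_algebra a a' JD GrD[OF \<gamma>_Gr[of t]] numeral_times_matrix)
  qed
  have "tangent_proj ?g J' = tangent_proj ?g N - tangent_proj ?g (?J ** \<Omega> - \<Omega> ** ?J)"
    unfolding linear_diff[OF tangent_proj_linear, symmetric] by (simp add: N_def)
  then show "covd {0..L} J t = J' + J t ** \<Omega> - \<Omega> ** J t"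
    unfolding covd_def using N1 N2 by (simp add: J'_def N_def)
qed

lemma smooth_on_tangent_proj_\<gamma>:
  assumes "deriv_unique_on T" "smooth_on F T"
  shows "smooth_on (\<lambda>t. tangent_proj (\<gamma> t) (F t)) T"
proof -
  note m = smooth_on_bilinear[OF assms(1) bounded_bilinear_matrix_mult]
  note g = smooth_on_\<gamma>[OF assms(1)]
  show ?thesis unfolding tangent_proj_def
    by (rule smooth_on_diff[OF assms(1) smooth_on_add[OF assms(1) m[OF g assms(2)] m[OF assms(2) g]]
        smooth_on_linear[OF assms(1) bounded_linear_scaleR_right m[OF m[OF g assms(2)] g]]])
qed

lemma field_along_covd:
  assumes L: "0 < L" and J: "field_along \<gamma> {0..L} J"
  shows "field_along \<gamma> {0..L} (covd {0..L} J)"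
  unfolding field_along_def
proof
  show "smooth_on (covd {0..L} J) {0..L}"
    unfolding covd_def[abs_def] using J
    by (intro smooth_on_tangent_proj_\<gamma> deriv_unique_on_interval L smooth_on_vector_derivative(2))
       (simp add: field_along_def)
  show "\<forall>t\<in>{0..L}. covd {0..L} J t \<in> tangent_space (\<gamma> t)"
    unfolding covd_def using tangent_proj_in[OF \<gamma>_Gr field_along_deriv(2)[OF L J]] by blast
qed

text \<open>First covariant derivatives are identified on the interval only; this carries the
  identification through a second differentiation.\<close>

lemma covd_cong:
  assumes L: "0 < L" and K: "field_along \<gamma> {0..L} K" and t: "t \<in> {0..L}"
    and eq: "\<And>s. s \<in> {0..L} \<Longrightarrow> J s = K s"
  shows "covd {0..L} J t = covd {0..L} K t"
proof -
  have "(J has_vector_derivative vector_derivative K (at t within {0..L})) (at t within {0..L})"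
    by (rule has_vector_derivative_transform[OF t _ field_along_deriv(1)[OF L K t]]) (rule eq)
  from vector_derivative_eq_interval[OF L t this] show ?thesis by (simp add: covd_def)
qed

lemma is_covariant_derivative_covd:
  assumes L: "0 < L"
  shows "is_covariant_derivative_along p \<gamma> {0..L} (covd {0..L})"
  unfolding is_covariant_derivative_along_def
proof (intro conjI allI impI ballI)
  fix J assume "field_along \<gamma> {0..L} J"
  then show "field_along \<gamma> {0..L} (covd {0..L} J)" by (rule field_along_covd[OF L])
next
  fix J K t assume J: "field_along \<gamma> {0..L} J" and K: "field_along \<gamma> {0..L} K" and t: "t \<in> {0..L}"
  show "covd {0..L} (\<lambda>s. J s + K s) t = covd {0..L} J t + covd {0..L} K t"
    unfolding covd_def
      vector_derivative_eq_interval[OF L t has_vector_derivative_add[OF field_along_deriv(1)[OF L J t]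
        field_along_deriv(1)[OF L K t]]]
    by (simp add: linear_add[OF tangent_proj_linear])
next
  fix f :: "real \<Rightarrow> real" and J t
  assume f: "smooth_on f {0..L}" and J: "field_along \<gamma> {0..L} J" and t: "t \<in> {0..L}"
  have JT: "J t \<in> tangent_space (\<gamma> t)" using J t by (simp add: field_along_def)
  have "((\<lambda>s. f s *\<^sub>R J s) has_vector_derivative
      (f t *\<^sub>R vector_derivative J (at t within {0..L}) + vector_derivative f (at t within {0..L}) *\<^sub>R J t)) (at t within {0..L})"
    by (rule bounded_bilinear.has_vector_derivative[OF bounded_bilinear_scaleR
        smooth_on_vector_derivative(1)[OF L f t] field_along_deriv(1)[OF L J t]])
  from vector_derivative_eq_interval[OF L t this]
  show "covd {0..L} (\<lambda>s. f s *\<^sub>R J s) t =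
           vector_derivative f (at t within {0..L}) *\<^sub>R J t + f t *\<^sub>R covd {0..L} J t"
    by (simp add: covd_def linear_add[OF tangent_proj_linear] linear_cmul[OF tangent_proj_linear]
        tangent_proj_ident[OF \<gamma>_Gr JT])
next
  fix X :: "real^'n^'n \<Rightarrow> real^'n^'n" and t assume X: "vector_field p X" and t: "t \<in> {0..L}"
  obtain X' where X': "(X has_derivative X') (at (\<gamma> t) within Gr p)"
    using vector_field_has_derivative[OF X \<gamma>_Gr] .
  have "(X \<circ> \<gamma> has_derivative X' \<circ> (\<lambda>h. h *\<^sub>R velocity t)) (at t within {0..L})"
    by (rule diff_chain_within[OF \<gamma>_has_velocity[unfolded has_vector_derivative_def]])
       (use has_derivative_subset[OF X', of "\<gamma> ` {0..L}"] \<gamma>_Gr in auto)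
  then have "((\<lambda>s. X (\<gamma> s)) has_vector_derivative X' (velocity t)) (at t within {0..L})"
    using has_derivative_linear[OF X'] by (simp add: has_vector_derivative_def comp_def linear_cmul)
  from vector_derivative_eq_interval[OF L t this]
  show "covd {0..L} (\<lambda>s. X (\<gamma> s)) t =
           levi_civita p X (\<gamma> t) (vector_derivative \<gamma> (at t within {0..L}))"
    unfolding vector_derivative_eq_interval[OF L t \<gamma>_has_velocity]
      levi_civita_eq[OF X \<gamma>_Gr velocity_tangent] grass_conn_eq[OF \<gamma>_Gr velocity_tangent X']
    by (simp add: covd_def)
qed

text \<open>A field along \<open>\<gamma>\<close> is a combination, with smooth coefficients, of restrictions of global
  vector fields, on which the axioms determine a covariant derivative. That two fields agreeing on the
  interval have the same derivative there also follows from the Leibniz rule, with a factor that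
  vanishes on the interval.\<close>

lemma covariant_derivative_unique:
  assumes L: "0 < L"
    and D: "is_covariant_derivative_along p \<gamma> {0..L} D1" "is_covariant_derivative_along p \<gamma> {0..L} D2"
    and J: "field_along \<gamma> {0..L} J" and t: "t \<in> {0..L}"
  shows "D1 J t = D2 J t"
proof -
  let ?T = "{0..L}"
  note U = deriv_unique_on_interval[OF L]
  \<comment> \<open>Tangential projections of the symmetrized matrix units: global vector fields
    that span every tangent space. The entries of \<open>J\<close> serve as coefficients.\<close>
  define e where "e b Q = tangent_proj Q ((1/2) *\<^sub>R (b + transpose b))" for b Q :: "real^'n^'n"
  have sym: "transpose ((1/2) *\<^sub>R (b + transpose b)) = (1/2) *\<^sub>R (b + transpose b)" for b :: "real^'n^'n"
    by (simp add: transpose_algebra add.commute)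
  have ev: "vector_field p (e b)" for b
    unfolding e_def[abs_def] by (rule vector_field_tangent_proj[OF sym])
  have ef: "field_along \<gamma> ?T (\<lambda>s. e b (\<gamma> s))" for b
    unfolding field_along_def e_def
    using smooth_on_tangent_proj_\<gamma>[OF U smooth_on_const[OF U]] tangent_proj_in[OF \<gamma>_Gr sym] by blast
  have cf: "smooth_on (\<lambda>s. J s \<bullet> b) ?T" for b
    by (rule smooth_on_linear[OF U bounded_linear_inner_left]) (use J in \<open>simp add: field_along_def\<close>)
  have scale: "field_along \<gamma> ?T (\<lambda>s. f s *\<^sub>R K s)" if "smooth_on f ?T" "field_along \<gamma> ?T K" for f K
    using that unfolding field_along_def
    by (auto intro!: smooth_on_bilinear[OF U bounded_bilinear_scaleR] tangent_space_scaleR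
        simp del: atLeastAtMost_iff)
  have add: "field_along \<gamma> ?T (\<lambda>s. K s + K' s)" if "field_along \<gamma> ?T K" "field_along \<gamma> ?T K'" for K K'
    using that unfolding field_along_def
    by (auto intro!: smooth_on_add[OF U] tangent_space_add simp del: atLeastAtMost_iff)
  have zero: "field_along \<gamma> ?T (\<lambda>s. 0)"
    using smooth_on_const[OF U] subspace_0[OF subspace_tangent_space] by (auto simp: field_along_def)
  have expand: "J s = (\<Sum>b\<in>Basis. (J s \<bullet> b) *\<^sub>R e b (\<gamma> s))" if s: "s \<in> ?T" for s
  proof -
    have JT: "J s \<in> tangent_space (\<gamma> s)" using J s by (simp add: field_along_def)
    have lin: "linear (\<lambda>M::real^'n^'n. tangent_proj (\<gamma> s) ((1/2) *\<^sub>R (M + transpose M)))"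
      by (auto intro!: linearI simp: transpose_algebra linear_add[OF tangent_proj_linear, symmetric]
          linear_cmul[OF tangent_proj_linear, symmetric] algebra_simps)
    have "J s = tangent_proj (\<gamma> s) ((1/2) *\<^sub>R (J s + transpose (J s)))"
      by (simp add: tangent_spaceD(1)[OF JT] tangent_proj_ident[OF \<gamma>_Gr JT] scaleR_2[symmetric])
    also have "\<dots> = (\<lambda>M. tangent_proj (\<gamma> s) ((1/2) *\<^sub>R (M + transpose M))) (\<Sum>b\<in>Basis. (J s \<bullet> b) *\<^sub>R b)"
      by (simp only: euclidean_representation)
    also have "\<dots> = (\<Sum>b\<in>Basis. (J s \<bullet> b) *\<^sub>R e b (\<gamma> s))"
      unfolding linear_sum[OF lin] linear_cmul[OF lin] e_def ..
    finally show ?thesis .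
  qed
  have val: "D J t = (\<Sum>b\<in>Basis. vector_derivative (\<lambda>s. J s \<bullet> b) (at t within ?T) *\<^sub>R e b (\<gamma> t)
        + (J t \<bullet> b) *\<^sub>R levi_civita p (e b) (\<gamma> t) (vector_derivative \<gamma> (at t within ?T)))"
    if D: "is_covariant_derivative_along p \<gamma> ?T D" for D
  proof -
    have Dadd: "D (\<lambda>s. K s + K' s) t = D K t + D K' t"
      if "field_along \<gamma> ?T K" "field_along \<gamma> ?T K'" for K K'
      using D that t unfolding is_covariant_derivative_along_def by blast
    have Dscale: "D (\<lambda>s. f s *\<^sub>R K s) t = vector_derivative f (at t within ?T) *\<^sub>R K t + f t *\<^sub>R D K t"
      if "smooth_on f ?T" "field_along \<gamma> ?T K" for f K
      using D that t unfolding is_covariant_derivative_along_def by blast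
    have Dzero: "D K t = 0" if K: "field_along \<gamma> ?T K" and K0: "\<And>s. s \<in> ?T \<Longrightarrow> K s = 0" for K
    proof -
      \<comment> \<open>With value 1 outside the interval, \<open>f\<close> times \<open>K\<close>
        is \<open>K\<close> as a function on the whole line, while \<open>K t = 0\<close> and
        \<open>f t = 0\<close> annihilate both terms of the Leibniz rule.\<close>
      define f :: "real \<Rightarrow> real" where "f s = (if s \<in> ?T then 0 else 1)" for s
      have "smooth_on f ?T"
        using smooth_on_const[OF U, of "0::real"] smooth_on_cong[of ?T f "\<lambda>s. 0"] by (simp add: f_def)
      moreover have "(\<lambda>s. f s *\<^sub>R K s) = K" using K0 by (auto simp: f_def)
      ultimately show ?thesis using Dscale[of f K] K K0[OF t] t by (simp add: f_def)
    qed
    have Dsum: "field_along \<gamma> ?T (\<lambda>s. \<Sum>b\<in>B. F b s) \<and> D (\<lambda>s. \<Sum>b\<in>B. F b s) t = (\<Sum>b\<in>B. D (F b) t)"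
      if "finite B" "\<And>b. b \<in> B \<Longrightarrow> field_along \<gamma> ?T (F b)"
      for B :: "(real^'n^'n) set" and F
      using that
    proof (induction B rule: finite_induct)
      case empty
      then show ?case using zero Dzero[OF zero] by simp
    next
      case (insert b B)
      then show ?case using add[of "F b" "\<lambda>s. \<Sum>b\<in>B. F b s"] Dadd[of "F b" "\<lambda>s. \<Sum>b\<in>B. F b s"] by simp
    qed
    let ?F = "\<lambda>b s. (J s \<bullet> b) *\<^sub>R e b (\<gamma> s)"
    have S: "field_along \<gamma> ?T (\<lambda>s. \<Sum>b\<in>Basis. ?F b s)"
      "D (\<lambda>s. \<Sum>b\<in>Basis. ?F b s) t = (\<Sum>b\<in>Basis. D (?F b) t)"
      using Dsum[OF finite_Basis scale[OF cf ef]] by auto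
    let ?K = "\<lambda>s. J s + (-1) *\<^sub>R (\<Sum>b\<in>Basis. ?F b s)"
    have K: "field_along \<gamma> ?T ?K"
      by (rule add[OF J scale[OF smooth_on_const[OF U] S(1)]])
    have "D J t = D (\<lambda>s. ?K s + (\<Sum>b\<in>Basis. ?F b s)) t" by simp
    also have "\<dots> = D ?K t + D (\<lambda>s. \<Sum>b\<in>Basis. ?F b s) t" by (rule Dadd[OF K S(1)])
    also have "D ?K t = 0" by (rule Dzero[OF K]) (use expand in simp)
    also have "D (\<lambda>s. \<Sum>b\<in>Basis. ?F b s) t = (\<Sum>b\<in>Basis. vector_derivative (\<lambda>s. J s \<bullet> b) (at t within ?T) *\<^sub>R e b (\<gamma> t)
        + (J t \<bullet> b) *\<^sub>R levi_civita p (e b) (\<gamma> t) (vector_derivative \<gamma> (at t within ?T)))"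
    proof -
      have "D (\<lambda>s. e b (\<gamma> s)) t = levi_civita p (e b) (\<gamma> t) (vector_derivative \<gamma> (at t within ?T))" for b
        using D ev t unfolding is_covariant_derivative_along_def by blast
      then show ?thesis unfolding S(2) using Dscale[OF cf ef] by simp
    qed
    finally show ?thesis by simp
  qed
  show ?thesis unfolding val[OF D(1)] val[OF D(2)] ..
qed

lemma covariant_derivative_along_eq:
  assumes L: "0 < L" and J: "field_along \<gamma> {0..L} J" and t: "t \<in> {0..L}"
  shows "covariant_derivative_along p \<gamma> {0..L} J t = covd {0..L} J t"
    and "field_along \<gamma> {0..L} (covariant_derivative_along p \<gamma> {0..L} J)"
proof -
  have D: "is_covariant_derivative_along p \<gamma> {0..L} (covariant_derivative_along p \<gamma> {0..L})"
    unfolding covariant_derivative_along_def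
    by (rule someI[of "is_covariant_derivative_along p \<gamma> {0..L}", OF is_covariant_derivative_covd[OF L]])
  show "covariant_derivative_along p \<gamma> {0..L} J t = covd {0..L} J t"
    by (rule covariant_derivative_unique[OF L D is_covariant_derivative_covd[OF L] J t])
  show "field_along \<gamma> {0..L} (covariant_derivative_along p \<gamma> {0..L} J)"
    using D J unfolding is_covariant_derivative_along_def by blast
qed

section \<open>The Jacobi equation along a geodesic\<close>

lemma jacobi_field_iff:
  assumes L: "0 < L"
  shows "jacobi_field p \<gamma> {0..L} J \<longleftrightarrow> field_along \<gamma> {0..L} J \<and>
    (\<forall>t\<in>{0..L}. covd {0..L} (covd {0..L} J) t
       + commutator (commutator (J t) (velocity t)) (velocity t) = 0)"
proof (cases "field_along \<gamma> {0..L} J")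
  case True
  let ?D = "covariant_derivative_along p \<gamma> {0..L}"
  have "?D (?D J) t + curvature p (\<gamma> t) (J t) (vector_derivative \<gamma> (at t within {0..L}))
         (vector_derivative \<gamma> (at t within {0..L}))
      = covd {0..L} (covd {0..L} J) t + commutator (commutator (J t) (velocity t)) (velocity t)"
    if t: "t \<in> {0..L}" for t
  proof -
    have J: "J t \<in> tangent_space (\<gamma> t)" using True t by (simp add: field_along_def)
    have DJ: "field_along \<gamma> {0..L} (?D J)" by (rule covariant_derivative_along_eq(2)[OF L True t])
    have "covd {0..L} (?D J) t = covd {0..L} (covd {0..L} J) t"
      by (rule covd_cong[OF L field_along_covd[OF L True] t covariant_derivative_along_eq(1)[OF L True]])
    then show ?thesis
      unfolding covariant_derivative_along_eq(1)[OF L DJ t] vector_derivative_eq_interval[OF L t \<gamma>_has_velocity]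
        curvature_eq[OF \<gamma>_Gr J velocity_tangent velocity_tangent] by simp
  qed
  then show ?thesis using True unfolding jacobi_field_def Let_def by simp
next
  case False
  then show ?thesis by (simp add: jacobi_field_def)
qed

text \<open>The field \<open>E t K E (- t)\<close> is parallel, so covariant differentiation acts on
  the scalar factor only; conjugation by \<open>E t\<close> carries \<open>eig\<close> from
  \<open>P\<close> to the velocity at \<open>\<gamma> t\<close>.\<close>

lemma jacobi_field_sin:
  assumes L: "0 < L" and K: "K \<in> tangent_space P"
    and eig: "commutator (commutator K \<Delta>) \<Delta> = (w * w) *\<^sub>R K"
  shows "jacobi_field p \<gamma> {0..L} (\<lambda>t. sin (w * t) *\<^sub>R (E t ** K ** E (- t)))"
proof -
  note U = deriv_unique_on_interval[OF L]
  let ?W = "\<lambda>t. E t ** K ** E (- t)"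
  have field: "field_along \<gamma> {0..L} (\<lambda>t. f t *\<^sub>R ?W t)" if "smooth_on f {0..L}" for f
    unfolding field_along_def
    using smooth_on_bilinear[OF U bounded_bilinear_scaleR that smooth_on_conj[OF U]]
      tangent_space_scaleR[OF conj_tangent[OF K]] by blast
  have d: "covd {0..L} (\<lambda>t. f t *\<^sub>R ?W t) t = f' *\<^sub>R ?W t"
    if f: "smooth_on f {0..L}" and f': "(f has_vector_derivative f') (at t within {0..L})" and t: "t \<in> {0..L}" for f f' t
  proof -
    have "((\<lambda>t. f t *\<^sub>R ?W t) has_vector_derivative
        (f t *\<^sub>R (\<Omega> ** ?W t - ?W t ** \<Omega>) + f' *\<^sub>R ?W t)) (at t within {0..L})"
      by (rule bounded_bilinear.has_vector_derivative[OF bounded_bilinear_scaleR f' conj_deriv])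
    from vector_derivative_eq_interval[OF L t this] show ?thesis
      unfolding field_along_deriv(3)[OF L field[OF f] t]
      by (simp add: matrix_mult.scaleR_left matrix_mult.scaleR_right scaleR_diff_right)
  qed
  \<comment> \<open>A simultaneous induction, since each function is up to a factor the derivative
    of the other.\<close>
  have sc: "Ck_on k (\<lambda>t. sin (w * t)) {0..L} \<and> Ck_on k (\<lambda>t. cos (w * t)) {0..L}" for k
  proof (induction k)
    case 0
    then show ?case by (auto intro!: continuous_intros)
  next
    case (Suc k)
    have "Ck_on (Suc k) (\<lambda>t. sin (w * t)) {0..L}"
      by (rule Ck_on_SucI[OF U, where f'="\<lambda>t v. (v * w) * cos (w * t)"])
         (use Suc Ck_on_linear[OF U bounded_linear_mult_right] in \<open>auto intro!: derivative_eq_intros\<close>)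
    moreover have "Ck_on (Suc k) (\<lambda>t. cos (w * t)) {0..L}"
    proof (rule Ck_on_SucI[OF U, where f'="\<lambda>t v. (- (v * w)) * sin (w * t)"])
      show "Ck_on k (\<lambda>x. (- (v * w)) * sin (w * x)) {0..L}" for v
        using Ck_on_linear[OF U bounded_linear_mult_right] Suc by blast
    qed (auto intro!: derivative_eq_intros)
    ultimately show ?case by simp
  qed
  then have s: "smooth_on (\<lambda>t. sin (w * t)) {0..L}" and c: "smooth_on (\<lambda>t. w * cos (w * t)) {0..L}"
    using smooth_on_linear[OF U bounded_linear_mult_right, of "\<lambda>t. cos (w * t)" w] by (simp_all add: smooth_on_def)
  have sd: "((\<lambda>t. sin (w * t)) has_vector_derivative w * cos (w * t)) (at t within {0..L})" for t
    by (auto intro!: derivative_eq_intros simp: has_real_derivative_iff_has_vector_derivative[symmetric])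
  have cd: "((\<lambda>t. w * cos (w * t)) has_vector_derivative - (w * w * sin (w * t))) (at t within {0..L})" for t
    by (auto intro!: derivative_eq_intros simp: has_real_derivative_iff_has_vector_derivative[symmetric])
  have DJ: "covd {0..L} (\<lambda>t. sin (w * t) *\<^sub>R ?W t) t = (w * cos (w * t)) *\<^sub>R ?W t" if "t \<in> {0..L}" for t
    by (rule d[OF s sd that])
  show ?thesis
    unfolding jacobi_field_iff[OF L]
  proof (intro conjI ballI field s)
    fix t assume t: "t \<in> {0..L}"
    let ?DJ = "covd {0..L} (\<lambda>t. sin (w * t) *\<^sub>R ?W t)"
    have "covd {0..L} ?DJ t = covd {0..L} (\<lambda>t. (w * cos (w * t)) *\<^sub>R ?W t) t"
      by (rule covd_cong[OF L field[OF c] t DJ])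
    also have "\<dots> = - (w * w * sin (w * t)) *\<^sub>R ?W t" by (rule d[OF c cd t])
    also have "\<dots> = - (sin (w * t) *\<^sub>R (E t ** ((w * w) *\<^sub>R K) ** E (- t)))"
      by (simp add: matrix_mult.scaleR_left matrix_mult.scaleR_right mult_ac)
    also have "E t ** ((w * w) *\<^sub>R K) ** E (- t) = commutator (commutator (?W t) (velocity t)) (velocity t)"
      unfolding eig[symmetric] by (simp add: commutator_def velocity_def matrix_algebra E_inverse' numeral_times_matrix)
    finally show "covd {0..L} ?DJ t + commutator (commutator (sin (w * t) *\<^sub>R ?W t) (velocity t)) (velocity t) = 0"
      by (simp add: commutator_scaleR)
  qed
qed

text \<open>\<open>E t u\<close> and \<open>E t w\<close> remain eigenvectors of the velocity
  \<open>V\<close> for \<open>a\<close> and \<open>b\<close>. The curvature term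
  \<open>J V V - 2 V J V + V V J\<close> therefore contributes
  \<open>b\<^sup>2 - 2 a b + a\<^sup>2\<close> to the component between them, and differentiating
  the vectors accounts for the commutator in \<open>covd\<close>.\<close>

lemma jacobi_field_component:
  assumes L: "0 < L" and J: "jacobi_field p \<gamma> {0..L} J" and t: "t \<in> {0..L}"
    and u: "\<Delta> *v u = a *\<^sub>R u" and w: "\<Delta> *v w = b *\<^sub>R w"
  shows "((\<lambda>t. (E t *v u) \<bullet> (J t *v (E t *v w))) has_real_derivative
           (E t *v u) \<bullet> (covd {0..L} J t *v (E t *v w))) (at t within {0..L})"
    and "((\<lambda>t. (E t *v u) \<bullet> (covd {0..L} J t *v (E t *v w))) has_real_derivative
           - (a - b)\<^sup>2 * ((E t *v u) \<bullet> (J t *v (E t *v w)))) (at t within {0..L})"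
proof -
  have F: "field_along \<gamma> {0..L} J" using J by (simp add: jacobi_field_iff[OF L])
  have skew: "(\<Omega> *v x) \<bullet> y = - (x \<bullet> (\<Omega> *v y))" for x y
    using inner_matrix_vector[of x \<Omega> y] transpose_\<Omega> by (simp add: matrix_vector.minus_left del: transpose_matrix_vector)
  have deriv: "((\<lambda>t. (E t *v u) \<bullet> (K t *v (E t *v w))) has_real_derivative
           (E t *v u) \<bullet> (covd {0..L} K t *v (E t *v w))) (at t within {0..L})"
    if K: "field_along \<gamma> {0..L} K" for K
  proof -
    have Ed: "((\<lambda>t. E t *v x) has_vector_derivative (\<Omega> *v (E t *v x))) (at t within {0..L})" for x
      using bounded_linear.has_vector_derivative[OF matrix_vector.bounded_linear_left E_deriv]
      by (simp add: matrix_vector_mul_assoc)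
    note d = bounded_bilinear.has_vector_derivative[OF bounded_bilinear_inner Ed[of u]
        matrix_vector.has_vector_derivative[OF field_along_deriv(1)[OF L K t] Ed[of w]]]
    have "(E t *v u) \<bullet> (K t *v (\<Omega> *v (E t *v w)) + vector_derivative K (at t within {0..L}) *v (E t *v w))
        + (\<Omega> *v (E t *v u)) \<bullet> (K t *v (E t *v w)) = (E t *v u) \<bullet> (covd {0..L} K t *v (E t *v w))"
      unfolding field_along_deriv(3)[OF L K t] skew
      by (simp add: matrix_vector_algebra inner_add_right inner_diff_right)
    with d show ?thesis by (simp add: has_real_derivative_iff_has_vector_derivative)
  qed
  show "((\<lambda>t. (E t *v u) \<bullet> (J t *v (E t *v w))) has_real_derivative
           (E t *v u) \<bullet> (covd {0..L} J t *v (E t *v w))) (at t within {0..L})"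
    by (rule deriv[OF F])
  have ev: "velocity t *v (E t *v x) = c *\<^sub>R (E t *v x)" if "\<Delta> *v x = c *\<^sub>R x" for x c
  proof -
    have "velocity t *v (E t *v x) = E t *v (\<Delta> *v x)"
      unfolding velocity_def by (simp add: matrix_vector_mul_assoc matrix_algebra E_inverse)
    then show ?thesis by (simp add: that matrix_vector.scaleR_right)
  qed
  have vsym: "x \<bullet> (velocity t *v y) = (velocity t *v x) \<bullet> y" for x y
    using inner_matrix_vector[of x "velocity t" y] tangent_spaceD(1)[OF velocity_tangent]
    by (simp del: transpose_matrix_vector)
  have second: "covd {0..L} (covd {0..L} J) t = - commutator (commutator (J t) (velocity t)) (velocity t)"
    using J t by (simp add: jacobi_field_iff[OF L] eq_neg_iff_add_eq_0)

  have "(E t *v u) \<bullet> (covd {0..L} (covd {0..L} J) t *v (E t *v w))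
      = - (a - b)\<^sup>2 * ((E t *v u) \<bullet> (J t *v (E t *v w)))"
    unfolding second
    by (simp add: commutator_def matrix_algebra matrix_vector_algebra numeral_times_matrix
        ev[OF u] ev[OF w] vsym inner_diff_right inner_minus_right)
       (simp add: power2_eq_square algebra_simps vsym ev[OF u])
  then show "((\<lambda>t. (E t *v u) \<bullet> (covd {0..L} J t *v (E t *v w))) has_real_derivative
           - (a - b)\<^sup>2 * ((E t *v u) \<bullet> (J t *v (E t *v w)))) (at t within {0..L})"
    using deriv[OF field_along_covd[OF L F]] by simp
qed

end

section \<open>Zeros of a harmonic oscillator\<close>

lemma oscillator_zeros:
  fixes f g :: "real \<Rightarrow> real"
  assumes L: "0 < L"
    and f: "\<And>t. t \<in> {0..L} \<Longrightarrow> (f has_real_derivative g t) (at t within {0..L})"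
    and g: "\<And>t. t \<in> {0..L} \<Longrightarrow> (g has_real_derivative - \<mu>\<^sup>2 * f t) (at t within {0..L})"
    and zero: "f 0 = 0" "f L = 0" and s: "s \<in> {0..L}" "f s \<noteq> 0"
  shows "\<mu> \<noteq> 0 \<and> sin (\<mu> * L) = 0"
proof -
  have const: "h t = h 0" if "\<And>t. t \<in> {0..L} \<Longrightarrow> (h has_real_derivative 0) (at t within {0..L})" "t \<in> {0..L}"
    for h :: "real \<Rightarrow> real" and t
    by (rule has_derivative_zero_unique[of "{0..L}"])
       (use that L in \<open>auto simp: has_field_derivative_def lambda_zero\<close>)
  \<comment> \<open>\<open>h1\<close> and \<open>h2\<close> are the coordinates of the pair of
    \<open>\<mu> f\<close> and \<open>g\<close>, turned by the angle \<open>\<mu> t\<close>. They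
    are constants of motion, and solving for \<open>f\<close> gives a multiple of the sine.\<close>
  define h1 where "h1 t = g t * sin (\<mu> * t) - \<mu> * f t * cos (\<mu> * t)" for t
  define h2 where "h2 t = g t * cos (\<mu> * t) + \<mu> * f t * sin (\<mu> * t)" for t
  have h1: "h1 t = 0" if "t \<in> {0..L}" for t
  proof -
    have "(h1 has_real_derivative 0) (at t within {0..L})" if "t \<in> {0..L}" for t
      unfolding h1_def
      by (rule derivative_eq_intros f[OF that] g[OF that] refl | simp)+
         (simp add: power2_eq_square algebra_simps)
    from const[OF this that] show ?thesis by (simp add: h1_def zero)
  qed
  have h2: "h2 t = g 0" if "t \<in> {0..L}" for t
  proof -
    have "(h2 has_real_derivative 0) (at t within {0..L})" if "t \<in> {0..L}" for t
      unfolding h2_def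
      by (rule derivative_eq_intros f[OF that] g[OF that] refl | simp)+
         (simp add: power2_eq_square algebra_simps)
    from const[OF this that] show ?thesis by (simp add: h2_def)
  qed
  have sol: "\<mu> * f t = g 0 * sin (\<mu> * t)" if "t \<in> {0..L}" for t
  proof -
    have "(g t * C + \<mu> * f t * S) * S - (g t * S - \<mu> * f t * C) * C = \<mu> * f t * (C * C + S * S)" for S C
      by (simp add: algebra_simps)
    from this[of "cos (\<mu> * t)" "sin (\<mu> * t)"] show ?thesis
      using h1[OF that] h2[OF that] by (simp add: h1_def h2_def)
  qed
  \<comment> \<open>With frequency zero the solution is linear, so a second zero would make it
    vanish identically.\<close>
  have "\<mu> \<noteq> 0"
  proof
    assume "\<mu> = 0"
    then have g0: "g t = g 0" if "t \<in> {0..L}" for t using h2[OF that] by (simp add: h2_def)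
    have "((\<lambda>t. f t - g 0 * t) has_real_derivative 0) (at t within {0..L})" if "t \<in> {0..L}" for t
      by (rule derivative_eq_intros f[OF that] refl | simp add: g0[OF that])+
    from const[OF this] have lin: "f t = g 0 * t" if "t \<in> {0..L}" for t
      using that zero(1) by fastforce
    then have "g 0 = 0" using lin[of L] L zero(2) by simp
    then show False using lin[OF s(1)] s(2) by simp
  qed
  moreover have "sin (\<mu> * L) = 0"
    using sol[of L] sol[OF s(1)] L zero(2) s(2) \<open>\<mu> \<noteq> 0\<close> by auto
  ultimately show ?thesis by simp
qed

section \<open>Orthonormal families and the spectral theorem\<close>

definition orthonormal_on :: "'i set \<Rightarrow> ('i \<Rightarrow> 'a::real_inner) \<Rightarrow> bool" where
  "orthonormal_on I f \<longleftrightarrow> (\<forall>i\<in>I. \<forall>j\<in>I. f i \<bullet> f j = (if i = j then 1 else 0))"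

lemma orthonormal_onD: "orthonormal_on I f \<Longrightarrow> i \<in> I \<Longrightarrow> j \<in> I \<Longrightarrow> f i \<bullet> f j = (if i = j then 1 else 0)"
  by (simp add: orthonormal_on_def)

lemma orthonormal_on_insert:
  assumes "orthonormal_on I f" "norm x = 1" "\<And>i. i \<in> I \<Longrightarrow> f i \<bullet> x = 0" "j \<notin> I"
  shows "orthonormal_on (insert j I) (f(j := x))"
proof -
  have "x \<bullet> x = 1" using assms(2) by (simp add: dot_square_norm)
  then show ?thesis using assms unfolding orthonormal_on_def by (auto simp: inner_commute)
qed

lemma unit_vector_orthogonal:
  fixes V :: "'a::euclidean_space set"
  assumes V: "subspace V" and S: "S \<subseteq> V" "finite S" "card S < dim V"
  obtains x where "x \<in> V" "norm x = 1" "\<And>s. s \<in> S \<Longrightarrow> s \<bullet> x = 0"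
proof -
  have sV: "span V = V" using V by (simp add: span_eq_iff)
  have "span S \<subseteq> V" using S(1) V by (simp add: span_minimal)
  moreover have "span S \<noteq> V"
    using dim_le_card'[OF S(2)] S(3) dim_span[of S] by auto
  ultimately obtain x where x: "x \<noteq> 0" "x \<in> V" "\<And>y. y \<in> span S \<Longrightarrow> orthogonal x y"
    using orthogonal_to_subspace_exists_gen[of S V] sV by auto
  show ?thesis
  proof (rule that[of "(1 / norm x) *\<^sub>R x"])
    show "(1 / norm x) *\<^sub>R x \<in> V" using x V by (simp add: subspace_scale)
    show "norm ((1 / norm x) *\<^sub>R x) = 1" using x by simp
    show "s \<bullet> (1 / norm x) *\<^sub>R x = 0" if "s \<in> S" for s
      using x(3)[OF span_base[OF that]] by (simp add: orthogonal_def inner_commute)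
  qed
qed

text \<open>Missing indices are filled one at a time by unit vectors of \<open>V\<close> orthogonal
  to all earlier ones. This completes families that are prescribed only where a singular value, or
  later the sine of an angle, is nonzero.\<close>

lemma orthonormal_extend:
  fixes f :: "'i::finite \<Rightarrow> 'a::euclidean_space"
  assumes V: "subspace V" and f: "orthonormal_on I f" "\<And>i. i \<in> I \<Longrightarrow> f i \<in> V"
    and d: "CARD('i) \<le> dim V"
  obtains g where "orthonormal_on UNIV g" "\<And>i. g i \<in> V" "\<And>i. i \<in> I \<Longrightarrow> g i = f i"
proof -
  have "\<exists>g. orthonormal_on (I \<union> J) g \<and> (\<forall>i\<in>I \<union> J. g i \<in> V) \<and> (\<forall>i\<in>I. g i = f i)" if "finite J" for J
    using that
  proof (induction J rule: finite_induct)
    case empty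
    then show ?case using f by auto
  next
    case (insert j J)
    then obtain g where g: "orthonormal_on (I \<union> J) g" "\<forall>i\<in>I \<union> J. g i \<in> V" "\<forall>i\<in>I. g i = f i" by blast
    show ?case
    proof (cases "j \<in> I \<union> J")
      case True
      then show ?thesis using g by (intro exI[of _ g]) (simp add: insert_absorb)
    next
      case False
      have "card (g ` (I \<union> J)) \<le> card (I \<union> J)" by (rule card_image_le) simp
      also have "\<dots> < CARD('i)"
        by (rule psubset_card_mono) (use False in auto)
      finally have "card (g ` (I \<union> J)) < dim V" using d by simp
      then obtain x where x: "x \<in> V" "norm x = 1" "\<And>s. s \<in> g ` (I \<union> J) \<Longrightarrow> s \<bullet> x = 0"
        using unit_vector_orthogonal[OF V, of "g ` (I \<union> J)"] g(2) by auto
      have "orthonormal_on (insert j (I \<union> J)) (g(j := x))"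
        by (rule orthonormal_on_insert[OF g(1) x(2)]) (use x False in auto)
      then have "orthonormal_on (I \<union> insert j J) (g(j := x))" by simp
      then show ?thesis
        by (rule exI[of _ "g(j := x)", OF conjI]) (use g x False in auto)
    qed
  qed
  from this[of UNIV] show ?thesis using that by auto
qed

text \<open>\<open>x\<close> maximizes the quadratic form on the unit sphere of \<open>V\<close>.
  The residue \<open>z = A *v x - m x\<close> lies in \<open>V\<close> by invariance, and maximality
  along \<open>x + t z\<close> bounds a first-order term with coefficient
  \<open>2 (z \<bullet> z)\<close> by a second-order one, so \<open>z = 0\<close>.\<close>

lemma symmetric_matrix_eigenvector:
  fixes A :: "real^'n^'n"
  assumes A: "transpose A = A" and V: "subspace V" "\<And>x. x \<in> V \<Longrightarrow> A *v x \<in> V" and x0: "x0 \<in> V" "norm x0 = 1"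
  obtains x l where "x \<in> V" "norm x = 1" "A *v x = l *\<^sub>R x"
proof -
  have sym: "x \<bullet> (A *v y) = (A *v x) \<bullet> y" for x y
    using inner_matrix_vector[of x A y] by (simp add: A del: transpose_matrix_vector)
  have "compact (sphere 0 1 \<inter> V)" by (rule compact_Int_closed) (simp_all add: closed_subspace V)
  moreover have "sphere 0 1 \<inter> V \<noteq> {}" using x0 by auto
  moreover have "continuous_on (sphere 0 1 \<inter> V) (\<lambda>x. x \<bullet> (A *v x))"
    by (intro continuous_intros linear_continuous_on matrix_vector_mul_bounded_linear)
  ultimately obtain x where x': "x \<in> sphere 0 1 \<inter> V"
    and max': "\<forall>y\<in>sphere 0 1 \<inter> V. y \<bullet> (A *v y) \<le> x \<bullet> (A *v x)"
    using continuous_attains_sup[of "sphere 0 1 \<inter> V" "\<lambda>x. x \<bullet> (A *v x)"] by blast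
  then have x: "x \<in> V" "norm x = 1"
    and max: "\<And>y. y \<in> V \<Longrightarrow> norm y = 1 \<Longrightarrow> y \<bullet> (A *v y) \<le> x \<bullet> (A *v x)"
    by auto
  define m where "m = x \<bullet> (A *v x)"
  have xx: "x \<bullet> x = 1" using x by (simp add: dot_square_norm)
  have le: "y \<bullet> (A *v y) \<le> m * (y \<bullet> y)" if "y \<in> V" for y
  proof (cases "y = 0")
    case False
    have "((1 / norm y) *\<^sub>R y) \<bullet> (A *v ((1 / norm y) *\<^sub>R y)) \<le> m"
      unfolding m_def by (rule max) (use that V False in \<open>auto simp: subspace_scale\<close>)
    then have "(y \<bullet> (A *v y)) / (norm y * norm y) \<le> m"
      by (simp add: matrix_vector.scaleR_right)
    then show ?thesis using False by (simp add: divide_le_eq dot_square_norm power2_eq_square)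
  qed simp
  define z where "z = A *v x - m *\<^sub>R x"
  have zV: "z \<in> V" unfolding z_def using x V by (intro subspace_diff subspace_scale) auto
  have xz: "z \<bullet> (A *v x) - m * (x \<bullet> z) = z \<bullet> z"
    unfolding z_def by (simp add: inner_diff_left inner_diff_right inner_commute algebra_simps)
  define c where "c = m * (z \<bullet> z) - z \<bullet> (A *v z)"
  have c0: "0 \<le> c" using le[OF zV] by (simp add: c_def)
  have t: "2 * t * (z \<bullet> z) \<le> t * t * c" for t
  proof -
    have a: "(x + t *\<^sub>R z) \<bullet> (A *v (x + t *\<^sub>R z)) \<le> m * ((x + t *\<^sub>R z) \<bullet> (x + t *\<^sub>R z))"
      by (rule le) (use x zV V in \<open>auto intro: subspace_add subspace_scale\<close>)
    have b: "(x + t *\<^sub>R z) \<bullet> (A *v (x + t *\<^sub>R z)) = m + 2 * t * (z \<bullet> (A *v x)) + t * t * (z \<bullet> (A *v z))"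
      by (simp add: matrix_vector.add_right matrix_vector.scaleR_right inner_add_left inner_add_right
          m_def sym[of x z] inner_commute[of "A *v x" z] algebra_simps)
    have d: "(x + t *\<^sub>R z) \<bullet> (x + t *\<^sub>R z) = 1 + 2 * t * (x \<bullet> z) + t * t * (z \<bullet> z)"
      by (simp add: inner_add_left inner_add_right xx inner_commute[of z x] algebra_simps)
    have "2 * t * (z \<bullet> (A *v x) - m * (x \<bullet> z)) \<le> t * t * c"
      using a unfolding b d by (simp add: c_def algebra_simps)
    then show ?thesis unfolding xz .
  qed
  have "z \<bullet> z = 0"
  proof (rule ccontr)
    assume "z \<bullet> z \<noteq> 0"
    then have z: "0 < z \<bullet> z" by simp
    \<comment> \<open>The summand 1 keeps the denominator positive for \<open>c = 0\<close>, and
      \<open>t * c\<close> is still at most \<open>z \<bullet> z\<close>.\<close>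
    define t where "t = (z \<bullet> z) / (c + 1)"
    have t0: "0 < t" using z c0 by (simp add: t_def)
    have "t * (2 * (z \<bullet> z)) \<le> t * (t * c)" using t[of t] by (simp add: mult_ac)
    then have "2 * (z \<bullet> z) \<le> t * c" using t0 by simp
    also have "\<dots> \<le> z \<bullet> z" using c0 z by (simp add: t_def field_simps)
    finally show False using z by simp
  qed
  then have "A *v x = m *\<^sub>R x" by (simp add: z_def)
  then show ?thesis using that x by blast
qed

theorem symmetric_matrix_eigenbasis:
  fixes A :: "real^'n^'n"
  assumes A: "transpose A = A"
  obtains u :: "'n \<Rightarrow> real^'n" and l where "orthonormal_on UNIV u" "\<And>i. A *v u i = l i *\<^sub>R u i"
proof -
  have sym: "x \<bullet> (A *v y) = (A *v x) \<bullet> y" for x y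
    using inner_matrix_vector[of x A y] by (simp add: A del: transpose_matrix_vector)
  have "\<exists>u l. orthonormal_on I u \<and> (\<forall>i\<in>I. A *v u i = l i *\<^sub>R u i)" if "finite I" for I :: "'n set"
    using that
  proof (induction I rule: finite_induct)
    case empty
    then show ?case by (simp add: orthonormal_on_def)
  next
    case (insert j I)
    then obtain u :: "'n \<Rightarrow> real^'n" and l where u: "orthonormal_on I u" "\<forall>i\<in>I. A *v u i = l i *\<^sub>R u i" by blast
    have "card (u ` I) \<le> card I" by (rule card_image_le) simp
    also have "\<dots> < CARD('n)" by (rule psubset_card_mono) (use insert in auto)
    finally have "card (u ` I) < dim (UNIV :: (real^'n) set)" by simp
    then obtain x0 where x0: "norm x0 = 1" "\<And>s. s \<in> u ` I \<Longrightarrow> s \<bullet> x0 = 0"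
      using unit_vector_orthogonal[OF subspace_UNIV, of "u ` I"] by auto
    define V where "V = {x. \<forall>i\<in>I. u i \<bullet> x = 0}"
    have V: "subspace V" unfolding V_def by (auto simp: subspace_def inner_add_right)
    have inv: "A *v x \<in> V" if "x \<in> V" for x
      using that u(2) by (auto simp: V_def sym)
    have "x0 \<in> V" using x0 by (auto simp: V_def)
    then obtain x l' where x: "x \<in> V" "norm x = 1" "A *v x = l' *\<^sub>R x"
      using symmetric_matrix_eigenvector[OF A V inv _ x0(1)] by blast
    have "orthonormal_on (insert j I) (u(j := x))"
      by (rule orthonormal_on_insert[OF u(1) x(2)]) (use x insert in \<open>auto simp: V_def\<close>)
    then have "orthonormal_on (insert j I) (u(j := x)) \<and>
        (\<forall>i\<in>insert j I. A *v (u(j := x)) i = (l(j := l')) i *\<^sub>R (u(j := x)) i)"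
      using u x insert by auto
    then show ?case by blast
  qed
  from this[of UNIV] that show ?thesis by auto
qed

section \<open>Singular values and principal angles\<close>

definition column_matrix :: "('k::finite \<Rightarrow> real^'n) \<Rightarrow> real^'k^'n" where
  "column_matrix v = (\<chi> i k. v k $ i)"

definition outer :: "real^'n \<Rightarrow> real^'m \<Rightarrow> real^'m^'n" where
  "outer v w = (\<chi> i j. v $ i * w $ j)"

lemma outer_vector: "outer v w *v x = (w \<bullet> x) *\<^sub>R v"
  by (simp add: outer_def vec_eq_iff matrix_vector_mult_def inner_vec_def sum_distrib_left mult_ac)

lemma outer_zero [simp]: "outer 0 w = 0" "outer v 0 = 0"
  by (simp_all add: outer_def vec_eq_iff)

lemma outer_scaleR: "outer (r *\<^sub>R v) w = r *\<^sub>R outer v w" "outer v (r *\<^sub>R w) = r *\<^sub>R outer v w"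
  by (simp_all add: outer_def vec_eq_iff)

lemma transpose_outer: "transpose (outer v w) = outer w v"
  by (simp add: outer_def transpose_def vec_eq_iff)

lemma matrix_mult_outer: "A ** outer v w = outer (A *v v) w"
  by (simp add: outer_def vec_eq_iff matrix_matrix_mult_def matrix_vector_mult_def sum_distrib_right
      sum_distrib_left mult_ac)

lemma outer_matrix_mult: "outer v w ** A = outer v (transpose A *v w)"
  by (simp add: outer_def vec_eq_iff matrix_matrix_mult_def matrix_vector_mult_def transpose_def
      sum_distrib_left mult_ac del: transpose_matrix_vector)

lemma column_matrix_inner: "transpose (column_matrix v) ** column_matrix w = (\<chi> k l. v k \<bullet> w l)"
  by (simp add: column_matrix_def vec_eq_iff matrix_matrix_mult_def transpose_def inner_vec_def)

lemma column_matrix_outer: "column_matrix v ** transpose (column_matrix w) = (\<Sum>k\<in>UNIV. outer (v k) (w k))"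
  by (simp add: column_matrix_def outer_def vec_eq_iff matrix_matrix_mult_def transpose_def)

lemma matrix_mult_column_matrix: "A ** column_matrix v = column_matrix (\<lambda>k. A *v v k)"
  by (simp add: column_matrix_def vec_eq_iff matrix_matrix_mult_def matrix_vector_mult_def)

lemma orthonormal_column_matrix:
  "orthonormal_on UNIV v \<longleftrightarrow> transpose (column_matrix v) ** column_matrix v = mat 1"
  by (simp add: column_matrix_inner orthonormal_on_def vec_eq_iff mat_def)

lemma Gr_subspace: "subspace (range (\<lambda>x. (P::real^'n^'m) *v x))"
  by (rule linear_subspace_image) auto

lemma orthonormal_expand:
  fixes v :: "'k::finite \<Rightarrow> 'a::euclidean_space"
  assumes v: "orthonormal_on UNIV v" "\<And>k. v k \<in> V" and d: "dim V \<le> CARD('k)" and x: "x \<in> V"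
  shows "x = (\<Sum>k\<in>UNIV. (v k \<bullet> x) *\<^sub>R v k)"
proof -
  have inj: "inj v"
    by (rule injI) (metis UNIV_I orthonormal_onD[OF v(1)] zero_neq_one)
  have nz: "0 \<notin> range v" using orthonormal_onD[OF v(1)] by (metis UNIV_I inner_zero_left rangeE zero_neq_one)
  have "pairwise orthogonal (range v)"
    using orthonormal_onD[OF v(1)] by (auto simp: pairwise_def orthogonal_def)
  then have ind: "independent (range v)" using nz by (rule pairwise_orthogonal_independent)
  have "V \<subseteq> span (range v)"
    by (rule card_ge_dim_independent[OF _ ind]) (use v d inj in \<open>auto simp: card_image\<close>)
  define z where "z = x - (\<Sum>k\<in>UNIV. (v k \<bullet> x) *\<^sub>R v k)"
  have zs: "z \<in> span (range v)"
    unfolding z_def using x \<open>V \<subseteq> span (range v)\<close>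
    by (intro span_diff span_sum span_scale) (auto intro: span_base)
  have "v k \<bullet> z = 0" for k
  proof -
    have "v k \<bullet> z = v k \<bullet> x - (\<Sum>j\<in>UNIV. (v j \<bullet> x) * (if k = j then 1 else 0))"
      by (simp add: z_def inner_diff_right inner_sum_right orthonormal_onD[OF v(1)])
    also have "\<dots> = v k \<bullet> x - v k \<bullet> x" by (simp add: if_distrib cong: if_cong)
    finally show ?thesis by simp
  qed
  then have "orthogonal z y" if "y \<in> range v" for y
    using that by (auto simp: orthogonal_def inner_commute)
  from orthogonal_to_span[OF zs this] have "z = 0" by (simp add: orthogonal_self)
  then show ?thesis by (simp add: z_def)
qed

lemma Gr_frame:
  fixes P :: "real^'n^'n"
  assumes P: "P \<in> Gr CARD('p::finite)"
  obtains v :: "'p::finite \<Rightarrow> real^'n" where "orthonormal_on UNIV v" "P = (\<Sum>k\<in>UNIV. outer (v k) (v k))"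
proof -
  let ?V = "range (\<lambda>x. P *v x)"
  have d: "dim ?V = CARD('p)" using P by (simp add: Gr_def rank_dim_range)
  obtain v :: "'p \<Rightarrow> real^'n" where v: "orthonormal_on UNIV v" "\<And>k. v k \<in> ?V"
    using orthonormal_extend[OF Gr_subspace, of "{}" "\<lambda>_. 0" P] d by (auto simp: orthonormal_on_def)
  have Pv: "P *v v k = v k" for k
    using v(2)[of k] GrD(2)[OF P] by (auto simp: matrix_vector_mul_assoc)
  have "P *v x = (\<Sum>k\<in>UNIV. outer (v k) (v k)) *v x" for x
  proof -
    have "P *v x = (\<Sum>k\<in>UNIV. (v k \<bullet> (P *v x)) *\<^sub>R v k)"
      by (rule orthonormal_expand[OF v]) (use d in auto)
    also have "\<dots> = (\<Sum>k\<in>UNIV. (v k \<bullet> x) *\<^sub>R v k)"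
      by (simp add: inner_matrix_vector GrD(1)[OF P] Pv del: transpose_matrix_vector)
    finally show ?thesis by (simp add: matrix_vector.sum_left outer_vector)
  qed
  then have "P = (\<Sum>k\<in>UNIV. outer (v k) (v k))" by (simp add: matrix_eq)
  then show ?thesis using that v by blast
qed

text \<open>The right singular vectors \<open>b k\<close> are eigenvectors of the Gram matrix of
  \<open>M\<close>. Their images under \<open>M\<close> are orthogonal of length \<open>c k\<close>;
  where \<open>c k\<close> is nonzero they are normalized to \<open>a k\<close>, and the remaining
  \<open>a k\<close> are completed freely.\<close>

lemma square_matrix_svd:
  fixes M :: "real^'p^'p"
  obtains a b :: "'p \<Rightarrow> real^'p" and c :: "'p \<Rightarrow> real" where
    "orthonormal_on UNIV a" "orthonormal_on UNIV b" "\<And>k. 0 \<le> c k"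
    "\<And>k l. a k \<bullet> (M *v b l) = (if k = l then c k else 0)"
    "\<And>k l. b k \<bullet> ((transpose M ** M) *v b l) = (if k = l then (c k)\<^sup>2 else 0)"
proof -
  have "transpose (transpose M ** M) = transpose M ** M" by (simp add: matrix_transpose_mul)
  then obtain b :: "'p \<Rightarrow> real^'p" and d where b: "orthonormal_on UNIV b"
    and d: "\<And>i. (transpose M ** M) *v b i = d i *\<^sub>R b i"
    using symmetric_matrix_eigenbasis by metis
  have Mb: "(M *v b k) \<bullet> (M *v b l) = (if k = l then d k else 0)" for k l
  proof -
    have "(M *v b k) \<bullet> (M *v b l) = b k \<bullet> ((transpose M ** M) *v b l)"
      using inner_matrix_vector[of "b k" "transpose M" "M *v b l"]
      by (simp add: matrix_vector_mul_assoc[symmetric] del: transpose_matrix_vector)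
    then show ?thesis by (simp add: d orthonormal_onD[OF b])
  qed
  have d0: "0 \<le> d k" for k using Mb[of k k] by (metis inner_ge_zero)
  define c where "c k = sqrt (d k)" for k
  have cc: "c k * c k = d k" "0 \<le> c k" for k using d0 by (simp_all add: c_def)
  define I where "I = {k. c k \<noteq> 0}"
  have "orthonormal_on I (\<lambda>k. (1 / c k) *\<^sub>R (M *v b k))"
    unfolding orthonormal_on_def using cc by (auto simp: I_def Mb divide_simps)
  then obtain a where a: "orthonormal_on UNIV a" "\<And>k. k \<in> I \<Longrightarrow> a k = (1 / c k) *\<^sub>R (M *v b k)"
    using orthonormal_extend[OF subspace_UNIV, of I "\<lambda>k. (1 / c k) *\<^sub>R (M *v b k)"] by auto
  have Mba: "M *v b l = c l *\<^sub>R a l" for l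
  proof (cases "l \<in> I")
    case False
    then have "M *v b l = 0" using Mb[of l l] cc(1)[of l] by (simp add: I_def)
    then show ?thesis using False by (simp add: I_def)
  qed (simp add: a I_def)
  show ?thesis
    by (rule that[of a b c]) (use a b in \<open>auto simp: Mba cc d orthonormal_onD power2_eq_square\<close>)
qed

text \<open>The values determine the polynomial. A root of one product is a root of the other, and
  cancelling its linear factor from both is the induction step.\<close>

lemma prod_mset_linear_eq:
  fixes A B :: "real multiset"
  assumes "\<And>x. (\<Prod>a\<in>#A. x - a) = (\<Prod>b\<in>#B. x - b)"
  shows "A = B"
proof -
  define q where "q A = (\<Prod>a\<in>#A. [:- a, 1:])" for A :: "real multiset"
  have pq: "poly (q A) x = (\<Prod>a\<in>#A. x - a)" for A x
    by (induction A) (simp_all add: q_def algebra_simps)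
  have "q A = q B" using assms by (subst poly_eq_poly_eq_iff[symmetric]) (simp add: pq fun_eq_iff)
  then show ?thesis
  proof (induction A arbitrary: B)
    case empty
    show ?case
    proof (rule ccontr)
      assume "{#} \<noteq> B"
      then obtain b where b: "b \<in># B" by auto
      have "poly (q B) b = 0" using b by (auto simp: pq prod_mset_zero_iff)
      then show False using empty by (simp add: q_def)
    qed
  next
    case (add a A)
    have "poly (q B) a = 0" unfolding add.prems[symmetric] by (simp add: pq)
    then have "a \<in># B" by (auto simp: pq prod_mset_zero_iff)
    then obtain B' where B: "B = add_mset a B'" by (metis insert_DiffM)
    have "[:- a, 1:] * q A = [:- a, 1:] * q B'" using add.prems by (simp add: q_def B)
    then have "q A = q B'" by (metis mult_cancel_left pCons_eq_0_iff zero_neq_one)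
    then show ?case using add.IH B by simp
  qed
qed

text \<open>The characteristic polynomial determines the multiset of squares, nonnegativity then the
  values, and sorting the list. The multiset is all that is recorded, as a repeated or a zero angle
  does not depend on the order.\<close>

lemma singular_values_eq:
  fixes M :: "real^'p^'p"
  assumes c0: "\<And>k. 0 \<le> c k"
    and det: "\<And>x. det (mat x - transpose M ** M) = (\<Prod>k\<in>UNIV. x - (c k)\<^sup>2)"
  shows "mset (singular_values M) = image_mset c (mset_set (UNIV :: 'p set))"
proof -
  obtain ks :: "'p list" where ks: "set ks = UNIV" "distinct ks"
    using finite_distinct_list[of "UNIV :: 'p set"] by auto
  have mks: "mset ks = mset_set UNIV" using ks mset_set_set by metis
  define s where "s = rev (sort (map c ks))"
  have ms: "mset s = image_mset c (mset_set UNIV)" by (simp add: s_def mks)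
  have prod: "(\<Prod>y\<leftarrow>t. x - y\<^sup>2) = (\<Prod>a\<in>#image_mset (\<lambda>y. y\<^sup>2) (mset t). x - a)" for x :: real and t
    by (induction t) simp_all
  have "singular_values M = s"
    unfolding singular_values_def
  proof (rule the_equality, intro conjI)
    show "length s = CARD('p)"
      using arg_cong[OF ms, of size] by simp
    show "sorted_wrt (\<ge>) s" unfolding s_def sorted_wrt_rev using sorted_sort[of "map c ks"] by simp
    show "\<forall>x\<in>set s. 0 \<le> x" unfolding s_def using c0 by auto
    show "\<forall>x. det (mat x - transpose M ** M) = (\<Prod>y\<leftarrow>s. x - y\<^sup>2)"
    proof
      fix x
      have "(\<Prod>y\<leftarrow>s. x - y\<^sup>2) = (\<Prod>k\<in>UNIV. x - (c k)\<^sup>2)"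
        unfolding prod ms by (simp add: prod_unfold_prod_mset image_mset.compositionality comp_def)
      then show "det (mat x - transpose M ** M) = (\<Prod>y\<leftarrow>s. x - y\<^sup>2)" using det by simp
    qed
  next
    fix t assume t: "length t = CARD('p) \<and> sorted_wrt (\<ge>) t \<and> (\<forall>x\<in>set t. 0 \<le> x) \<and>
     (\<forall>x. det (mat x - transpose M ** M) = (\<Prod>y\<leftarrow>t. x - y\<^sup>2))"
    have "image_mset (\<lambda>y. y\<^sup>2) (mset t) = image_mset (\<lambda>y. y\<^sup>2) (mset s)"
    proof (rule prod_mset_linear_eq)
      fix x
      have "(\<Prod>y\<leftarrow>s. x - y\<^sup>2) = (\<Prod>k\<in>UNIV. x - (c k)\<^sup>2)"
        unfolding prod ms by (simp add: prod_unfold_prod_mset image_mset.compositionality comp_def)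
      then show "(\<Prod>a\<in>#image_mset (\<lambda>y. y\<^sup>2) (mset t). x - a) = (\<Prod>b\<in>#image_mset (\<lambda>y. y\<^sup>2) (mset s). x - b)"
        using t det by (simp add: prod[symmetric])
    qed
    then have "image_mset sqrt (image_mset (\<lambda>y. y\<^sup>2) (mset t)) = image_mset sqrt (image_mset (\<lambda>y. y\<^sup>2) (mset s))"
      by simp
    moreover have "image_mset sqrt (image_mset (\<lambda>y. y\<^sup>2) (mset r)) = mset r" if "\<forall>x\<in>set r. 0 \<le> x" for r
      using that by (induction r) simp_all
    moreover have "\<forall>x\<in>set s. 0 \<le> x" unfolding s_def using c0 by auto
    ultimately have m: "mset t = mset s" using t by simp
    have "sorted (rev t)" using t by (simp add: sorted_wrt_rev)
    then have "sort (rev s) = rev t" by (intro properties_for_sort) (simp_all add: m)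
    moreover have "sort (rev s) = rev s" by (simp add: s_def sorted_sort_id)
    ultimately show "t = s" by simp
  qed
  then show ?thesis using ms by simp
qed

lemma singular_values_cong:
  fixes M N :: "real^'p^'p"
  assumes "\<And>x. det (mat x - transpose M ** M) = det (mat x - transpose N ** N)"
  shows "singular_values M = singular_values N"
  unfolding singular_values_def using assms by simp

lemma det_conjugate:
  fixes R :: "real^'p^'p"
  assumes "transpose R ** R = mat 1"
  shows "det (mat x - transpose R ** A ** R) = det (mat x - A)"
proof -
  have mx: "mat x = x *\<^sub>R (mat 1 :: real^'p^'p)" by (simp add: mat_def vec_eq_iff)
  have "mat x - transpose R ** A ** R = transpose R ** (mat x - A) ** R"
    unfolding mx by (simp add: matrix_algebra assms)
  moreover have "det (transpose R) * det R = 1" using arg_cong[OF assms, of det] by (simp add: det_mul)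
  ultimately show ?thesis by (simp add: det_mul)
qed

text \<open>The frame of \<open>P\<close> enters the Gram matrix of \<open>transpose U ** Y\<close>
  only through \<open>P\<close> itself. Two frames of \<open>F\<close> differ by an orthogonal
  matrix \<open>R\<close>, which merely conjugates that Gram matrix.\<close>

lemma principal_angles_eq:
  fixes U Y :: "real^'p^'n"
  assumes U: "transpose U ** U = mat 1" "P = U ** transpose U"
    and Y: "transpose Y ** Y = mat 1" "F = Y ** transpose Y"
  shows "principal_angles TYPE('p) P F = map arccos (singular_values (transpose U ** Y))"
  unfolding principal_angles_def
proof (rule the_equality)
  show "\<exists>U' Y' :: real^'p^'n. transpose U' ** U' = mat 1 \<and> transpose Y' ** Y' = mat 1 \<and>
     P = U' ** transpose U' \<and> F = Y' ** transpose Y' \<and>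
     map arccos (singular_values (transpose U ** Y)) = map arccos (singular_values (transpose U' ** Y'))"
    using U Y by blast
next
  fix \<theta>
  assume "\<exists>U' Y' :: real^'p^'n. transpose U' ** U' = mat 1 \<and> transpose Y' ** Y' = mat 1 \<and>
     P = U' ** transpose U' \<and> F = Y' ** transpose Y' \<and>
     \<theta> = map arccos (singular_values (transpose U' ** Y'))"
  then obtain U' Y' :: "real^'p^'n" where
    U': "P = U' ** transpose U'" and
    Y': "transpose Y' ** Y' = mat 1" "F = Y' ** transpose Y'" and
    \<theta>: "\<theta> = map arccos (singular_values (transpose U' ** Y'))" by blast
  define R where "R = transpose Y ** Y'"
  have FY': "Y ** (transpose Y ** Y') = Y'"
    using Y(2) Y' by (metis matrix_mul_assoc matrix_mul_rid)
  have R: "transpose R ** R = mat 1"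
    unfolding R_def using FY' Y'(1)
    by (simp add: matrix_transpose_mul) (metis FY' matrix_mul_assoc)
  have PU: "U' ** transpose U' = U ** transpose U" using U U' by simp
  have "transpose (transpose U' ** Y') ** (transpose U' ** Y') = transpose Y' ** (U' ** transpose U') ** Y'"
    by (simp add: matrix_transpose_mul matrix_mul_assoc)
  also have "\<dots> = transpose R ** (transpose (transpose U ** Y) ** (transpose U ** Y)) ** R"
    unfolding PU R_def using arg_cong[OF FY', of transpose]
    by (subst FY'[symmetric], subst (2) FY'[symmetric]) (simp add: matrix_transpose_mul matrix_mul_assoc)
  finally have "singular_values (transpose U' ** Y') = singular_values (transpose U ** Y)"
    by (intro singular_values_cong) (simp add: det_conjugate[OF R])
  then show "\<theta> = map arccos (singular_values (transpose U ** Y))" using \<theta> by simp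
qed

text \<open>Principal vectors: orthonormal bases of the two ranges whose mutual inner products are
  diagonal, with the cosines \<open>c k\<close> of the principal angles on the diagonal. Indexing by
  the type \<open>'p\<close> leaves these cosines unsorted.\<close>

locale principal_frames =
  fixes P F :: "real^'n^'n" and v y :: "'p::finite \<Rightarrow> real^'n" and c :: "'p \<Rightarrow> real"
  assumes v: "orthonormal_on UNIV v" and y: "orthonormal_on UNIV y"
    and P_eq: "P = (\<Sum>k\<in>UNIV. outer (v k) (v k))" and F_eq: "F = (\<Sum>k\<in>UNIV. outer (y k) (y k))"
    and vy: "\<And>k l. v k \<bullet> y l = (if k = l then c k else 0)"
    and c0: "\<And>k. 0 \<le> c k" and c1: "\<And>k. c k \<le> 1"

text \<open>The frames come from a singular value decomposition of \<open>transpose U ** Y\<close>,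
  mapped forward by \<open>U\<close> and \<open>Y\<close>. Both equivalences concern the multiset of
  angles only, and \<open>arccos\<close> is injective on the interval from 0 to 1, so they pass to
  the family \<open>c\<close>.\<close>

theorem principal_vectors:
  fixes P F :: "real^'n^'n"
  assumes P: "P \<in> Gr CARD('p::finite)" and F: "F \<in> Gr CARD('p::finite)"
  obtains v y :: "'p::finite \<Rightarrow> real^'n" and c :: "'p \<Rightarrow> real" where
    "principal_frames P F v y c"
    "(\<exists>i<CARD('p). \<exists>j<CARD('p). i \<noteq> j \<and>
         principal_angles TYPE('p) P F ! i = principal_angles TYPE('p) P F ! j) \<longleftrightarrow> (\<exists>k l. k \<noteq> l \<and> c k = c l)"
    "(\<exists>k<CARD('p). principal_angles TYPE('p) P F ! k = 0) \<longleftrightarrow> (\<exists>k. c k = 1)"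
proof -
  obtain u :: "'p \<Rightarrow> real^'n" where u: "orthonormal_on UNIV u" "P = (\<Sum>k\<in>UNIV. outer (u k) (u k))"
    using Gr_frame[OF P] .
  obtain w :: "'p \<Rightarrow> real^'n" where w: "orthonormal_on UNIV w" "F = (\<Sum>k\<in>UNIV. outer (w k) (w k))"
    using Gr_frame[OF F] .
  define U where "U = column_matrix u"
  define Y where "Y = column_matrix w"
  have U: "transpose U ** U = mat 1" "P = U ** transpose U"
    using u by (simp_all add: U_def orthonormal_column_matrix column_matrix_outer)
  have Y: "transpose Y ** Y = mat 1" "F = Y ** transpose Y"
    using w by (simp_all add: Y_def orthonormal_column_matrix column_matrix_outer)
  define M where "M = transpose U ** Y"
  obtain a b :: "'p \<Rightarrow> real^'p" and c where ab: "orthonormal_on UNIV a" "orthonormal_on UNIV b"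
    and c0: "\<And>k. 0 \<le> c k" and svd: "\<And>k l. a k \<bullet> (M *v b l) = (if k = l then c k else 0)"
      "\<And>k l. b k \<bullet> ((transpose M ** M) *v b l) = (if k = l then (c k)\<^sup>2 else 0)"
    using square_matrix_svd[of M] by blast
  have frame: "orthonormal_on UNIV (\<lambda>k. W *v e k) \<and>
      W ** transpose W = (\<Sum>k\<in>UNIV. outer (W *v e k) (W *v e k))"
    if W: "transpose W ** W = mat 1" and e: "orthonormal_on UNIV e" for W :: "real^'p^'n" and e :: "'p \<Rightarrow> real^'p"
  proof -
    have E: "transpose (column_matrix e) ** column_matrix e = mat 1" using e by (simp add: orthonormal_column_matrix)
    then have E': "column_matrix e ** transpose (column_matrix e) = mat 1"
      by (simp add: matrix_left_right_inverse)
    have "transpose (W ** column_matrix e) ** (W ** column_matrix e)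
        = transpose (column_matrix e) ** (transpose W ** W) ** column_matrix e"
      by (simp add: matrix_transpose_mul matrix_mul_assoc)
    then have "orthonormal_on UNIV (\<lambda>k. W *v e k)"
      by (simp add: orthonormal_column_matrix matrix_mult_column_matrix[symmetric] W E)
    moreover have "(\<Sum>k\<in>UNIV. outer (W *v e k) (W *v e k))
        = W ** (column_matrix e ** transpose (column_matrix e)) ** transpose W"
      by (simp add: column_matrix_outer[symmetric] matrix_mult_column_matrix[symmetric]
          matrix_transpose_mul matrix_mul_assoc)
    ultimately show ?thesis by (simp add: E')
  qed
  define v where "v k = U *v a k" for k
  define y where "y k = Y *v b k" for k
  have v: "orthonormal_on UNIV v" "P = (\<Sum>k\<in>UNIV. outer (v k) (v k))"
    using frame[OF U(1) ab(1)] U(2) by (simp_all add: v_def[abs_def])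
  have y: "orthonormal_on UNIV y" "F = (\<Sum>k\<in>UNIV. outer (y k) (y k))"
    using frame[OF Y(1) ab(2)] Y(2) by (simp_all add: y_def[abs_def])
  have vy: "v k \<bullet> y l = (if k = l then c k else 0)" for k l
  proof -
    have "v k \<bullet> y l = a k \<bullet> (M *v b l)"
      using inner_matrix_vector[of "a k" "transpose U" "Y *v b l"]
      by (simp add: v_def y_def M_def matrix_vector_mul_assoc[symmetric] del: transpose_matrix_vector)
    then show ?thesis by (simp add: svd)
  qed
  have c1: "c k \<le> 1" for k
  proof -
    have "norm (v k) = 1" "norm (y k) = 1"
      using orthonormal_onD[OF v(1), of k k] orthonormal_onD[OF y(1), of k k] by (simp_all add: norm_eq_sqrt_inner)
    then show ?thesis using norm_cauchy_schwarz[of "v k" "y k"] vy[of k k] by simp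
  qed
  have det: "det (mat x - transpose M ** M) = (\<Prod>k\<in>UNIV. x - (c k)\<^sup>2)" for x
  proof -
    let ?B = "column_matrix b"
    have B: "transpose ?B ** ?B = mat 1" using ab(2) by (simp add: orthonormal_column_matrix)
    have "transpose ?B ** S ** ?B = transpose ?B ** column_matrix (\<lambda>k. S *v b k)" for S
      by (simp only: matrix_mult_column_matrix matrix_vector_mul_assoc)
    then have "transpose ?B ** (transpose M ** M) ** ?B = (\<chi> k l. if k = l then (c k)\<^sup>2 else 0)"
      by (simp only: column_matrix_inner svd(2))
    then have "mat x - transpose ?B ** (transpose M ** M) ** ?B = (\<chi> k l. if k = l then x - (c k)\<^sup>2 else 0)"
      by (simp add: mat_def vec_eq_iff)
    then have "det (mat x - transpose M ** M) = det (\<chi> k l. if k = l then x - (c k)\<^sup>2 else 0 :: real^'p^'p)"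
      using det_conjugate[OF B, of x "transpose M ** M"] by simp
    also have "\<dots> = (\<Prod>k\<in>UNIV. x - (c k)\<^sup>2)" by (subst det_diagonal) simp_all
    finally show ?thesis .
  qed
  let ?\<theta> = "principal_angles TYPE('p) P F"
  obtain ks :: "'p list" where ks: "set ks = UNIV" "distinct ks"
    using finite_distinct_list[of "UNIV :: 'p set"] by auto
  have mks: "mset ks = mset_set UNIV" using ks mset_set_set by metis
  have "mset ?\<theta> = image_mset arccos (mset (singular_values M))"
    unfolding principal_angles_eq[OF U Y] M_def by simp
  also have "\<dots> = mset (map (\<lambda>k. arccos (c k)) ks)"
    unfolding singular_values_eq[OF c0 det] by (simp add: mks image_mset.compositionality comp_def)
  finally have m\<theta>: "mset ?\<theta> = mset (map (\<lambda>k. arccos (c k)) ks)" .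
  have len: "length ?\<theta> = CARD('p)"
    using mset_eq_length[OF m\<theta>] distinct_card[OF ks(2)] ks(1) by simp
  have cosarc: "cos (arccos (c k)) = c k" for k using c0[of k] c1[of k] by (simp add: cos_arccos)
  have "(\<exists>i<CARD('p). \<exists>j<CARD('p). i \<noteq> j \<and> ?\<theta> ! i = ?\<theta> ! j) \<longleftrightarrow> \<not> distinct ?\<theta>"
    by (auto simp: distinct_conv_nth len)
  also have "\<dots> \<longleftrightarrow> \<not> inj (\<lambda>k. arccos (c k))"
    unfolding mset_eq_imp_distinct_iff[OF m\<theta>] using ks by (simp add: distinct_map)
  also have "\<dots> \<longleftrightarrow> (\<exists>k l. k \<noteq> l \<and> c k = c l)"
    unfolding inj_def using cosarc by metis
  finally have r1: "(\<exists>i<CARD('p). \<exists>j<CARD('p). i \<noteq> j \<and> ?\<theta> ! i = ?\<theta> ! j) \<longleftrightarrow> (\<exists>k l. k \<noteq> l \<and> c k = c l)" .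
  have "(\<exists>k<CARD('p). ?\<theta> ! k = 0) \<longleftrightarrow> 0 \<in> set ?\<theta>"
    by (auto simp: in_set_conv_nth len)
  also have "\<dots> \<longleftrightarrow> (\<exists>k. arccos (c k) = 0)"
    unfolding mset_eq_setD[OF m\<theta>] using ks by (auto simp: image_iff)
  also have "\<dots> \<longleftrightarrow> (\<exists>k. c k = 1)"
    using cosarc by (metis arccos_1 cos_zero)
  finally have r2: "(\<exists>k<CARD('p). ?\<theta> ! k = 0) \<longleftrightarrow> (\<exists>k. c k = 1)" .
  have "principal_frames P F v y c"
    by unfold_locales (fact v(1) y(1) v(2) y(2) vy c0 c1)+
  then show ?thesis by (rule that[OF _ r1 r2])
qed

section \<open>The conjugate locus\<close>

context principal_frames
begin

lemma v_inner: "v k \<bullet> v l = (if k = l then 1 else 0)"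
  using orthonormal_onD[OF v] by simp

lemma y_inner: "y k \<bullet> y l = (if k = l then 1 else 0)"
  using orthonormal_onD[OF y] by simp

lemma P_apply: "P *v x = (\<Sum>k\<in>UNIV. (v k \<bullet> x) *\<^sub>R v k)"
  by (simp add: P_eq matrix_vector.sum_left outer_vector)

lemma F_apply: "F *v x = (\<Sum>k\<in>UNIV. (y k \<bullet> x) *\<^sub>R y k)"
  by (simp add: F_eq matrix_vector.sum_left outer_vector)

lemma P_v: "P *v v k = v k"
  by (simp add: P_apply v_inner if_distrib if_distribR cong: if_cong)

lemma v_inner_P: "v k \<bullet> (P *v x) = v k \<bullet> x"
  by (simp add: P_apply inner_sum_right v_inner if_distrib if_distribR cong: if_cong)

lemma P_y: "P *v y k = c k *\<^sub>R v k"
  by (simp add: P_apply vy if_distrib if_distribR cong: if_cong)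

lemma y_inner_P: "y k \<bullet> (P *v x) = c k * (v k \<bullet> x)"
  by (simp add: P_apply inner_sum_right inner_commute[of "y k"] vy if_distrib if_distribR cong: if_cong)

lemma v_inner_F: "v k \<bullet> (F *v x) = c k * (y k \<bullet> x)"
  by (simp add: F_apply inner_sum_right vy if_distrib if_distribR cong: if_cong)

text \<open>On the range of \<open>P\<close> the map \<open>P F\<close> is diagonal in the basis
  \<open>v\<close> with entries \<open>(c k)\<^sup>2\<close>; any nonzero coordinate of
  \<open>x\<close> reveals the eigenvalue.\<close>

lemma eigenvalue_exists:
  assumes x: "P *v x = x" "x \<noteq> 0" and e: "P *v (F *v x) = \<mu> *\<^sub>R x"
  obtains k where "v k \<bullet> x \<noteq> 0" "(c k)\<^sup>2 = \<mu>"
proof -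
  obtain k where k: "v k \<bullet> x \<noteq> 0"
    using P_apply[of x] x by force
  have "v k \<bullet> (P *v (F *v x)) = (c k)\<^sup>2 * (v k \<bullet> x)"
    using y_inner_P[of k x] x(1) by (simp add: v_inner_P v_inner_F power2_eq_square)
  then have "(c k)\<^sup>2 = \<mu>" using e k by simp
  then show ?thesis using k that by blast
qed

text \<open>Subtracting the multiple of \<open>x\<close> that clears coordinate \<open>k\<close>
  leaves an eigenvector whose nonzero coordinate must have another index.\<close>

lemma double_eigenvalue:
  assumes x: "P *v x = x" "x \<noteq> 0" "P *v (F *v x) = \<mu> *\<^sub>R x"
    and x': "P *v x' = x'" "\<And>r. x' \<noteq> r *\<^sub>R x" "P *v (F *v x') = \<mu> *\<^sub>R x'"
  obtains k l where "k \<noteq> l" "c k = c l"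
proof -
  obtain k where k: "v k \<bullet> x \<noteq> 0" "(c k)\<^sup>2 = \<mu>" using eigenvalue_exists[OF x] .
  define r where "r = (v k \<bullet> x') / (v k \<bullet> x)"
  define z where "z = x' - r *\<^sub>R x"
  have "P *v z = z" "z \<noteq> 0" "P *v (F *v z) = \<mu> *\<^sub>R z"
    using x x' by (simp_all add: z_def matrix_vector.diff_right matrix_vector.scaleR_right algebra_simps)
  then obtain l where l: "v l \<bullet> z \<noteq> 0" "(c l)\<^sup>2 = \<mu>" using eigenvalue_exists by blast
  have "v k \<bullet> z = 0" using k by (simp add: z_def r_def inner_diff_right)
  then have "k \<noteq> l" using l by auto
  moreover have "c k = c l" using k l c0 by (metis power2_eq_iff_nonneg)
  ultimately show ?thesis using that by blast
qed

end

section \<open>From oscillation frequencies to principal angles\<close>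

context geodesic
begin

text \<open>\<open>\<Delta>\<close> exchanges the range and the kernel of \<open>P\<close>, so the
  eigenvector equation splits into its two components.\<close>

lemma tangent_eigenvector:
  assumes "\<Delta> *v u = a *\<^sub>R u"
  shows "\<Delta> *v (P *v u) = a *\<^sub>R (u - P *v u)" "\<Delta> *v (u - P *v u) = a *\<^sub>R (P *v u)"
proof -
  have "\<Delta> *v (P *v u) + P *v (\<Delta> *v u) = \<Delta> *v u"
    using arg_cong[OF tangent_spaceD(2)[OF \<Delta>], of "\<lambda>M. M *v u"]
    by (simp add: matrix_vector.add_left matrix_vector_mul_assoc)
  then show 1: "\<Delta> *v (P *v u) = a *\<^sub>R (u - P *v u)"
    by (simp add: assms matrix_vector.scaleR_right algebra_simps)
  then show "\<Delta> *v (u - P *v u) = a *\<^sub>R (P *v u)"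
    by (simp add: matrix_vector.diff_right assms algebra_simps)
qed

lemma P_idem: "P *v (P *v x) = P *v x"
  by (simp add: matrix_vector_mul_assoc GrD(2)[OF P])

lemma \<Omega>_rotation:
  assumes "\<Delta> *v x = a *\<^sub>R z" "\<Delta> *v z = a *\<^sub>R x" "P *v x = x" "P *v z = 0"
  shows "E t *v x = cos (t * a) *\<^sub>R x + sin (t * a) *\<^sub>R z"
  unfolding E_def
  by (rule matrix_exp_rotation)
     (simp_all add: \<Omega>_def commutator_def matrix_vector.diff_left matrix_vector_mul_assoc[symmetric]
       assms matrix_vector.scaleR_right)

text \<open>\<open>E t\<close> turns the plane of \<open>P u\<close> and \<open>u - P u\<close> by
  the angle \<open>t * a\<close>. One cosine arises from projecting after \<open>E (- t)\<close>,
  the other from projecting after \<open>E t\<close>.\<close>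

lemma PFP_eigenvector:
  assumes "\<Delta> *v u = a *\<^sub>R u"
  shows "P *v (\<gamma> t *v (P *v u)) = (cos (t * a))\<^sup>2 *\<^sub>R (P *v u)"
proof -
  let ?x = "P *v u" and ?z = "u - P *v u"
  have Pz: "P *v ?z = 0" by (simp add: matrix_vector.diff_right P_idem)
  note rot = \<Omega>_rotation[OF tangent_eigenvector[OF assms] P_idem Pz]
  have "\<gamma> t *v ?x = E t *v (P *v (E (- t) *v ?x))"
    by (simp add: \<gamma>_eq matrix_vector_mul_assoc matrix_mul_assoc)
  also have "P *v (E (- t) *v ?x) = cos (t * a) *\<^sub>R ?x"
    unfolding rot by (simp add: matrix_vector.add_right matrix_vector.diff_right matrix_vector.scaleR_right P_idem)
  also have "E t *v (cos (t * a) *\<^sub>R ?x) = cos (t * a) *\<^sub>R (cos (t * a) *\<^sub>R ?x + sin (t * a) *\<^sub>R ?z)"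
    by (simp add: matrix_vector.scaleR_right rot)
  finally show ?thesis
    by (simp add: matrix_vector.add_right matrix_vector.scaleR_right P_idem Pz power2_eq_square)
qed

lemma \<Delta>_sym: "x \<bullet> (\<Delta> *v z) = (\<Delta> *v x) \<bullet> z"
  using inner_matrix_vector[of x \<Delta> z] tangent_spaceD(1)[OF \<Delta>] by (simp del: transpose_matrix_vector)

lemma P_sym: "x \<bullet> (P *v z) = (P *v x) \<bullet> z"
  using inner_matrix_vector[of x P z] GrD(1)[OF P] by (simp del: transpose_matrix_vector)

lemma \<Delta>_P_orthogonal: "P *v x = x \<Longrightarrow> P *v (\<Delta> *v x) = 0"
  using tangent_spaceD_mult(2)[OF P \<Delta>] matrix_vector_mul_assoc[of P "\<Delta> ** P" x]
    matrix_vector_mul_assoc[of \<Delta> P x] by simp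

text \<open>If \<open>n = 2 p\<close>, then \<open>\<Delta>\<close> maps the range of \<open>P\<close> to its kernel, which has the same
  dimension; a vector of the kernel orthogonal to the image yields one of the range killed by \<open>\<Delta>\<close>.\<close>

lemma kernel_vector:
  assumes n: "CARD('n) = 2 * p" and w: "P *v w = 0" "\<Delta> *v w = 0" "w \<noteq> 0"
  obtains x where "P *v x = x" "\<Delta> *v x = 0" "x \<noteq> 0"
proof -
  let ?V = "range (\<lambda>x. P *v x)"
  have V: "x \<in> ?V \<longleftrightarrow> P *v x = x" for x
    using P_idem by (metis rangeE rangeI)
  have sV: "span ?V = ?V" by (simp add: span_eq_iff Gr_subspace)
  have dV: "dim ?V = p" using P by (simp add: Gr_def rank_dim_range)
  \<comment> \<open>Once \<open>w\<close> is added to the range of \<open>P\<close>, the orthogonal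
    complement \<open>?Z\<close> has dimension \<open>2 p - (p + 1) = p - 1\<close>, too small for
    an injective image of the range.\<close>
  let ?A = "span (insert w ?V)" and ?Z = "{z \<in> UNIV. \<forall>x\<in>span (insert w ?V). orthogonal x z}"
  have "w \<notin> span ?V" using w by (simp add: sV V)
  then have dA: "dim ?A = p + 1" by (simp add: dim_insert dV)
  have dZ: "dim ?Z + dim ?A = dim (UNIV :: (real^'n) set)"
    by (rule dim_subspace_orthogonal_to_vectors) auto
  have sub: "(\<lambda>x. \<Delta> *v x) ` ?V \<subseteq> ?Z"
  proof clarify
    fix x0
    define x where "x = P *v x0"
    have x: "P *v x = x" by (simp add: x_def P_idem)
    have o: "orthogonal (\<Delta> *v x) z" if "z \<in> insert w ?V" for z
      using that
    proof
      assume "z = w"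
      then show ?thesis using \<Delta>_sym[of x w] w by (simp add: orthogonal_def)
    next
      assume "z \<in> ?V"
      then have "P *v z = z" by (simp add: V)
      then show ?thesis
        using P_sym[of "\<Delta> *v x" z] \<Delta>_P_orthogonal[OF x] by (simp add: orthogonal_def)
    qed
    then have "orthogonal (\<Delta> *v x) a" if "a \<in> ?A" for a
      using orthogonal_to_span[OF that] by blast
    then have "\<forall>a\<in>?A. orthogonal a (\<Delta> *v x)" by (simp add: orthogonal_commute)
    then show "\<Delta> *v (P *v x0) \<in> UNIV \<and> (\<forall>a\<in>?A. orthogonal a (\<Delta> *v (P *v x0)))"
      by (simp add: x_def)
  qed
  have "\<not> inj_on (\<lambda>x. \<Delta> *v x) (span ?V)"
  proof
    assume "inj_on (\<lambda>x. \<Delta> *v x) (span ?V)"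
    then have "dim ((\<lambda>x. \<Delta> *v x) ` ?V) = p" using dim_image_eq[of "\<lambda>x. \<Delta> *v x" ?V] dV by simp
    then have "p \<le> dim ?Z" using dim_subset[OF sub] by simp
    then show False using dZ dA n by simp
  qed
  then obtain x1 x2 where "x1 \<in> ?V" "x2 \<in> ?V" "\<Delta> *v x1 = \<Delta> *v x2" "x1 \<noteq> x2"
    unfolding sV inj_on_def by blast
  then show ?thesis
    by (intro that[of "x1 - x2"]) (simp_all add: V matrix_vector.diff_right)
qed

text \<open>An eigenvector in the kernel of \<open>P\<close> has eigenvalue 0, as
  \<open>\<Delta>\<close> maps it into the range. The frequency is then \<open>a\<close> alone, so
  \<open>cos (L * a)\<close> is 1 or -1 and \<open>P *v u\<close> accounts for a zero angle. When
  \<open>CARD('n) = 2 * p\<close> one zero angle is not enough, and \<open>kernel_vector\<close>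
  supplies a second.\<close>

lemma angles_kernel_case:
  fixes v y :: "'p::finite \<Rightarrow> real^'n"
  assumes fr: "principal_frames P (\<gamma> L) v y c"
    and p: "p = CARD('p)" and n: "2 * CARD('p) \<le> CARD('n)"
    and w: "P *v w = 0" "\<Delta> *v w = b *\<^sub>R w" "w \<noteq> 0" and u: "\<Delta> *v u = a *\<^sub>R u" "u \<noteq> 0"
    and ab: "a \<noteq> b" "sin ((a - b) * L) = 0"
  shows "(\<exists>k l. k \<noteq> l \<and> c k = c l) \<or> (2 * CARD('p) < CARD('n) \<and> (\<exists>k. c k = 1))"
proof -
  interpret principal_frames P "\<gamma> L" v y c by (rule fr)
  have "b = 0" using tangent_eigenvector(1)[OF w(2)] w by simp
  with ab have a: "a \<noteq> 0" and sa: "sin (L * a) = 0" by (simp_all add: mult.commute)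
  then have cos2: "(cos (L * a))\<^sup>2 = 1" using sin_cos_squared_add[of "L * a"] by simp
  let ?x = "P *v u"
  have ex: "P *v (\<gamma> L *v ?x) = 1 *\<^sub>R ?x" using PFP_eigenvector[OF u(1), of L] cos2 by simp
  have x0: "?x \<noteq> 0" using tangent_eigenvector(1)[OF u(1)] a u(2) by auto
  show ?thesis
  proof (cases "2 * CARD('p) < CARD('n)")
    case True
    obtain k where "(c k)\<^sup>2 = 1" using eigenvalue_exists[OF P_idem x0 ex] .
    then have "c k = 1" using c0[of k] by (simp add: power2_eq_1_iff)
    then show ?thesis using True by blast
  next
    case False
    then have "CARD('n) = 2 * p" using n p by simp
    then obtain x' where x': "P *v x' = x'" "\<Delta> *v x' = 0" "x' \<noteq> 0"
      using kernel_vector w \<open>b = 0\<close> by auto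
    have ex': "P *v (\<gamma> L *v x') = 1 *\<^sub>R x'"
      using PFP_eigenvector[of x' 0 L] x' by simp
    have "x' \<noteq> r *\<^sub>R ?x" for r
    proof
      assume r: "x' = r *\<^sub>R ?x"
      then have "r * a = 0 \<or> u - ?x = 0"
        using x'(2) tangent_eigenvector(1)[OF u(1)] by (auto simp: matrix_vector.scaleR_right)
      moreover have "u - ?x \<noteq> 0" using tangent_eigenvector(2)[OF u(1)] x0 a by auto
      ultimately show False using r x'(3) a by auto
    qed
    then obtain k l where "k \<noteq> l" "c k = c l"
      by (rule double_eigenvalue[OF P_idem x0 ex x'(1) _ ex'])
    then show ?thesis by blast
  qed
qed

lemma conjugate_imp_angles:
  fixes v y :: "'p::finite \<Rightarrow> real^'n"
  assumes fr: "principal_frames P (\<gamma> L) v y c"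
    and p: "p = CARD('p)" and n: "2 * CARD('p) \<le> CARD('n)"
    and K: "K \<in> tangent_space P" and u: "\<Delta> *v u = a *\<^sub>R u" and w: "\<Delta> *v w = b *\<^sub>R w"
    and uKw: "u \<bullet> (K *v w) \<noteq> 0" and ab: "a \<noteq> b" "sin ((a - b) * L) = 0"
  shows "(\<exists>k l. k \<noteq> l \<and> c k = c l) \<or> (2 * CARD('p) < CARD('n) \<and> (\<exists>k. c k = 1))"
proof -
  interpret principal_frames P "\<gamma> L" v y c by (rule fr)
  have nz: "u \<noteq> 0" "w \<noteq> 0" using uKw by auto
  have Ksym: "x \<bullet> (K *v z) = (K *v x) \<bullet> z" for x z
    using inner_matrix_vector[of x K z] tangent_spaceD(1)[OF K] by (simp del: transpose_matrix_vector)
  have KP: "K *v (P *v x) + P *v (K *v x) = K *v x" for x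
    using arg_cong[OF tangent_spaceD(2)[OF K], of "\<lambda>M. M *v x"]
    by (simp add: matrix_vector.add_left matrix_vector_mul_assoc)
  have ba: "b \<noteq> a" "sin ((b - a) * L) = 0"
    using ab sin_minus[of "(a - b) * L"] by (simp_all add: algebra_simps)
  consider "P *v w = 0" | "P *v u = 0" | "P *v w \<noteq> 0" "P *v u \<noteq> 0" by blast
  then show ?thesis
  proof cases
    case 1
    then show ?thesis using angles_kernel_case[OF fr p n _ w nz(2) u nz(1) ab] by blast
  next
    case 2
    then show ?thesis using angles_kernel_case[OF fr p n _ u nz(1) w nz(2) ba] by blast
  next
    case 3
    have "cos (L * a) = cos (L * b) * cos ((a - b) * L)"
      using cos_add[of "L * b" "(a - b) * L"] ab(2) by (simp add: algebra_simps)
    moreover have "(cos ((a - b) * L))\<^sup>2 = 1" using sin_cos_squared_add[of "(a - b) * L"] ab(2) by simp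
    ultimately have cc: "(cos (L * a))\<^sup>2 = (cos (L * b))\<^sup>2" by (simp add: power_mult_distrib)
    note eu = PFP_eigenvector[OF u, of L, unfolded cc] and ew = PFP_eigenvector[OF w, of L]
    have "P *v w \<noteq> r *\<^sub>R (P *v u)" for r
    proof
      assume r: "P *v w = r *\<^sub>R (P *v u)"
      \<comment> \<open>Applying \<open>\<Delta>\<close> twice preserves the range of
        \<open>P\<close>. Proportional vectors there force \<open>a\<^sup>2 = b\<^sup>2\<close>, and
        since \<open>a\<close> and \<open>b\<close> differ, \<open>b = - a\<close>.\<close>
      have sq: "\<Delta> *v (\<Delta> *v (P *v z)) = (d * d) *\<^sub>R (P *v z)" if "\<Delta> *v z = d *\<^sub>R z" for z d
        by (simp add: tangent_eigenvector[OF that] matrix_vector.scaleR_right)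
      have "(b * b) *\<^sub>R (P *v w) = r *\<^sub>R (\<Delta> *v (\<Delta> *v (P *v u)))"
        unfolding sq[OF w, symmetric] by (simp only: r matrix_vector.scaleR_right)
      also have "\<dots> = (a * a) *\<^sub>R (P *v w)" by (simp add: sq[OF u] r)
      finally have "b * b = a * a" using 3 by simp
      then have b: "b = - a" using ab(1) by (simp add: square_eq_iff)
      then have a: "a \<noteq> 0" using ab(1) by auto
      have "b *\<^sub>R (w - P *v w) = (r * a) *\<^sub>R (u - P *v u)"
        using tangent_eigenvector(1)[OF w] tangent_eigenvector(1)[OF u] by (simp add: r matrix_vector.scaleR_right)
      then have "a *\<^sub>R (w - P *v w + r *\<^sub>R (u - P *v u)) = 0" by (simp add: b algebra_simps)
      then have "w - P *v w + r *\<^sub>R (u - P *v u) = 0" using a by simp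
      \<comment> \<open>Up to the factor \<open>r\<close>, this is the reflection
        \<open>2 P - 1\<close> applied to \<open>u\<close>, and the entry of \<open>K\<close>
        between \<open>u\<close> and its reflection vanishes.\<close>
      then have "w = r *\<^sub>R (P *v u + (P *v u - u))" by (simp add: r algebra_simps add_eq_0_iff)
      from arg_cong[OF this, of "\<lambda>x. u \<bullet> (K *v x)"]
      have "u \<bullet> (K *v w) = r * (u \<bullet> (K *v (P *v u)) + (u \<bullet> (K *v (P *v u)) - u \<bullet> (K *v u)))"
        by (simp only: matrix_vector.scaleR_right matrix_vector.add_right matrix_vector.diff_right
            inner_scaleR_right inner_add_right inner_diff_right)
      also have "u \<bullet> (K *v u) = u \<bullet> (K *v (P *v u)) + u \<bullet> (P *v (K *v u))"
        using arg_cong[OF KP[of u], of "\<lambda>x. u \<bullet> x"] by (simp add: inner_add_right)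
      also have "u \<bullet> (P *v (K *v u)) = u \<bullet> (K *v (P *v u))"
        using P_sym[of u "K *v u"] Ksym[of u "P *v u"] by (simp add: inner_commute)
      finally show False using uKw by simp
    qed
    then obtain k l where "k \<noteq> l" "c k = c l"
      by (rule double_eigenvalue[OF P_idem 3(2) eu P_idem _ ew])
    then show ?thesis by blast
  qed
qed

text \<open>The frequency is normalized to \<open>pi\<close> on the interval from 0 to 1, so the
  sine vanishes at both ends and equals 1 at the midpoint.\<close>

lemma conjugate_locusI:
  assumes K: "K \<in> tangent_space P" "K \<noteq> 0"
    and eig: "commutator (commutator K \<Delta>) \<Delta> = (pi * pi) *\<^sub>R K"
  shows "\<gamma> 1 \<in> conjugate_locus p P"
proof -
  let ?J = "\<lambda>t. sin (pi * t) *\<^sub>R (E t ** K ** E (- t))"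
  have "\<Delta> \<noteq> 0" using eig K(2) by (auto simp: commutator_def)
  moreover have "Exp_Gr P (1 *\<^sub>R \<Delta>) = \<gamma> 1" by (simp add: \<gamma>_def)
  moreover have "jacobi_field p (\<lambda>t. Exp_Gr P (t *\<^sub>R \<Delta>)) {0..1} ?J"
    using jacobi_field_sin[OF _ K(1) eig, of 1] unfolding \<gamma>_def[abs_def] by simp
  moreover have "?J (1/2) \<noteq> 0"
  proof
    assume "?J (1/2) = 0"
    then have "E (1/2) ** K ** E (- (1/2)) = 0" by simp
    then have "E (- (1/2)) ** (E (1/2) ** K ** E (- (1/2))) ** E (1/2) = 0" by simp
    then show False using K(2) by (simp add: matrix_algebra E_inverse E_inverse')
  qed
  then have "\<exists>t\<in>{0..1}. ?J t \<noteq> 0" by (intro bexI[of _ "1/2"]) auto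
  moreover have "?J 0 = 0" "?J 1 = 0" by simp_all
  ultimately show ?thesis
    unfolding conjugate_locus_def using \<Delta> \<gamma>_Gr[of 1]
    by (intro CollectI conjI bexI[of _ \<Delta>] exI[of _ "1::real"] exI[of _ ?J]) auto
qed

end

lemma orthonormal_matrix_nonzero:
  fixes u :: "'n::finite \<Rightarrow> real^'n" and M :: "real^'n^'n"
  assumes u: "orthonormal_on UNIV u" and M: "M \<noteq> 0"
  obtains i j where "u i \<bullet> (M *v u j) \<noteq> 0"
proof (rule ccontr)
  assume "\<not> thesis"
  then have z: "u i \<bullet> (M *v u j) = 0" for i j using that by blast
  have expand: "x = (\<Sum>k\<in>UNIV. (u k \<bullet> x) *\<^sub>R u k)" for x
    by (rule orthonormal_expand[OF u, where V=UNIV]) auto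
  have "M *v u j = 0" for j using expand[of "M *v u j"] by (simp add: z)
  then have "M *v x = 0" for x
    using arg_cong[OF expand[of x], of "\<lambda>x. M *v x"] by (simp add: matrix_vector.sum_right matrix_vector.scaleR_right)
  then have "M = 0" by (simp add: matrix_eq)
  then show False using M by simp
qed

section \<open>Geodesics through principal frames and the two inclusions\<close>

context principal_frames
begin

lemma tangent_outer:
  assumes "P \<in> Gr p" "P *v a = a" "P *v b = 0"
  shows "outer a b + outer b a \<in> tangent_space P"
  unfolding tangent_space_def
  by (simp add: transpose_algebra transpose_outer matrix_mult.add_left matrix_mult.add_right
      outer_matrix_mult matrix_mult_outer GrD(1)[OF assms(1)] assms del: transpose_matrix_vector)

text \<open>\<open>w k\<close> is the direction of the part of \<open>y k\<close> orthogonal to the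
  range of \<open>P\<close>, whose length is the sine of the angle. Where the sine is zero,
  \<open>w k\<close> is completed inside the kernel of \<open>P\<close>, which has room because its
  dimension \<open>CARD('n) - CARD('p)\<close> is at least \<open>CARD('p)\<close>.\<close>

lemma complementary_frame:
  assumes n: "2 * CARD('p) \<le> CARD('n)" and P: "P \<in> Gr CARD('p)"
  obtains w :: "'p \<Rightarrow> real^'n" where "orthonormal_on UNIV w" "\<forall>k. P *v w k = 0"
    "\<forall>k. y k = c k *\<^sub>R v k + sqrt (1 - (c k)\<^sup>2) *\<^sub>R w k" "dim {x. P *v x = 0} = CARD('n) - CARD('p)"
proof -
  let ?V = "{x. P *v x = 0}"
  have sV: "subspace ?V" by (auto simp: subspace_def matrix_vector.add_right matrix_vector.scaleR_right)
  have sym: "x \<bullet> (P *v z) = (P *v x) \<bullet> z" for x z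
    using inner_matrix_vector[of x P z] GrD(1)[OF P] by (simp del: transpose_matrix_vector)
  have idem: "P *v (P *v x) = P *v x" for x by (simp add: matrix_vector_mul_assoc GrD(2)[OF P])
  let ?R = "range (\<lambda>x. P *v x)"
  have "dim {z \<in> UNIV. \<forall>x\<in>?R. orthogonal x z} + dim ?R = dim (UNIV :: (real^'n) set)"
    by (rule dim_subspace_orthogonal_to_vectors) (auto simp: Gr_subspace)
  moreover have "{z \<in> UNIV. \<forall>x\<in>?R. orthogonal x z} = ?V"
  proof -
    have "(\<forall>x. orthogonal (P *v x) z) \<longleftrightarrow> P *v z = 0" for z
      using sym[of _ z] idem[of z] by (auto simp: orthogonal_def) (metis inner_eq_zero_iff sym idem)
    then show ?thesis by auto
  qed
  moreover have "dim ?R = CARD('p)" using P by (simp add: Gr_def rank_dim_range)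
  ultimately have dV: "dim ?V = CARD('n) - CARD('p)" by simp
  define s where "s k = sqrt (1 - (c k)\<^sup>2)" for k
  have c2: "(c k)\<^sup>2 \<le> 1" for k using c0 c1 by (simp add: power_le_one)
  have ss: "s k * s k = 1 - (c k)\<^sup>2" for k using c2[of k] by (simp add: s_def)
  define z where "z k = y k - c k *\<^sub>R v k" for k
  have zz: "z k \<bullet> z l = (if k = l then s k * s k else 0)" for k l
    unfolding ss using vy[of k l] vy[of l k]
    by (simp add: z_def inner_diff_left inner_diff_right y_inner v_inner vy inner_commute[of "y k" "v l"] power2_eq_square)
  have Pz: "P *v z k = 0" for k by (simp add: z_def matrix_vector.diff_right matrix_vector.scaleR_right P_y P_v)
  define I where "I = {k. s k \<noteq> 0}"
  have o: "orthonormal_on I (\<lambda>k. (1 / s k) *\<^sub>R z k)"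
    unfolding orthonormal_on_def by (auto simp: I_def zz)
  have m: "(1 / s k) *\<^sub>R z k \<in> ?V" if "k \<in> I" for k by (simp add: matrix_vector.scaleR_right Pz)
  have d: "CARD('p) \<le> dim ?V" using n dV by simp
  have "\<exists>w :: 'p \<Rightarrow> real^'n. orthonormal_on UNIV w \<and> (\<forall>k. w k \<in> ?V) \<and> (\<forall>k\<in>I. w k = (1 / s k) *\<^sub>R z k)"
    by (rule orthonormal_extend[OF sV o m d]) blast+
  then obtain w :: "'p \<Rightarrow> real^'n" where w: "orthonormal_on UNIV w" "\<And>k. w k \<in> ?V"
    "\<And>k. k \<in> I \<Longrightarrow> w k = (1 / s k) *\<^sub>R z k"
    by blast
  have "z k = s k *\<^sub>R w k" for k
  proof (cases "k \<in> I")
    case False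
    then have "z k = 0" using zz[of k k] by (simp add: I_def)
    then show ?thesis using False by (simp add: I_def)
  qed (simp add: w I_def)
  then have "y k = c k *\<^sub>R v k + s k *\<^sub>R w k" for k by (metis z_def diff_add_cancel add.commute)
  then show ?thesis using that[OF w(1) _ _ dV] w(2) by (simp add: s_def)
qed

text \<open>The geodesic turns each \<open>v k\<close> by the angle \<open>\<phi> k\<close> towards
  \<open>w k\<close>. Reaching \<open>y k\<close> up to a sign \<open>e k\<close> is enough, since
  \<open>F\<close> is quadratic in the frame; this freedom is what allows \<open>pi\<close> to be
  added to an angle.\<close>

lemma geodesic_through_frames:
  fixes w :: "'p \<Rightarrow> real^'n" and \<phi> :: "'p \<Rightarrow> real"
  assumes P: "P \<in> Gr p" and w: "orthonormal_on UNIV w" "\<And>k. P *v w k = 0"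
    and yw: "\<And>k. y k = c k *\<^sub>R v k + s k *\<^sub>R w k"
    and \<phi>: "\<And>k. cos (\<phi> k) = e k * c k" "\<And>k. sin (\<phi> k) = e k * s k" "\<And>k. e k * e k = 1"
  defines "\<Delta> \<equiv> \<Sum>k\<in>UNIV. \<phi> k *\<^sub>R (outer (w k) (v k) + outer (v k) (w k))"
  shows "\<Delta> \<in> tangent_space P" "\<And>k. \<Delta> *v v k = \<phi> k *\<^sub>R w k" "\<And>k. \<Delta> *v w k = \<phi> k *\<^sub>R v k"
    "\<And>x. (\<And>k. v k \<bullet> x = 0) \<Longrightarrow> (\<And>k. w k \<bullet> x = 0) \<Longrightarrow> \<Delta> *v x = 0"
    "geodesic.\<gamma> P \<Delta> 1 = F"
proof -
  have PT: "transpose P = P" by (rule GrD(1)[OF P])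
  have vw: "v k \<bullet> w l = 0" for k l
    using inner_matrix_vector[of "v k" P "w l"] by (simp add: PT P_v w del: transpose_matrix_vector)
  have wi: "w k \<bullet> w l = (if k = l then 1 else 0)" for k l using orthonormal_onD[OF w(1)] by simp
  have \<Delta>_apply: "\<Delta> *v x = (\<Sum>k\<in>UNIV. \<phi> k *\<^sub>R ((v k \<bullet> x) *\<^sub>R w k + (w k \<bullet> x) *\<^sub>R v k))" for x
    by (simp add: \<Delta>_def matrix_vector.sum_left matrix_vector.scaleR_left matrix_vector.add_left outer_vector)
  show \<Delta>v: "\<Delta> *v v k = \<phi> k *\<^sub>R w k" for k
    by (simp add: \<Delta>_apply v_inner vw inner_commute[of "w _" "v _"] if_distrib if_distribR cong: if_cong)
  show \<Delta>w: "\<Delta> *v w k = \<phi> k *\<^sub>R v k" for k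
    by (simp add: \<Delta>_apply wi vw if_distrib if_distribR cong: if_cong)
  show "\<Delta> *v x = 0" if "\<And>k. v k \<bullet> x = 0" "\<And>k. w k \<bullet> x = 0" for x
    by (simp add: \<Delta>_apply that)
  have summand: "outer (w k) (v k) + outer (v k) (w k) \<in> tangent_space P" for k
    using tangent_outer[OF P P_v w(2)] by (simp add: add.commute)
  show T: "\<Delta> \<in> tangent_space P"
    unfolding \<Delta>_def by (intro subspace_sum[OF subspace_tangent_space] tangent_space_scaleR summand)
  interpret geodesic p P \<Delta> by unfold_locales (fact P T)+
  have "E 1 *v v k = e k *\<^sub>R y k" for k
    using \<Omega>_rotation[OF \<Delta>v \<Delta>w P_v w(2), of 1 k] by (simp add: \<phi> yw scaleR_add_right)
  moreover have "\<gamma> 1 = (\<Sum>k\<in>UNIV. outer (E 1 *v v k) (E 1 *v v k))"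
  proof -
    have "\<gamma> 1 = (\<Sum>k\<in>UNIV. E 1 ** outer (v k) (v k) ** transpose (E 1))"
      unfolding \<gamma>_eq transpose_E by (subst P_eq) (simp add: matrix_mult.sum_left matrix_mult.sum_right)
    then show ?thesis by (simp add: matrix_mult_outer outer_matrix_mult del: transpose_matrix_vector)
  qed
  moreover have "outer (e k *\<^sub>R y k) (e k *\<^sub>R y k) = outer (y k) (y k)" for k
  proof -
    have "e k * a * (e k * b) = a * b" for a b
      using \<phi>(3)[of k] by (metis mult.assoc mult.left_commute mult_1)
    then show ?thesis by (simp add: outer_def vec_eq_iff)
  qed
  ultimately show "\<gamma> 1 = F" by (simp add: F_eq)
qed

lemma angles_imp_conjugate:
  assumes P: "P \<in> Gr CARD('p)" and n: "2 * CARD('p) \<le> CARD('n)"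
    and angles: "(\<exists>k l. k \<noteq> l \<and> c k = c l) \<or> (2 * CARD('p) < CARD('n) \<and> (\<exists>k. c k = 1))"
  shows "F \<in> conjugate_locus CARD('p) P"
proof -
  obtain w :: "'p \<Rightarrow> real^'n" where w': "orthonormal_on UNIV w" "\<forall>k. P *v w k = 0"
    and yw: "\<forall>k. y k = c k *\<^sub>R v k + sqrt (1 - (c k)\<^sup>2) *\<^sub>R w k"
    and dV: "dim {x. P *v x = 0} = CARD('n) - CARD('p)"
    using complementary_frame[OF n P] .
  note w = w'(1) w'(2)[rule_format] and yw = yw[rule_format]
  have PT: "transpose P = P" by (rule GrD(1)[OF P])
  have vw: "v k \<bullet> w l = 0" for k l
    using inner_matrix_vector[of "v k" P "w l"] by (simp add: PT P_v w del: transpose_matrix_vector)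
  have wi: "w k \<bullet> w l = (if k = l then 1 else 0)" for k l using orthonormal_onD[OF w(1)] by simp
  note tan = tangent_outer[OF P]
  \<comment> \<open>Both cases use one geodesic: the angle with index \<open>i\<close> is enlarged
    by \<open>pi\<close>, all others stay. They differ only in the initial direction
    \<open>K\<close>.\<close>
  have conj: "F \<in> conjugate_locus CARD('p) P"
    if K: "K \<in> tangent_space P" "K \<noteq> 0"
      and eig: "\<And>\<Delta>. \<Delta> \<in> tangent_space P \<Longrightarrow>
        (\<And>k. \<Delta> *v v k = (arccos (c k) + (if k = i then pi else 0)) *\<^sub>R w k) \<Longrightarrow>
        (\<And>k. \<Delta> *v w k = (arccos (c k) + (if k = i then pi else 0)) *\<^sub>R v k) \<Longrightarrow>
        (\<And>x. (\<And>k. v k \<bullet> x = 0) \<Longrightarrow> (\<And>k. w k \<bullet> x = 0) \<Longrightarrow> \<Delta> *v x = 0) \<Longrightarrow>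
        commutator (commutator K \<Delta>) \<Delta> = (pi * pi) *\<^sub>R K"
    for K i
  proof -
    let ?\<phi> = "\<lambda>k. arccos (c k) + (if k = i then pi else 0)" and ?e = "\<lambda>k. if k = i then - 1 else 1 :: real"
    have cc: "\<bar>c k\<bar> \<le> 1" for k using c0[of k] c1[of k] by simp
    have "cos (arccos (c k)) = c k" for k using c0[of k] c1[of k] by (simp add: cos_arccos)
    then have cos: "cos (?\<phi> k) = ?e k * c k" for k by simp
    have sin: "sin (?\<phi> k) = ?e k * sqrt (1 - (c k)\<^sup>2)" for k
      using c0[of k] c1[of k] by (simp add: sin_arccos_abs cc)
    define \<Delta> where "\<Delta> = (\<Sum>k\<in>UNIV. ?\<phi> k *\<^sub>R (outer (w k) (v k) + outer (v k) (w k)))"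
    note g = geodesic_through_frames[OF P w yw cos sin, folded \<Delta>_def]
    have e1: "?e k * ?e k = 1" for k by simp
    interpret geodesic "CARD('p)" P \<Delta> by unfold_locales (rule P g(1)[OF e1])+
    have "commutator (commutator K \<Delta>) \<Delta> = (pi * pi) *\<^sub>R K"
      by (rule eig[OF g(1)[OF e1] g(2)[OF e1] g(3)[OF e1] g(4)[OF e1]])
    from conjugate_locusI[OF K this] show ?thesis using g(5)[OF e1] by simp
  qed
  have double: "commutator (commutator (outer a b) \<Delta>) \<Delta>
     = outer a (\<Delta> *v (\<Delta> *v b)) - 2 *\<^sub>R outer (\<Delta> *v a) (\<Delta> *v b) + outer (\<Delta> *v (\<Delta> *v a)) b"
    if "\<Delta> \<in> tangent_space P" for \<Delta> :: "real^'n^'n" and a b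
    unfolding commutator_def scaleR_2
    by (simp add: matrix_mult.diff_left matrix_mult.diff_right outer_matrix_mult matrix_mult_outer
        matrix_mul_assoc tangent_spaceD(1)[OF that] del: transpose_matrix_vector)
  have cadd: "commutator (commutator (A + B) \<Delta>) \<Delta> = commutator (commutator A \<Delta>) \<Delta> + commutator (commutator B \<Delta>) \<Delta>"
    for A B \<Delta> :: "real^'n^'n"
    by (simp add: commutator_def matrix_algebra)

  from angles show ?thesis
  proof
    assume "\<exists>k l. k \<noteq> l \<and> c k = c l"
    then obtain i j where ij: "i \<noteq> j" "c i = c j" by blast
    \<comment> \<open>Let \<alpha> and \<beta> be the angles turned in the planes of
      \<open>i\<close> and \<open>j\<close>. The double commutator multiplies
      \<open>outer (v i) (w j)\<close> by \<open>\<alpha>\<^sup>2 + \<beta>\<^sup>2\<close> and adds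
      \<open>- 2 \<alpha> \<beta>\<close> times \<open>outer (w i) (v j)\<close>. Their sum is thus
      an eigenvector for \<open>(\<alpha> - \<beta>)\<^sup>2\<close>, and transposes are added for
      symmetry.\<close>
    let ?K = "(outer (v i) (w j) + outer (w j) (v i)) + (outer (v j) (w i) + outer (w i) (v j))"
    show ?thesis
    proof (rule conj[of ?K i])
      show "?K \<in> tangent_space P"
        by (intro tangent_space_add tan P_v w)
      have "?K *v w j = v i"
        using ij by (simp add: matrix_vector.add_left outer_vector wi vw)
      moreover have "v i \<noteq> 0" using v_inner[of i i] by auto
      ultimately show "?K \<noteq> 0" by auto
    next
      fix \<Delta> :: "real^'n^'n"
      assume T: "\<Delta> \<in> tangent_space P"
        and "\<And>k. \<Delta> *v v k = (arccos (c k) + (if k = i then pi else 0)) *\<^sub>R w k"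
          "\<And>k. \<Delta> *v w k = (arccos (c k) + (if k = i then pi else 0)) *\<^sub>R v k"
      moreover define \<alpha> \<beta> where "\<alpha> = arccos (c i) + pi" and "\<beta> = arccos (c i)"
      ultimately have d: "\<Delta> *v v i = \<alpha> *\<^sub>R w i" "\<Delta> *v w i = \<alpha> *\<^sub>R v i"
        "\<Delta> *v v j = \<beta> *\<^sub>R w j" "\<Delta> *v w j = \<beta> *\<^sub>R v j"
        using ij by simp_all
      have "commutator (commutator ?K \<Delta>) \<Delta> = ((\<alpha> - \<beta>) * (\<alpha> - \<beta>)) *\<^sub>R ?K"
        unfolding cadd double[OF T]
        by (simp add: d matrix_vector.scaleR_right outer_scaleR algebra_simps)
      then show "commutator (commutator ?K \<Delta>) \<Delta> = (pi * pi) *\<^sub>R ?K"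
        by (simp add: \<alpha>_def \<beta>_def)
    qed
  next
    assume a: "2 * CARD('p) < CARD('n) \<and> (\<exists>k. c k = 1)"
    then obtain i where i: "c i = 1" by blast
    \<comment> \<open>For \<open>CARD('n) > 2 * CARD('p)\<close> the kernel of \<open>P\<close> has
      a unit vector \<open>z\<close> orthogonal to all \<open>w k\<close>. As
      \<open>\<Delta>\<close> kills \<open>z\<close>, the angle 0 of \<open>v i\<close>, enlarged to
      \<open>pi\<close>, is itself the frequency between the two.\<close>
    have "card (range w) \<le> CARD('p)" by (rule card_image_le) simp
    then have card: "card (range w) < dim {x. P *v x = 0}" using a dV by linarith
    have sub: "subspace {x. P *v x = 0}" "range w \<subseteq> {x. P *v x = 0}"
      using w(2) by (auto simp: subspace_def matrix_vector.add_right matrix_vector.scaleR_right)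
    have "\<exists>z. z \<in> {x. P *v x = 0} \<and> norm z = 1 \<and> (\<forall>s\<in>range w. s \<bullet> z = 0)"
      by (rule unit_vector_orthogonal[OF sub _ card]) (simp, blast)
    then obtain z where z: "P *v z = 0" "norm z = 1" "\<And>k. w k \<bullet> z = 0"
      by auto
    have vz: "v k \<bullet> z = 0" for k
      using inner_matrix_vector[of "v k" P z] by (simp add: PT P_v z del: transpose_matrix_vector)
    let ?K = "outer (v i) z + outer z (v i)"
    show ?thesis
    proof (rule conj[of ?K i])
      show "?K \<in> tangent_space P" by (intro tan P_v z)
      have "?K *v z = v i"
        using z(2) by (simp add: matrix_vector.add_left outer_vector vz dot_square_norm)
      moreover have "v i \<noteq> 0" using v_inner[of i i] by auto
      ultimately show "?K \<noteq> 0" by auto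
    next
      fix \<Delta> :: "real^'n^'n"
      assume T: "\<Delta> \<in> tangent_space P"
        and "\<And>k. \<Delta> *v v k = (arccos (c k) + (if k = i then pi else 0)) *\<^sub>R w k"
          "\<And>k. \<Delta> *v w k = (arccos (c k) + (if k = i then pi else 0)) *\<^sub>R v k"
        and "\<And>x. (\<And>k. v k \<bullet> x = 0) \<Longrightarrow> (\<And>k. w k \<bullet> x = 0) \<Longrightarrow> \<Delta> *v x = 0"
      then have d: "\<Delta> *v v i = pi *\<^sub>R w i" "\<Delta> *v w i = pi *\<^sub>R v i" "\<Delta> *v z = 0"
        using i z vz by simp_all
      show "commutator (commutator ?K \<Delta>) \<Delta> = (pi * pi) *\<^sub>R ?K"
        unfolding cadd double[OF T]
        by (simp add: d matrix_vector.scaleR_right outer_scaleR algebra_simps)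
    qed
  qed
qed

text \<open>Pulling \<open>J\<close> back to \<open>P\<close> at a time where it is nonzero singles
  out a pair of eigenvectors with a nonzero entry. The corresponding component of \<open>J\<close>
  is a nontrivial oscillation with zeros at both ends, which yields the frequency condition.\<close>

lemma conjugate_imp_angles_eq:
  assumes P: "P \<in> Gr CARD('p)" and n: "2 * CARD('p) \<le> CARD('n)" and F: "F \<in> conjugate_locus CARD('p) P"
  shows "(\<exists>k l. k \<noteq> l \<and> c k = c l) \<or> (2 * CARD('p) < CARD('n) \<and> (\<exists>k. c k = 1))"
proof -
  obtain \<Delta> L J t where T: "\<Delta> \<in> tangent_space P" and L: "0 < L" and FL: "Exp_Gr P (L *\<^sub>R \<Delta>) = F"
    and J0: "jacobi_field CARD('p) (\<lambda>t. Exp_Gr P (t *\<^sub>R \<Delta>)) {0..L} J"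
    and t: "t \<in> {0..L}" "J t \<noteq> 0" and ends: "J 0 = 0" "J L = 0"
    using F unfolding conjugate_locus_def by blast
  interpret g: geodesic "CARD('p)" P \<Delta> by unfold_locales (fact P T)+
  have J: "jacobi_field CARD('p) g.\<gamma> {0..L} J" using J0 by (simp add: g.\<gamma>_def[abs_def])
  have JT: "J t \<in> tangent_space (g.\<gamma> t)"
    using J t(1) unfolding g.jacobi_field_iff[OF L] field_along_def by blast
  define K where "K = g.E (- t) ** J t ** g.E t"
  have K: "K \<in> tangent_space P" unfolding K_def by (rule g.conj_tangent_inv[OF JT])
  have "K \<noteq> 0"
  proof
    assume "K = 0"
    then have "g.E t ** K ** g.E (- t) = 0" by simp
    then show False using t(2) by (simp add: K_def matrix_algebra g.E_inverse g.E_inverse')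
  qed
  obtain u :: "'n \<Rightarrow> real^'n" and l where u: "orthonormal_on UNIV u" and ev: "\<And>i. \<Delta> *v u i = l i *\<^sub>R u i"
    using symmetric_matrix_eigenbasis[OF tangent_spaceD(1)[OF T]] by blast
  obtain i j where ij: "u i \<bullet> (K *v u j) \<noteq> 0" using orthonormal_matrix_nonzero[OF u \<open>K \<noteq> 0\<close>] .
  let ?f = "\<lambda>t. (g.E t *v u i) \<bullet> (J t *v (g.E t *v u j))"
  have "?f t = u i \<bullet> (K *v u j)"
    using inner_matrix_vector[of "u i" "g.E (- t)" "J t *v (g.E t *v u j)"]
    by (simp add: K_def matrix_vector_mul_assoc[symmetric] g.transpose_E del: transpose_matrix_vector)
  then have ft: "?f t \<noteq> 0" using ij by simp
  have "(l i - l j) \<noteq> 0 \<and> sin ((l i - l j) * L) = 0"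
    by (rule oscillator_zeros[OF L g.jacobi_field_component(1)[OF L J _ ev ev]
          g.jacobi_field_component(2)[OF L J _ ev ev] _ _ t(1) ft]) (simp_all add: ends)
  then have ab: "l i \<noteq> l j" "sin ((l i - l j) * L) = 0" by simp_all
  have "g.\<gamma> L = F" using FL by (simp add: g.\<gamma>_def)
  then have fr: "principal_frames P (g.\<gamma> L) v y c" using principal_frames_axioms by simp
  show ?thesis by (rule g.conjugate_imp_angles[OF fr refl n K ev ev ij ab])
qed

end

theorem theorem7p2:
  fixes P :: "real^'n^'n"
  assumes "CARD('n) \<ge> 2"
    and "2 * CARD('p::finite) \<le> CARD('n)"
    and "P \<in> Gr CARD('p)"
  shows "conjugate_locus CARD('p) P =
    {F \<in> Gr CARD('p).
      (\<exists>i<CARD('p). \<exists>j<CARD('p). i \<noteq> j \<and>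
         principal_angles TYPE('p) P F ! i = principal_angles TYPE('p) P F ! j) \<or>
      (2 * CARD('p) < CARD('n) \<and> (\<exists>k<CARD('p). principal_angles TYPE('p) P F ! k = 0))}"
proof (intro equalityI subsetI)
  fix F assume F: "F \<in> conjugate_locus CARD('p) P"
  then have FG: "F \<in> Gr CARD('p)" by (simp add: conjugate_locus_def)
  obtain v y :: "'p \<Rightarrow> real^'n" and c where f: "principal_frames P F v y c"
    and a: "(\<exists>i<CARD('p). \<exists>j<CARD('p). i \<noteq> j \<and>
         principal_angles TYPE('p) P F ! i = principal_angles TYPE('p) P F ! j) \<longleftrightarrow> (\<exists>k l. k \<noteq> l \<and> c k = c l)"
      "(\<exists>k<CARD('p). principal_angles TYPE('p) P F ! k = 0) \<longleftrightarrow> (\<exists>k. c k = 1)"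
    using principal_vectors[OF assms(3) FG] .
  from principal_frames.conjugate_imp_angles_eq[OF f assms(3,2) F]
  show "F \<in> {F \<in> Gr CARD('p).
      (\<exists>i<CARD('p). \<exists>j<CARD('p). i \<noteq> j \<and>
         principal_angles TYPE('p) P F ! i = principal_angles TYPE('p) P F ! j) \<or>
      (2 * CARD('p) < CARD('n) \<and> (\<exists>k<CARD('p). principal_angles TYPE('p) P F ! k = 0))}"
    using FG unfolding mem_Collect_eq a by simp
next
  fix F assume F: "F \<in> {F \<in> Gr CARD('p).
      (\<exists>i<CARD('p). \<exists>j<CARD('p). i \<noteq> j \<and>
         principal_angles TYPE('p) P F ! i = principal_angles TYPE('p) P F ! j) \<or>
      (2 * CARD('p) < CARD('n) \<and> (\<exists>k<CARD('p). principal_angles TYPE('p) P F ! k = 0))}"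
  then have FG: "F \<in> Gr CARD('p)" by simp
  obtain v y :: "'p \<Rightarrow> real^'n" and c where f: "principal_frames P F v y c"
    and a: "(\<exists>i<CARD('p). \<exists>j<CARD('p). i \<noteq> j \<and>
         principal_angles TYPE('p) P F ! i = principal_angles TYPE('p) P F ! j) \<longleftrightarrow> (\<exists>k l. k \<noteq> l \<and> c k = c l)"
      "(\<exists>k<CARD('p). principal_angles TYPE('p) P F ! k = 0) \<longleftrightarrow> (\<exists>k. c k = 1)"
    using principal_vectors[OF assms(3) FG] .
  have "(\<exists>k l. k \<noteq> l \<and> c k = c l) \<or> (2 * CARD('p) < CARD('n) \<and> (\<exists>k. c k = 1))"
    using F unfolding mem_Collect_eq a by simp
  then show "F \<in> conjugate_locus CARD('p) P"
    by (rule principal_frames.angles_imp_conjugate[OF f assms(3,2)])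
qed

end
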